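(* Let $d\ge 1$, let $L_i<R_i$ be real numbers for $i=1,\dots,d$, and let $D=(L_1,R_1)\times\cdots\times(L_d,R_d)$ with closure $\bar D$. Let $\mathbf f=(f_1,\dots,f_d)$ and $\mathbf g=(g_1,\dots,g_d)$ belong to $C^1(\bar D;\mathbb R^d)$ and suppose that for every $i\in\{1,\dots,d\}$ and every $\mathbf y\in\bar D$ $$f_i(\Pi_i^{L_i}(\mathbf y))\ge 0,\qquad f_i(\Pi_i^{R_i}(\mathbf y))\le 0 .$$ Set $G_i(\mathbf y)=g_i(\mathbf y)(y_i-L_i)(R_i-y_i)$ and let $\mathbf X_0=(X_{1,0},\dots,X_{d,0})\in D$. Then the system of Itô stochastic differential equations $$dX_i(t)=f_i(\mathbf X(t))\,dt+G_i(\mathbf X(t))\,dW_i(t),\qquad X_i(0)=X_{i,0},\qquad i=1,\dots,d,$$ has a unique strong solution $\mathbf X(t)=(X_1(t),\dots,X_d(t))$, and it satisfies, for all $i\in\{1,\dots,d\}$, $$\mathbb P\big(X_i(t)\in(L_i,R_i)\ \text{ for all } t\ge 0\big)=1 .$$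
   Context: For $s\in\mathbb R$, $\Pi_i^{s}$ replaces the $i$-th coordinate by $s$: $\Pi_i^{s}(y_1,\dots,y_d)=(y_1,\dots,y_{i-1},s,y_{i+1},\dots,y_d)$. We work on a probability space $(\Omega,\mathcal F,\mathbb P)$ with a filtration $(\mathcal F_t)_{t\ge 0}$ satisfying the usual conditions, and $\mathbf W=(W_1,\dots,W_d)$ is a standard $d$-dimensional $(\mathcal F_t)$-Brownian motion (independent components). *)

theory Defs
  imports "HOL-Probability.Probability"
begin

section \<open>Filtrations and Brownian motion\<close>

text \<open>
  Time is \<^typ>\<open>real\<close>, and every condition is imposed for nonnegative times only.
  The measure carried by the spaces \<open>F t\<close> is irrelevant; they serve as sigma-algebras.
\<close>

definition usual_conditions :: "'w measure \<Rightarrow> (real \<Rightarrow> 'w measure) \<Rightarrow> bool" where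
  "usual_conditions M F \<longleftrightarrow>
     (\<forall>t\<ge>0. subalgebra M (F t)) \<and>
     (\<forall>s t. 0 \<le> s \<and> s \<le> t \<longrightarrow> sets (F s) \<subseteq> sets (F t)) \<and>
     (\<forall>t\<ge>0. sets (F t) = (\<Inter>u\<in>{t<..}. sets (F u))) \<and>
     (\<forall>A\<in>null_sets M. \<forall>B. B \<subseteq> A \<longrightarrow> B \<in> sets (F 0))"

definition brownian_motion ::
  "'w measure \<Rightarrow> (real \<Rightarrow> 'w measure) \<Rightarrow> (real \<Rightarrow> 'w \<Rightarrow> real ^ 'd) \<Rightarrow> bool" where
  "brownian_motion M F W \<longleftrightarrow>
     (\<forall>t\<ge>0. W t \<in> borel_measurable (F t)) \<and>
     (AE \<omega> in M. W 0 \<omega> = 0) \<and>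
     (AE \<omega> in M. continuous_on {0..} (\<lambda>t. W t \<omega>)) \<and>
     (\<forall>s t. 0 \<le> s \<and> s < t \<longrightarrow>
        prob_space.indep_set M (sets (F s))
          (sets (vimage_algebra (space M) (\<lambda>\<omega>. W t \<omega> - W s \<omega>) borel)) \<and>
        prob_space.indep_vars M (\<lambda>_. borel) (\<lambda>i \<omega>. W t \<omega> $ i - W s \<omega> $ i) UNIV \<and>
        (\<forall>i. distributed M lborel (\<lambda>\<omega>. W t \<omega> $ i - W s \<omega> $ i)
               (normal_density 0 (sqrt (t - s)))))"

definition completed_natural_filtration ::
  "'w measure \<Rightarrow> (real \<Rightarrow> 'w \<Rightarrow> real ^ 'd) \<Rightarrow> real \<Rightarrow> 'w measure" where
  "completed_natural_filtration M W t =
     sigma (space M)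
       ({W s -` A \<inter> space M | s A. 0 \<le> s \<and> s \<le> t \<and> A \<in> sets borel} \<union>
        {N. \<exists>A\<in>null_sets M. N \<subseteq> A})"

section \<open>The Ito integral\<close>

definition progressively_measurable ::
  "(real \<Rightarrow> 'w measure) \<Rightarrow> (real \<Rightarrow> 'w \<Rightarrow> real) \<Rightarrow> bool" where
  "progressively_measurable F H \<longleftrightarrow>
     (\<forall>T\<ge>0. (\<lambda>(t, \<omega>). H t \<omega>) \<in> borel_measurable (restrict_space borel {0..T} \<Otimes>\<^sub>M F T))"

text \<open>
  A simple integrand is \<open>\<Sum>k<m. \<xi> k * indicator {\<tau> k<..\<tau> (Suc k)}\<close> with bounded
  \<open>\<xi> k\<close> that are measurable with respect to \<open>F (\<tau> k)\<close>.
\<close>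

definition simple_integrand ::
  "'w measure \<Rightarrow> (real \<Rightarrow> 'w measure) \<Rightarrow> nat \<Rightarrow> (nat \<Rightarrow> real) \<Rightarrow> (nat \<Rightarrow> 'w \<Rightarrow> real) \<Rightarrow> bool" where
  "simple_integrand M F m \<tau> \<xi> \<longleftrightarrow>
     0 \<le> \<tau> 0 \<and>
     (\<forall>k<m. \<tau> k \<le> \<tau> (Suc k) \<and> \<xi> k \<in> borel_measurable (F (\<tau> k)) \<and>
            (\<exists>C. \<forall>\<omega>\<in>space M. \<bar>\<xi> k \<omega>\<bar> \<le> C))"

definition simple_process ::
  "nat \<Rightarrow> (nat \<Rightarrow> real) \<Rightarrow> (nat \<Rightarrow> 'w \<Rightarrow> real) \<Rightarrow> real \<Rightarrow> 'w \<Rightarrow> real" where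
  "simple_process m \<tau> \<xi> t \<omega> = (\<Sum>k<m. \<xi> k \<omega> * indicator {\<tau> k<..\<tau> (Suc k)} t)"

definition simple_integral ::
  "(real \<Rightarrow> 'w \<Rightarrow> real) \<Rightarrow> nat \<Rightarrow> (nat \<Rightarrow> real) \<Rightarrow> (nat \<Rightarrow> 'w \<Rightarrow> real) \<Rightarrow> real \<Rightarrow> 'w \<Rightarrow> real" where
  "simple_integral B m \<tau> \<xi> t \<omega> =
     (\<Sum>k<m. \<xi> k \<omega> * (B (min t (\<tau> (Suc k))) \<omega> - B (min t (\<tau> k)) \<omega>))"

text \<open>
  \<open>is_ito_integral M F B H J\<close> says that \<open>J\<close> is a continuous version of the process
  \<open>t \<mapsto> \<integral>\<^sub>0\<^sup>t H dB\<close>. As usual, for progressively measurable \<open>H\<close> with locally square integrable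
  paths, the integral is the limit in probability of the integrals of simple integrands that
  converge to \<open>H\<close> in \<open>L\<^sup>2(0, T)\<close> in probability for every \<open>T\<close>.
  By the Ito isometry the limit does not depend on the approximating sequence,
  so \<open>J\<close> is unique up to indistinguishability.
\<close>

definition is_ito_integral ::
  "'w measure \<Rightarrow> (real \<Rightarrow> 'w measure) \<Rightarrow> (real \<Rightarrow> 'w \<Rightarrow> real) \<Rightarrow>
   (real \<Rightarrow> 'w \<Rightarrow> real) \<Rightarrow> (real \<Rightarrow> 'w \<Rightarrow> real) \<Rightarrow> bool" where
  "is_ito_integral M F B H J \<longleftrightarrow>
     progressively_measurable F H \<and>
     (\<forall>T\<ge>0. AE \<omega> in M. (\<integral>\<^sup>+s\<in>{0..T}. ennreal ((H s \<omega>)\<^sup>2) \<partial>lborel) < \<infinity>) \<and>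
     (\<forall>t\<ge>0. J t \<in> borel_measurable (F t)) \<and>
     (AE \<omega> in M. continuous_on {0..} (\<lambda>t. J t \<omega>)) \<and>
     (\<exists>m \<tau> \<xi>.
        (\<forall>n. simple_integrand M F (m n) (\<tau> n) (\<xi> n)) \<and>
        (\<forall>T\<ge>0. \<forall>\<epsilon>>0.
           (\<lambda>n. measure M {\<omega>\<in>space M. ennreal \<epsilon> <
              (\<integral>\<^sup>+s\<in>{0..T}. ennreal ((simple_process (m n) (\<tau> n) (\<xi> n) s \<omega> - H s \<omega>)\<^sup>2) \<partial>lborel)})
           \<longlonglongrightarrow> 0) \<and>
        (\<forall>t\<ge>0. \<forall>\<epsilon>>0.
           (\<lambda>n. measure M {\<omega>\<in>space M. \<epsilon> <
              \<bar>simple_integral B (m n) (\<tau> n) (\<xi> n) t \<omega> - J t \<omega>\<bar>})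
           \<longlonglongrightarrow> 0))"

section \<open>Stochastic differential equations\<close>

text \<open>
  Solutions of \<open>dX\<^sub>i = b\<^sub>i(X) dt + \<sigma>\<^sub>i(X) dW\<^sub>i\<close>, \<open>X(0) = x\<^sub>0\<close>, for coefficients that are only
  meaningful on the state space \<open>S\<close>: the values of \<open>b\<close> and \<open>\<sigma>\<close> outside \<open>S\<close> are arbitrary, so
  a solution is by definition an \<open>S\<close>-valued process, for every outcome.
\<close>

definition sde_solution ::
  "'w measure \<Rightarrow> (real \<Rightarrow> 'w measure) \<Rightarrow> (real \<Rightarrow> 'w \<Rightarrow> real ^ 'd) \<Rightarrow> (real ^ 'd) set \<Rightarrow>
   (real ^ 'd \<Rightarrow> real ^ 'd) \<Rightarrow> (real ^ 'd \<Rightarrow> real ^ 'd) \<Rightarrow> real ^ 'd \<Rightarrow>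
   (real \<Rightarrow> 'w \<Rightarrow> real ^ 'd) \<Rightarrow> bool" where
  "sde_solution M F W S b \<sigma> x\<^sub>0 X \<longleftrightarrow>
     (\<forall>t\<ge>0. X t \<in> borel_measurable (F t)) \<and>
     (\<forall>\<omega>\<in>space M. continuous_on {0..} (\<lambda>t. X t \<omega>)) \<and>
     (\<forall>\<omega>\<in>space M. \<forall>t\<ge>0. X t \<omega> \<in> S) \<and>
     (AE \<omega> in M. X 0 \<omega> = x\<^sub>0) \<and>
     (\<forall>i. \<exists>J. is_ito_integral M F (\<lambda>t \<omega>. W t \<omega> $ i) (\<lambda>t \<omega>. \<sigma> (X t \<omega>) $ i) J \<and>
        (AE \<omega> in M. \<forall>t\<ge>0.
           set_integrable lborel {0..t} (\<lambda>s. b (X s \<omega>) $ i) \<and>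
           X t \<omega> $ i = x\<^sub>0 $ i + (LINT s:{0..t}|lborel. b (X s \<omega>) $ i) + J t \<omega>))"

definition strong_solution ::
  "'w measure \<Rightarrow> (real \<Rightarrow> 'w measure) \<Rightarrow> (real \<Rightarrow> 'w \<Rightarrow> real ^ 'd) \<Rightarrow> (real ^ 'd) set \<Rightarrow>
   (real ^ 'd \<Rightarrow> real ^ 'd) \<Rightarrow> (real ^ 'd \<Rightarrow> real ^ 'd) \<Rightarrow> real ^ 'd \<Rightarrow>
   (real \<Rightarrow> 'w \<Rightarrow> real ^ 'd) \<Rightarrow> bool" where
  "strong_solution M F W S b \<sigma> x\<^sub>0 X \<longleftrightarrow>
     sde_solution M F W S b \<sigma> x\<^sub>0 X \<and>
     (\<forall>t\<ge>0. X t \<in> borel_measurable (completed_natural_filtration M W t))"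

definition indistinguishable ::
  "'w measure \<Rightarrow> (real \<Rightarrow> 'w \<Rightarrow> 'b) \<Rightarrow> (real \<Rightarrow> 'w \<Rightarrow> 'b) \<Rightarrow> bool" where
  "indistinguishable M X Y \<longleftrightarrow> (AE \<omega> in M. \<forall>t\<ge>0. X t \<omega> = Y t \<omega>)"

section \<open>Coefficients\<close>

definition replace_coord :: "'d \<Rightarrow> real \<Rightarrow> real ^ 'd \<Rightarrow> real ^ 'd" where
  "replace_coord i s y = (\<chi> j. if j = i then s else y $ j)"

text \<open>
  The class \<open>C\<^sup>1\<close> on the closure of an open set \<open>D\<close>: continuous on the closure, differentiable
  in \<open>D\<close>, with a derivative that extends continuously to the closure.
\<close>

definition C1_closure ::
  "('a::real_normed_vector) set \<Rightarrow> ('a \<Rightarrow> 'b::real_normed_vector) \<Rightarrow> bool" where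
  "C1_closure D f \<longleftrightarrow>
     continuous_on (closure D) f \<and>
     (\<exists>f' :: 'a \<Rightarrow> 'a \<Rightarrow>\<^sub>L 'b. continuous_on (closure D) f' \<and>
        (\<forall>y\<in>D. (f has_derivative blinfun_apply (f' y)) (at y)))"

end

theory Submission
  imports Defs
begin

text \<open>
  Composing the coefficients with the clamping onto the closed box makes them bounded and globally
  Lipschitz. The Euler scheme on dyadic grids then converges almost surely, uniformly on bounded
  time intervals: the Ito isometry and a discrete Gronwall argument control the second moments of
  the differences of consecutive levels, a maximal inequality controls their suprema, and
  Borel-Cantelli applies. The integrands of the scheme are themselves simple processes that
  witness the Ito integral in the equation for the limit.

  The limit \<open>X\<close> does not leave the open box. Near a face, the distance \<open>Z\<close> to the face has drift at
  least \<open>- \<kappa> Z\<^sup>+\<close> (by the sign condition on \<open>f\<close>) and diffusion at most \<open>\<kappa> Z\<^sup>+\<close> in absolute value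
  (by the factor in \<open>G\<close>). The decreasing function \<open>v z = sqrt (1 + z\<^sup>2) - z\<close> satisfies
  \<open>z\<^sup>+ \<bar>v' z\<bar> \<le> v z\<close> and \<open>(z\<^sup>+)\<^sup>2 v'' z \<le> 2 v z\<close>, so that \<open>v (Z / \<epsilon>)\<close>, stopped when \<open>Z \<le> \<epsilon>\<close>, grows
  at most exponentially in mean, at a rate independent of \<open>\<epsilon>\<close>. Hence \<open>Z\<close> reaches \<open>\<epsilon>\<close> before a
  given time with probability \<open>O(\<epsilon>)\<close>. All of this takes place on the Euler scheme, by a
  third-order Taylor expansion in each step, and no Ito formula is needed. In particular the
  clamping is invisible to the limit.

  Uniqueness: the Ito integral of a continuous bounded integrand is the limit in probability of
  its dyadic Riemann sums, so the isometry and a Gronwall iteration apply to the difference of two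
  solutions.
\<close>

section \<open>Stochastic sums over Brownian increments\<close>

text \<open>Gaussian increments let a single step of the scheme jump across a face, however fine the
  grid is. A barrier like 1 / z, which lives on one side of the face, cannot be used;
  \<open>barrier\<close> decays like 1 / (2 z) but is smooth on the whole line with bounded
  derivatives up to order three. A step of length h then costs an error of order h ^ (3/2), and the
  T / h steps up to time T cost order sqrt h. The error constants contain powers of C / \<epsilon>,
  so the order of the limits matters: the mesh tends to 0 for fixed \<epsilon>, and only afterwards
  \<epsilon> tends to 0. The growth rate survives the division by \<epsilon> because both bounds
  near the face are homogeneous in the distance. In place of conditional expectations, a factor
  known at time s is carried along as a multiplier and split off by independence of the next
  increment. A solution has values in the closed box for every outcome, so the limit is redefined on
  a null set; two solutions are compared on the box, where both coefficients are bounded and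
  Lipschitz.\<close>

lemma grid_mono:
  fixes t :: "nat \<Rightarrow> real"
  assumes "\<And>j. j < k \<Longrightarrow> t j \<le> t (Suc j)" "i \<le> j" "j \<le> k"
  shows "t i \<le> t j"
  using assms(2,3)
proof (induction j)
  case (Suc j)
  then show ?case using assms(1)[of j] by (cases "i = Suc j") auto
qed simp

text \<open>One component of the Brownian motion. Independence of the past is phrased for random
  variables \<open>Z\<close>, because its only use is to factor the expectation of \<open>Z\<close>
  times a power of an increment.\<close>

locale scalar_bm = prob_space M for M :: "'w measure" +
  fixes F :: "real \<Rightarrow> 'w measure" and B :: "real \<Rightarrow> 'w \<Rightarrow> real"
  assumes subalg: "\<And>t. 0 \<le> t \<Longrightarrow> subalgebra M (F t)"
    and filtration_mono: "\<And>s t. 0 \<le> s \<Longrightarrow> s \<le> t \<Longrightarrow> sets (F s) \<subseteq> sets (F t)"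
    and adapted: "\<And>t. 0 \<le> t \<Longrightarrow> B t \<in> borel_measurable (F t)"
    and indep_increment: "\<And>s t Z. 0 \<le> s \<Longrightarrow> s < t \<Longrightarrow> Z \<in> borel_measurable (F s) \<Longrightarrow>
      indep_var borel (Z :: 'w \<Rightarrow> real) borel (\<lambda>\<omega>. B t \<omega> - B s \<omega>)"
    and normal_increment: "\<And>s t. 0 \<le> s \<Longrightarrow> s < t \<Longrightarrow>
      distributed M lborel (\<lambda>\<omega>. B t \<omega> - B s \<omega>) (normal_density 0 (sqrt (t - s)))"
begin

lemma space_F: "0 \<le> t \<Longrightarrow> space (F t) = space M"
  using subalg by (simp add: subalgebra_def)

lemma measurable_F_M: "f \<in> measurable (F t) N \<Longrightarrow> 0 \<le> t \<Longrightarrow> f \<in> measurable M N"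
  using measurable_from_subalg[OF subalg] by blast

lemma measurable_F_mono:
  assumes "f \<in> measurable (F s) N" "0 \<le> s" "s \<le> t"
  shows "f \<in> measurable (F t) N"
  using assms by (intro measurable_from_subalg[of "F t" "F s"])
    (auto simp: subalgebra_def space_F filtration_mono)

lemma B_measurable_M: "0 \<le> t \<Longrightarrow> B t \<in> borel_measurable M"
  using adapted measurable_F_M by blast

text \<open>The degenerate case s = t is included because grids clipped at a time t contain empty
  cells.\<close>

lemma increment_moment:
  assumes "0 \<le> s" "s \<le> t"
  shows "integrable M (\<lambda>\<omega>. (B t \<omega> - B s \<omega>) ^ p)"
    and "expectation (\<lambda>\<omega>. B t \<omega> - B s \<omega>) = 0"
    and "expectation (\<lambda>\<omega>. (B t \<omega> - B s \<omega>)\<^sup>2) = t - s"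
    and "expectation (\<lambda>\<omega>. (B t \<omega> - B s \<omega>) ^ 4) = 3 * (t - s)\<^sup>2"
proof -
  have "integrable M (\<lambda>\<omega>. (B t \<omega> - B s \<omega>) ^ p) \<and> expectation (\<lambda>\<omega>. B t \<omega> - B s \<omega>) = 0 \<and>
    expectation (\<lambda>\<omega>. (B t \<omega> - B s \<omega>)\<^sup>2) = t - s \<and> expectation (\<lambda>\<omega>. (B t \<omega> - B s \<omega>) ^ 4) = 3 * (t - s)\<^sup>2"
  proof (cases "s = t")
    case True
    then show ?thesis by (cases p) auto
  next
    case False
    then have st: "s < t" using assms by simp
    let ?\<sigma> = "sqrt (t - s)"
    have \<sigma>: "0 < ?\<sigma>" using st by simp
    note D = normal_increment[OF assms(1) st]
    have nn: "\<And>x. 0 \<le> normal_density 0 ?\<sigma> x" by (rule normal_density_nonneg)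
    have int: "(\<integral>x. normal_density 0 ?\<sigma> x * g x \<partial>lborel) = expectation (\<lambda>\<omega>. g (B t \<omega> - B s \<omega>))"
      if "g \<in> borel_measurable borel" for g :: "real \<Rightarrow> real"
      using that by (intro distributed_integral[OF D]) (auto simp: nn)
    have "integrable M (\<lambda>\<omega>. (B t \<omega> - B s \<omega>) ^ p)"
      using distributed_integrable[OF D, of "\<lambda>x. x ^ p"] integrable_normal_moment[OF \<sigma>, of 0 p] nn by simp
    moreover have "expectation (\<lambda>\<omega>. B t \<omega> - B s \<omega>) = 0"
      using int[of "\<lambda>x. x"] integral_normal_moment_odd[OF \<sigma>, of 0 0] by simp
    moreover have "expectation (\<lambda>\<omega>. (B t \<omega> - B s \<omega>)\<^sup>2) = t - s"
      using int[of "\<lambda>x. x ^ 2"] integral_normal_moment_even[OF \<sigma>, of 0 1] st by simp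
    moreover have "expectation (\<lambda>\<omega>. (B t \<omega> - B s \<omega>) ^ 4) = 3 * (t - s)\<^sup>2"
      using int[of "\<lambda>x. x ^ 4"] integral_normal_moment_even[OF \<sigma>, of 0 2] st
      by (simp add: fact_numeral power_divide field_simps)
    ultimately show ?thesis by blast
  qed
  then show "integrable M (\<lambda>\<omega>. (B t \<omega> - B s \<omega>) ^ p)"
    and "expectation (\<lambda>\<omega>. B t \<omega> - B s \<omega>) = 0"
    and "expectation (\<lambda>\<omega>. (B t \<omega> - B s \<omega>)\<^sup>2) = t - s"
    and "expectation (\<lambda>\<omega>. (B t \<omega> - B s \<omega>) ^ 4) = 3 * (t - s)\<^sup>2" by blast+
qed

text \<open>All uses of independence pass through this identity: p = 1 removes the cross terms, p =
  2 gives the isometry, and p = 4 controls the remainder of the Taylor expansion of the barrier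
  function.\<close>

lemma expectation_mult_increment:
  fixes Z :: "'w \<Rightarrow> real"
  assumes "0 \<le> s" "s \<le> t" "Z \<in> borel_measurable (F s)" "integrable M Z"
  shows "integrable M (\<lambda>\<omega>. Z \<omega> * (B t \<omega> - B s \<omega>) ^ p)"
    and "expectation (\<lambda>\<omega>. Z \<omega> * (B t \<omega> - B s \<omega>) ^ p) =
      expectation Z * expectation (\<lambda>\<omega>. (B t \<omega> - B s \<omega>) ^ p)"
proof -
  have "integrable M (\<lambda>\<omega>. Z \<omega> * (B t \<omega> - B s \<omega>) ^ p) \<and>
    expectation (\<lambda>\<omega>. Z \<omega> * (B t \<omega> - B s \<omega>) ^ p) =
      expectation Z * expectation (\<lambda>\<omega>. (B t \<omega> - B s \<omega>) ^ p)"
  proof (cases "s = t")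
    case True
    then show ?thesis using assms by (cases p) (auto simp: prob_space)
  next
    case False
    then have st: "s < t" using assms by simp
    have "indep_var borel ((\<lambda>x. x) \<circ> Z) borel ((\<lambda>x. x ^ p) \<circ> (\<lambda>\<omega>. B t \<omega> - B s \<omega>))"
      using indep_increment[OF assms(1) st assms(3)] by (rule indep_var_compose) auto
    then have ind: "indep_var borel Z borel (\<lambda>\<omega>. (B t \<omega> - B s \<omega>) ^ p)"
      by (simp add: comp_def)
    show ?thesis
      using indep_var_integrable[OF ind assms(4) increment_moment(1)[OF assms(1,2)]]
        indep_var_lebesgue_integral[OF ind assms(4) increment_moment(1)[OF assms(1,2)]]
      by simp
  qed
  then show "integrable M (\<lambda>\<omega>. Z \<omega> * (B t \<omega> - B s \<omega>) ^ p)"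
    and "expectation (\<lambda>\<omega>. Z \<omega> * (B t \<omega> - B s \<omega>) ^ p) =
      expectation Z * expectation (\<lambda>\<omega>. (B t \<omega> - B s \<omega>) ^ p)" by blast+
qed

lemma increment_sum_adapted:
  assumes t: "\<And>j. j < k \<Longrightarrow> 0 \<le> t j \<and> t j \<le> t (Suc j)"
    and meas: "\<And>j. j < k \<Longrightarrow> \<eta> j \<in> borel_measurable (F (t j))"
    and "n \<le> m" "m < k"
  shows "(\<lambda>\<omega>. \<Sum>j<n. \<eta> j \<omega> * (B (t (Suc j)) \<omega> - B (t j) \<omega>)) \<in> borel_measurable (F (t m))"
proof (intro borel_measurable_sum borel_measurable_times borel_measurable_diff)
  fix j assume "j \<in> {..<n}"
  then have j: "j < n" by simp
  have le: "t j \<le> t m" "t (Suc j) \<le> t m" "0 \<le> t j" "0 \<le> t (Suc j)"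
    using grid_mono[of k t j m] grid_mono[of k t "Suc j" m] t[of j] j t assms(3,4) by auto
  show "\<eta> j \<in> borel_measurable (F (t m))"
    using measurable_F_mono[OF meas] le j assms(3,4) by simp
  show "B (t (Suc j)) \<in> borel_measurable (F (t m))" "B (t j) \<in> borel_measurable (F (t m))"
    using measurable_F_mono[OF adapted] le by blast+
qed

text \<open>Expanding the square of the sum with one more increment leaves a cross term, whose
  multiplier is known at the left end of the cell and which therefore has mean zero, and a square
  term, whose mean factors by independence.\<close>

lemma ito_isometry_sum:
  assumes "\<And>j. j < k \<Longrightarrow> 0 \<le> t j \<and> t j \<le> t (Suc j)"
    and "\<And>j. j < k \<Longrightarrow> \<eta> j \<in> borel_measurable (F (t j))"
    and "\<And>j. j < k \<Longrightarrow> integrable M (\<lambda>\<omega>. (\<eta> j \<omega>)\<^sup>2)"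
  defines "I \<equiv> \<lambda>k \<omega>. \<Sum>j<k. \<eta> j \<omega> * (B (t (Suc j)) \<omega> - B (t j) \<omega>)"
  shows "integrable M (\<lambda>\<omega>. (I k \<omega>)\<^sup>2)"
    and "expectation (\<lambda>\<omega>. (I k \<omega>)\<^sup>2) = (\<Sum>j<k. expectation (\<lambda>\<omega>. (\<eta> j \<omega>)\<^sup>2) * (t (Suc j) - t j))"
proof -
  have adapt: "I n \<in> borel_measurable (F (t n))" if "n < k" for n
    unfolding I_def using assms(1,2) that by (intro increment_sum_adapted) auto
  have "n \<le> k \<Longrightarrow> integrable M (\<lambda>\<omega>. (I n \<omega>)\<^sup>2) \<and>
     expectation (\<lambda>\<omega>. (I n \<omega>)\<^sup>2) = (\<Sum>j<n. expectation (\<lambda>\<omega>. (\<eta> j \<omega>)\<^sup>2) * (t (Suc j) - t j))" for n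
  proof (induction n)
    case 0
    then show ?case by (simp add: I_def)
  next
    case (Suc n)
    then have n: "n < k" by simp
    note tn = assms(1)[OF n]
    let ?\<Delta> = "\<lambda>\<omega>. B (t (Suc n)) \<omega> - B (t n) \<omega>"
    have [measurable]: "I n \<in> borel_measurable M" "\<eta> n \<in> borel_measurable M"
      using adapt[OF n] assms(2)[OF n] measurable_F_M tn by blast+
    note IH = Suc.IH[OF less_imp_le[OF n]]
    have "integrable M (\<lambda>\<omega>. (I n \<omega>)\<^sup>2 + (\<eta> n \<omega>)\<^sup>2)"
      using IH assms(3)[OF n] by simp
    \<comment> \<open>The multiplier of the cross term is integrable because twice a product is at
      most the sum of the squares.\<close>
    then have prod: "integrable M (\<lambda>\<omega>. I n \<omega> * \<eta> n \<omega>)"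
    proof (rule Bochner_Integration.integrable_bound)
      show "AE \<omega> in M. norm (I n \<omega> * \<eta> n \<omega>) \<le> norm ((I n \<omega>)\<^sup>2 + (\<eta> n \<omega>)\<^sup>2)"
      proof (rule AE_I2)
        fix \<omega>
        have "0 \<le> (\<bar>I n \<omega>\<bar> - \<bar>\<eta> n \<omega>\<bar>)\<^sup>2" by simp
        then have "2 * (\<bar>I n \<omega>\<bar> * \<bar>\<eta> n \<omega>\<bar>) \<le> (I n \<omega>)\<^sup>2 + (\<eta> n \<omega>)\<^sup>2"
          by (simp add: power2_diff)
        then show "norm (I n \<omega> * \<eta> n \<omega>) \<le> norm ((I n \<omega>)\<^sup>2 + (\<eta> n \<omega>)\<^sup>2)"
          by (simp add: abs_mult)
             (smt (verit) mult_nonneg_nonneg abs_ge_zero)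
      qed
    qed measurable
    have pm: "(\<lambda>\<omega>. I n \<omega> * \<eta> n \<omega>) \<in> borel_measurable (F (t n))"
      using adapt[OF n] assms(2)[OF n] by measurable
    have sm: "(\<lambda>\<omega>. (\<eta> n \<omega>)\<^sup>2) \<in> borel_measurable (F (t n))"
      using assms(2)[OF n] by measurable
    note c = expectation_mult_increment[OF conjunct1[OF tn] conjunct2[OF tn] pm prod, of 1]
    note q = expectation_mult_increment[OF conjunct1[OF tn] conjunct2[OF tn] sm assms(3)[OF n], of 2]
    have eq: "(I (Suc n) \<omega>)\<^sup>2 = (I n \<omega>)\<^sup>2 + 2 * (I n \<omega> * \<eta> n \<omega> * ?\<Delta> \<omega> ^ 1) + (\<eta> n \<omega>)\<^sup>2 * (?\<Delta> \<omega>)\<^sup>2" for \<omega>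
    proof -
      have "I (Suc n) \<omega> = I n \<omega> + \<eta> n \<omega> * ?\<Delta> \<omega>" by (simp add: I_def)
      moreover have "(a + b * c)\<^sup>2 = a\<^sup>2 + 2 * (a * b * c ^ 1) + b\<^sup>2 * c\<^sup>2" for a b c :: real
        by (simp add: power2_eq_square algebra_simps)
      ultimately show ?thesis by metis
    qed
    have e1: "expectation (\<lambda>\<omega>. I n \<omega> * \<eta> n \<omega> * ?\<Delta> \<omega> ^ 1) = 0"
      using c(2) increment_moment(2)[of "t n" "t (Suc n)"] tn by simp
    have e2: "expectation (\<lambda>\<omega>. (\<eta> n \<omega>)\<^sup>2 * (?\<Delta> \<omega>)\<^sup>2) = expectation (\<lambda>\<omega>. (\<eta> n \<omega>)\<^sup>2) * (t (Suc n) - t n)"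
      using q(2) increment_moment(3)[of "t n" "t (Suc n)"] tn by simp
    have i12: "integrable M (\<lambda>\<omega>. (I n \<omega>)\<^sup>2 + 2 * (I n \<omega> * \<eta> n \<omega> * ?\<Delta> \<omega> ^ 1))"
      using IH c(1) by (intro Bochner_Integration.integrable_add integrable_mult_right) auto
    have "expectation (\<lambda>\<omega>. (I (Suc n) \<omega>)\<^sup>2) = expectation (\<lambda>\<omega>. (I n \<omega>)\<^sup>2) +
       2 * expectation (\<lambda>\<omega>. I n \<omega> * \<eta> n \<omega> * ?\<Delta> \<omega> ^ 1) + expectation (\<lambda>\<omega>. (\<eta> n \<omega>)\<^sup>2 * (?\<Delta> \<omega>)\<^sup>2)"
      unfolding eq
      by (subst Bochner_Integration.integral_add[OF i12 q(1)],
          subst Bochner_Integration.integral_add)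
         (use IH c(1) in auto)
    then have "expectation (\<lambda>\<omega>. (I (Suc n) \<omega>)\<^sup>2) =
        (\<Sum>j<Suc n. expectation (\<lambda>\<omega>. (\<eta> j \<omega>)\<^sup>2) * (t (Suc j) - t j))"
      using IH e1 e2 by simp
    moreover have "integrable M (\<lambda>\<omega>. (I (Suc n) \<omega>)\<^sup>2)"
      unfolding eq by (rule Bochner_Integration.integrable_add[OF i12 q(1)])
    ultimately show ?case by blast
  qed
  from this[of k] show "integrable M (\<lambda>\<omega>. (I k \<omega>)\<^sup>2)"
    and "expectation (\<lambda>\<omega>. (I k \<omega>)\<^sup>2) = (\<Sum>j<k. expectation (\<lambda>\<omega>. (\<eta> j \<omega>)\<^sup>2) * (t (Suc j) - t j))" by auto
qed

lemma prob_ge_le_second_moment: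
  assumes [measurable]: "f \<in> borel_measurable M" and "integrable M (\<lambda>\<omega>. (f \<omega>)\<^sup>2)" "0 < \<epsilon>"
  shows "prob {\<omega>\<in>space M. \<epsilon> \<le> \<bar>f \<omega>\<bar>} \<le> expectation (\<lambda>\<omega>. (f \<omega>)\<^sup>2) / \<epsilon>\<^sup>2"
proof -
  have "prob {\<omega>\<in>space M. \<epsilon>\<^sup>2 \<le> (f \<omega>)\<^sup>2} \<le> expectation (\<lambda>\<omega>. (f \<omega>)\<^sup>2) / \<epsilon>\<^sup>2"
    using assms by (intro integral_Markov_inequality_measure[where A = "{}"]) auto
  also have "{\<omega>\<in>space M. \<epsilon>\<^sup>2 \<le> (f \<omega>)\<^sup>2} = {\<omega>\<in>space M. \<epsilon> \<le> \<bar>f \<omega>\<bar>}"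
    using assms(3) by (auto simp: abs_le_square_iff[symmetric])
  finally show ?thesis .
qed

text \<open>Kolmogorov's maximal inequality is the isometry for the sum stopped when it reaches \<open>\<epsilon>\<close>.\<close>

lemma maximal_inequality_sum:
  assumes t: "\<And>j. j < k \<Longrightarrow> 0 \<le> t j \<and> t j \<le> t (Suc j)"
    and meas: "\<And>j. j < k \<Longrightarrow> \<eta> j \<in> borel_measurable (F (t j))"
    and int: "\<And>j. j < k \<Longrightarrow> integrable M (\<lambda>\<omega>. (\<eta> j \<omega>)\<^sup>2)"
    and "0 < \<epsilon>"
  defines "I \<equiv> \<lambda>k \<omega>. \<Sum>j<k. \<eta> j \<omega> * (B (t (Suc j)) \<omega> - B (t j) \<omega>)"
  shows "prob {\<omega>\<in>space M. \<exists>n\<le>k. \<epsilon> \<le> \<bar>I n \<omega>\<bar>} \<le>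
     (\<Sum>j<k. expectation (\<lambda>\<omega>. (\<eta> j \<omega>)\<^sup>2) * (t (Suc j) - t j)) / \<epsilon>\<^sup>2"
proof -
  \<comment> \<open>Whether the level was reached up to index \<open>j\<close> is known at time
    \<open>t j\<close>, so dropping the later coefficients keeps the integrand adapted. The
    increment that crosses the level is still kept.\<close>
  define \<zeta> where "\<zeta> j \<omega> = (if \<exists>n\<le>j. \<epsilon> \<le> \<bar>I n \<omega>\<bar> then 0 else \<eta> j \<omega>)" for j \<omega>
  define U where "U n \<omega> = (\<Sum>j<n. \<zeta> j \<omega> * (B (t (Suc j)) \<omega> - B (t j) \<omega>))" for n \<omega>
  have tpos: "0 \<le> t j" if "j \<le> k" "0 < k" for j
    using grid_mono[of k t 0 j] t that by fastforce
  have adapt: "I n \<in> borel_measurable (F (t m))" if "n \<le> m" "m < k" for n m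
    unfolding I_def using t meas that by (intro increment_sum_adapted) auto
  have \<zeta>m: "\<zeta> j \<in> borel_measurable (F (t j))" if "j < k" for j
  proof -
    have [measurable]: "I n \<in> borel_measurable (F (t j))" if "n \<in> {..j}" for n
      using adapt[of n j] that \<open>j < k\<close> by simp
    have [measurable]: "\<eta> j \<in> borel_measurable (F (t j))" using meas[OF that] .
    have "(\<lambda>\<omega>. if \<exists>n\<in>{..j}. \<epsilon> \<le> \<bar>I n \<omega>\<bar> then 0 else \<eta> j \<omega>) \<in> borel_measurable (F (t j))"
      by measurable
    then show ?thesis unfolding \<zeta>_def atMost_iff Bex_def .
  qed
  have \<zeta>int: "integrable M (\<lambda>\<omega>. (\<zeta> j \<omega>)\<^sup>2)"
    and \<zeta>le: "expectation (\<lambda>\<omega>. (\<zeta> j \<omega>)\<^sup>2) \<le> expectation (\<lambda>\<omega>. (\<eta> j \<omega>)\<^sup>2)" if "j < k" for j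
  proof -
    have [measurable]: "\<zeta> j \<in> borel_measurable M"
      using \<zeta>m[OF that] tpos[of j] that measurable_F_M by auto
    show i: "integrable M (\<lambda>\<omega>. (\<zeta> j \<omega>)\<^sup>2)"
    proof (rule Bochner_Integration.integrable_bound[OF int[OF that]])
      show "AE \<omega> in M. norm ((\<zeta> j \<omega>)\<^sup>2) \<le> norm ((\<eta> j \<omega>)\<^sup>2)" by (simp add: \<zeta>_def)
    qed measurable
    show "expectation (\<lambda>\<omega>. (\<zeta> j \<omega>)\<^sup>2) \<le> expectation (\<lambda>\<omega>. (\<eta> j \<omega>)\<^sup>2)"
      by (rule integral_mono[OF i int[OF that]]) (auto simp: \<zeta>_def)
  qed
  have iso: "integrable M (\<lambda>\<omega>. (U k \<omega>)\<^sup>2)"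
    "expectation (\<lambda>\<omega>. (U k \<omega>)\<^sup>2) = (\<Sum>j<k. expectation (\<lambda>\<omega>. (\<zeta> j \<omega>)\<^sup>2) * (t (Suc j) - t j))"
    unfolding U_def using t \<zeta>m \<zeta>int by (intro ito_isometry_sum; simp)+
  have Um: "U k \<in> borel_measurable M"
    unfolding U_def
  proof (intro borel_measurable_sum borel_measurable_times borel_measurable_diff)
    fix j assume "j \<in> {..<k}"
    then show "\<zeta> j \<in> borel_measurable M" "B (t (Suc j)) \<in> borel_measurable M" "B (t j) \<in> borel_measurable M"
      using \<zeta>m[of j] tpos[of j] tpos[of "Suc j"] measurable_F_M B_measurable_M by auto
  qed
  \<comment> \<open>After the crossing all coefficients vanish, so \<open>U\<close> keeps the value
    that it had there.\<close>
  have stopped: "(\<forall>m\<le>n. \<bar>I m \<omega>\<bar> < \<epsilon>) \<and> U n \<omega> = I n \<omega> \<or> (\<exists>m\<le>n. \<epsilon> \<le> \<bar>I m \<omega>\<bar>) \<and> \<epsilon> \<le> \<bar>U n \<omega>\<bar>" for n \<omega>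
  proof (induction n)
    case 0
    then show ?case using \<open>0 < \<epsilon>\<close> by (simp add: I_def U_def)
  next
    case (Suc n)
    show ?case
    proof (cases "\<exists>m\<le>n. \<epsilon> \<le> \<bar>I m \<omega>\<bar>")
      case True
      then have "U (Suc n) \<omega> = U n \<omega>" by (simp add: U_def \<zeta>_def)
      then show ?thesis using Suc True by (metis le_Suc_eq not_le)
    next
      case False
      then have "U n \<omega> = I n \<omega>" using Suc by auto
      moreover have "\<zeta> n \<omega> = \<eta> n \<omega>" using False unfolding \<zeta>_def by metis
      ultimately have "U (Suc n) \<omega> = I (Suc n) \<omega>" by (simp add: U_def I_def)
      then show ?thesis using False by (metis le_Suc_eq not_le)
    qed
  qed
  have "prob {\<omega>\<in>space M. \<exists>n\<le>k. \<epsilon> \<le> \<bar>I n \<omega>\<bar>} \<le> prob {\<omega>\<in>space M. \<epsilon> \<le> \<bar>U k \<omega>\<bar>}"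
    using Um stopped by (intro finite_measure_mono) (auto, meson not_le)
  also have "\<dots> \<le> expectation (\<lambda>\<omega>. (U k \<omega>)\<^sup>2) / \<epsilon>\<^sup>2"
    by (rule prob_ge_le_second_moment[OF Um iso(1) \<open>0 < \<epsilon>\<close>])
  also have "\<dots> \<le> (\<Sum>j<k. expectation (\<lambda>\<omega>. (\<eta> j \<omega>)\<^sup>2) * (t (Suc j) - t j)) / \<epsilon>\<^sup>2"
    unfolding iso(2) using t \<zeta>le by (intro divide_right_mono sum_mono mult_right_mono) auto
  finally show ?thesis .
qed

end

section \<open>Convergence in probability\<close>

text \<open>This has literally the form of the last clause of \<open>is_ito_integral\<close>, so
  unfolding translates between the two.\<close>

definition tends_in_prob :: "'w measure \<Rightarrow> (nat \<Rightarrow> 'w \<Rightarrow> real) \<Rightarrow> ('w \<Rightarrow> real) \<Rightarrow> bool" where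
  "tends_in_prob M Z Y \<longleftrightarrow>
     (\<forall>\<epsilon>>0. (\<lambda>n. measure M {\<omega>\<in>space M. \<epsilon> < \<bar>Z n \<omega> - Y \<omega>\<bar>}) \<longlonglongrightarrow> 0)"

context prob_space
begin

text \<open>Dominated convergence for the indicators of the events.\<close>

lemma prob_tendsto_0_AE:
  assumes [measurable]: "\<And>n. A n \<in> events" and "AE \<omega> in M. \<forall>\<^sub>F n in sequentially. \<omega> \<notin> A n"
  shows "(\<lambda>n. prob (A n)) \<longlonglongrightarrow> 0"
proof -
  have "(\<lambda>n. expectation (indicator (A n) :: 'a \<Rightarrow> real)) \<longlonglongrightarrow> expectation (\<lambda>_. 0 :: real)"
  proof (rule integral_dominated_convergence[where w = "\<lambda>_. 1"])
    show "AE \<omega> in M. (\<lambda>n. indicator (A n) \<omega> :: real) \<longlonglongrightarrow> 0"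
      using assms(2)
    proof eventually_elim
      case (elim \<omega>)
      then have "\<forall>\<^sub>F n in sequentially. (indicator (A n) \<omega> :: real) = 0"
        by eventually_elim simp
      then show ?case by (rule tendsto_eventually)
    qed
  qed (auto simp: indicator_def)
  then show ?thesis by simp
qed

lemma tends_in_prob_AE:
  assumes [measurable]: "\<And>n. Z n \<in> borel_measurable M" "Y \<in> borel_measurable M"
    and "AE \<omega> in M. (\<lambda>n. Z n \<omega>) \<longlonglongrightarrow> Y \<omega>"
  shows "tends_in_prob M Z Y"
  unfolding tends_in_prob_def
proof (intro allI impI prob_tendsto_0_AE)
  fix \<epsilon> :: real assume "0 < \<epsilon>"
  show "AE \<omega> in M. \<forall>\<^sub>F n in sequentially. \<omega> \<notin> {\<omega> \<in> space M. \<epsilon> < \<bar>Z n \<omega> - Y \<omega>\<bar>}"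
    using assms(3)
  proof eventually_elim
    case (elim \<omega>)
    from tendstoD[OF elim \<open>0 < \<epsilon>\<close>] show ?case
      by eventually_elim (auto simp: dist_real_def)
  qed
qed measurable

lemma tends_in_prob_add:
  assumes [measurable]: "\<And>n. Z n \<in> borel_measurable M" "Y \<in> borel_measurable M"
    "\<And>n. Z' n \<in> borel_measurable M" "Y' \<in> borel_measurable M"
    and "tends_in_prob M Z Y" "tends_in_prob M Z' Y'"
  shows "tends_in_prob M (\<lambda>n \<omega>. Z n \<omega> + Z' n \<omega>) (\<lambda>\<omega>. Y \<omega> + Y' \<omega>)"
  unfolding tends_in_prob_def
proof (intro allI impI)
  fix \<epsilon> :: real assume "0 < \<epsilon>"
  let ?A = "\<lambda>n. {\<omega>\<in>space M. \<epsilon> / 2 < \<bar>Z n \<omega> - Y \<omega>\<bar>}"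
  let ?A' = "\<lambda>n. {\<omega>\<in>space M. \<epsilon> / 2 < \<bar>Z' n \<omega> - Y' \<omega>\<bar>}"
  have "(\<lambda>n. prob (?A n)) \<longlonglongrightarrow> 0" "(\<lambda>n. prob (?A' n)) \<longlonglongrightarrow> 0"
    using assms(5,6) \<open>0 < \<epsilon>\<close> unfolding tends_in_prob_def by (meson half_gt_zero)+
  from tendsto_add[OF this] have lim: "(\<lambda>n. prob (?A n) + prob (?A' n)) \<longlonglongrightarrow> 0" by simp
  show "(\<lambda>n. prob {\<omega>\<in>space M. \<epsilon> < \<bar>Z n \<omega> + Z' n \<omega> - (Y \<omega> + Y' \<omega>)\<bar>}) \<longlonglongrightarrow> 0"
  proof (rule tendsto_sandwich[OF _ _ tendsto_const lim])
    show "\<forall>\<^sub>F n in sequentially. prob {\<omega>\<in>space M. \<epsilon> < \<bar>Z n \<omega> + Z' n \<omega> - (Y \<omega> + Y' \<omega>)\<bar>}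
        \<le> prob (?A n) + prob (?A' n)"
    proof (intro always_eventually allI)
      fix n
      have "prob {\<omega>\<in>space M. \<epsilon> < \<bar>Z n \<omega> + Z' n \<omega> - (Y \<omega> + Y' \<omega>)\<bar>} \<le> prob (?A n \<union> ?A' n)"
        by (rule finite_measure_mono) (auto simp: abs_if split: if_splits)
      also have "\<dots> \<le> prob (?A n) + prob (?A' n)" by (rule measure_Un_le) measurable
      finally show "prob {\<omega>\<in>space M. \<epsilon> < \<bar>Z n \<omega> + Z' n \<omega> - (Y \<omega> + Y' \<omega>)\<bar>} \<le> prob (?A n) + prob (?A' n)" .
    qed
  qed simp
qed

lemma tends_in_prob_uminus:
  "tends_in_prob M Z Y \<Longrightarrow> tends_in_prob M (\<lambda>n \<omega>. - Z n \<omega>) (\<lambda>\<omega>. - Y \<omega>)"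
  unfolding tends_in_prob_def by (simp add: abs_minus_commute)

text \<open>The distance truncated at 1 tends to 0 in L^1, and L^1 convergence yields an almost
  surely convergent subsequence. Along it the truncated distance is eventually below 1, where
  truncation has no effect.\<close>

lemma tends_in_prob_AE_subseq:
  assumes [measurable]: "\<And>n. Z n \<in> borel_measurable M" "Y \<in> borel_measurable M"
    and lim: "tends_in_prob M Z Y"
  obtains r where "strict_mono r" "AE \<omega> in M. (\<lambda>n. Z (r n) \<omega>) \<longlonglongrightarrow> Y \<omega>"
proof -
  define u where "u n \<omega> = min 1 \<bar>Z n \<omega> - Y \<omega>\<bar>" for n \<omega>
  have [measurable]: "u n \<in> borel_measurable M" for n unfolding u_def by measurable
  have ui: "integrable M (u n)" for n
    by (rule integrable_const_bound[where B = 1]) (auto simp: u_def)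
  have "(\<lambda>n. (\<integral>\<omega>. norm (u n \<omega>) \<partial>M)) \<longlonglongrightarrow> 0"
  proof (rule LIMSEQ_I)
    fix e :: real assume "0 < e"
    let ?A = "\<lambda>n. {\<omega>\<in>space M. e / 2 < \<bar>Z n \<omega> - Y \<omega>\<bar>}"
    have "(\<lambda>n. prob (?A n)) \<longlonglongrightarrow> 0" using lim \<open>0 < e\<close> unfolding tends_in_prob_def by (meson half_gt_zero)
    then obtain N where N: "\<And>n. N \<le> n \<Longrightarrow> prob (?A n) < e / 2"
      using LIMSEQ_D[of "\<lambda>n. prob (?A n)" 0 "e / 2"] \<open>0 < e\<close> by auto
    have "norm ((\<integral>\<omega>. norm (u n \<omega>) \<partial>M) - 0) < e" if "N \<le> n" for n
    proof -
      have "(\<integral>\<omega>. norm (u n \<omega>) \<partial>M) \<le> (\<integral>\<omega>. e / 2 + indicator (?A n) \<omega> \<partial>M)"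
      proof (rule integral_mono)
        show "norm (u n \<omega>) \<le> e / 2 + indicator (?A n) \<omega>" if "\<omega> \<in> space M" for \<omega>
          using that \<open>0 < e\<close> by (cases "e / 2 < \<bar>Z n \<omega> - Y \<omega>\<bar>") (auto simp: u_def min_def)
      qed (use ui in \<open>auto intro!: Bochner_Integration.integrable_add integrable_real_indicator simp: emeasure_eq_measure\<close>)
      also have "\<dots> = e / 2 + prob (?A n)"
        by (subst Bochner_Integration.integral_add)
           (auto simp: prob_space emeasure_eq_measure intro!: integrable_real_indicator)
      finally show ?thesis using N[OF that] by simp
    qed
    then show "\<exists>no. \<forall>n\<ge>no. norm ((\<integral>\<omega>. norm (u n \<omega>) \<partial>M) - 0) < e" by blast
  qed
  from tendsto_L1_AE_subseq[OF ui this] obtain r where r: "strict_mono r" "AE \<omega> in M. (\<lambda>n. u (r n) \<omega>) \<longlonglongrightarrow> 0"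
    by blast
  have "AE \<omega> in M. (\<lambda>n. Z (r n) \<omega>) \<longlonglongrightarrow> Y \<omega>"
    using r(2)
  proof eventually_elim
    case (elim \<omega>)
    have "(\<lambda>n. \<bar>Z (r n) \<omega> - Y \<omega>\<bar>) \<longlonglongrightarrow> 0"
    proof (rule tendsto_cong[THEN iffD1, OF _ elim])
      from order_tendstoD(2)[OF elim, of 1]
      show "\<forall>\<^sub>F n in sequentially. u (r n) \<omega> = \<bar>Z (r n) \<omega> - Y \<omega>\<bar>"
        by (auto elim!: eventually_mono simp: u_def min_def split: if_splits)
    qed
    then show ?case by (simp add: LIM_zero_cancel tendsto_rabs_zero_iff)
  qed
  with r(1) show ?thesis by (rule that)
qed

text \<open>Fatou's lemma along an almost surely convergent subsequence. In this way a bound from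
  the isometry for sums reaches Ito integrals, which are only given as limits in
  probability.\<close>

lemma second_moment_le_in_prob:
  assumes [measurable]: "\<And>n. Z n \<in> borel_measurable M" "Y \<in> borel_measurable M"
    and lim: "tends_in_prob M Z Y"
    and bound: "\<forall>\<^sub>F n in sequentially. integrable M (\<lambda>\<omega>. (Z n \<omega>)\<^sup>2) \<and> expectation (\<lambda>\<omega>. (Z n \<omega>)\<^sup>2) \<le> c"
  shows "integrable M (\<lambda>\<omega>. (Y \<omega>)\<^sup>2)" "expectation (\<lambda>\<omega>. (Y \<omega>)\<^sup>2) \<le> c"
proof -
  obtain r where r: "strict_mono r" "AE \<omega> in M. (\<lambda>n. Z (r n) \<omega>) \<longlonglongrightarrow> Y \<omega>"
    using tends_in_prob_AE_subseq[OF assms(1,2) lim] by blast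
  have bound': "\<forall>\<^sub>F n in sequentially. integrable M (\<lambda>\<omega>. (Z (r n) \<omega>)\<^sup>2) \<and> expectation (\<lambda>\<omega>. (Z (r n) \<omega>)\<^sup>2) \<le> c"
    using eventually_subseq[OF r(1) bound] .
  \<comment> \<open>Nonnegativity of \<open>c\<close> must be secured before moving to extended
    reals, because \<open>ennreal\<close> maps negative numbers to 0.\<close>
  then obtain n0 where "expectation (\<lambda>\<omega>. (Z (r n0) \<omega>)\<^sup>2) \<le> c"
    using eventually_happens by force
  moreover have "0 \<le> expectation (\<lambda>\<omega>. (Z (r n0) \<omega>)\<^sup>2)" by simp
  ultimately have c: "0 \<le> c" by linarith
  have "(\<integral>\<^sup>+\<omega>. ennreal ((Y \<omega>)\<^sup>2) \<partial>M) = (\<integral>\<^sup>+\<omega>. liminf (\<lambda>n. ennreal ((Z (r n) \<omega>)\<^sup>2)) \<partial>M)"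
    using r(2)
  proof (intro nn_integral_cong_AE, eventually_elim)
    case (elim \<omega>)
    then have "(\<lambda>n. ennreal ((Z (r n) \<omega>)\<^sup>2)) \<longlonglongrightarrow> ennreal ((Y \<omega>)\<^sup>2)"
      by (intro tendsto_ennrealI tendsto_power)
    from lim_imp_Liminf[OF _ this] show ?case by simp
  qed
  also have "\<dots> \<le> liminf (\<lambda>n. \<integral>\<^sup>+\<omega>. ennreal ((Z (r n) \<omega>)\<^sup>2) \<partial>M)"
    by (rule nn_integral_liminf) measurable
  also have "\<dots> \<le> liminf (\<lambda>n. ennreal c)"
  proof (rule Liminf_mono)
    from bound' show "\<forall>\<^sub>F n in sequentially. (\<integral>\<^sup>+\<omega>. ennreal ((Z (r n) \<omega>)\<^sup>2) \<partial>M) \<le> ennreal c"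
      by eventually_elim (simp add: nn_integral_eq_integral ennreal_leI)
  qed
  finally have le: "(\<integral>\<^sup>+\<omega>. ennreal ((Y \<omega>)\<^sup>2) \<partial>M) \<le> ennreal c" by (simp add: Liminf_const)
  then have "(\<integral>\<^sup>+\<omega>. ennreal ((Y \<omega>)\<^sup>2) \<partial>M) < \<infinity>" by (simp add: le_less_trans)
  then show i: "integrable M (\<lambda>\<omega>. (Y \<omega>)\<^sup>2)"
    by (intro integrableI_nonneg) auto
  then show "expectation (\<lambda>\<omega>. (Y \<omega>)\<^sup>2) \<le> c"
    using le c by (simp add: nn_integral_eq_integral)
qed

end

section \<open>Simple integrands\<close>

text \<open>Common form of two objects: \<open>g x = B (min t x) \<omega>\<close> gives the
  integral, and the indicator of \<open>s \<le> x\<close> as \<open>g x\<close> gives the value of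
  the process at \<open>s\<close>. An identity for all \<open>g\<close> thus covers both.\<close>

definition simple_sum :: "nat \<Rightarrow> (nat \<Rightarrow> real) \<Rightarrow> (nat \<Rightarrow> 'w \<Rightarrow> real) \<Rightarrow> (real \<Rightarrow> real) \<Rightarrow> 'w \<Rightarrow> real" where
  "simple_sum m \<tau> \<xi> g \<omega> = (\<Sum>k<m. \<xi> k \<omega> * (g (\<tau> (Suc k)) - g (\<tau> k)))"

lemma simple_integrandD:
  assumes "simple_integrand M F m \<tau> \<xi>" "k < m"
  shows "\<tau> k \<le> \<tau> (Suc k)" "\<xi> k \<in> borel_measurable (F (\<tau> k))"
    "\<exists>C. \<forall>\<omega>\<in>space M. \<bar>\<xi> k \<omega>\<bar> \<le> C"
  using assms unfolding simple_integrand_def by auto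

lemma simple_integral_eq_sum: "simple_integral B m \<tau> \<xi> t \<omega> = simple_sum m \<tau> \<xi> (\<lambda>x. B (min t x) \<omega>) \<omega>"
  by (simp add: simple_integral_def simple_sum_def)

lemma simple_process_eq_sum:
  assumes "\<And>k. k < m \<Longrightarrow> \<tau> k \<le> \<tau> (Suc k)"
  shows "simple_process m \<tau> \<xi> s \<omega> = simple_sum m \<tau> \<xi> (\<lambda>x. if s \<le> x then 1 else 0) \<omega>"
  unfolding simple_process_def simple_sum_def using assms
  by (intro sum.cong) (auto simp: indicator_def, meson not_le order_trans lessThan_iff)

lemma simple_process_value:
  assumes "\<And>k. k < m \<Longrightarrow> \<tau> k \<le> \<tau> (Suc k)" "k < m" "\<tau> k < s" "s \<le> \<tau> (Suc k)"
  shows "simple_process m \<tau> \<xi> s \<omega> = \<xi> k \<omega>"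
proof -
  have "simple_process m \<tau> \<xi> s \<omega> = (\<Sum>j<m. if j = k then \<xi> k \<omega> else 0)"
    unfolding simple_process_def
  proof (rule sum.cong)
    fix j assume j: "j \<in> {..<m}"
    have "\<tau> (Suc j) \<le> \<tau> k" if "j < k"
      using grid_mono[of m \<tau> "Suc j" k] assms(1,2) that by simp
    moreover have "\<tau> (Suc k) \<le> \<tau> j" if "k < j"
      using grid_mono[of m \<tau> "Suc k" j] assms(1) that j by simp
    ultimately have "s \<notin> {\<tau> j<..\<tau> (Suc j)}" if "j \<noteq> k"
      using assms(3,4) that by (cases j k rule: linorder_cases) force+
    then show "\<xi> j \<omega> * indicator {\<tau> j<..\<tau> (Suc j)} s = (if j = k then \<xi> k \<omega> else 0)"
      using assms(3,4) by auto
  qed simp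
  also have "\<dots> = \<xi> k \<omega>" using assms(2) by simp
  finally show ?thesis .
qed

text \<open>The cells are disjoint, so at each time at most one term of the sum is nonzero.\<close>

lemma simple_process_square:
  assumes "\<And>k. k < m \<Longrightarrow> \<tau> k \<le> \<tau> (Suc k)"
  shows "(simple_process m \<tau> \<xi> s \<omega>)\<^sup>2 = simple_process m \<tau> (\<lambda>k \<omega>. (\<xi> k \<omega>)\<^sup>2) s \<omega>"
proof (cases "\<exists>k<m. s \<in> {\<tau> k<..\<tau> (Suc k)}")
  case True
  then obtain k where "k < m" "\<tau> k < s" "s \<le> \<tau> (Suc k)" by auto
  then have "simple_process m \<tau> \<eta> s \<omega> = \<eta> k \<omega>" for \<eta>
    using assms by (intro simple_process_value) auto
  then show ?thesis by (simp only:)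
next
  case False
  then have "simple_process m \<tau> \<eta> s \<omega> = 0" for \<eta>
    unfolding simple_process_def by (intro sum.neutral) auto
  then show ?thesis by simp
qed

text \<open>Inserting the integrator \<open>\<lambda>t \<omega>. t\<close> turns
  \<open>simple_integral\<close> into a time integral. Drift terms and squared L^2 norms are written
  in this form below.\<close>

lemma simple_process_lebesgue_integral:
  assumes "\<And>k. k < m \<Longrightarrow> 0 \<le> \<tau> k \<and> \<tau> k \<le> \<tau> (Suc k)" "0 \<le> t"
  shows "has_bochner_integral lborel (\<lambda>s. indicator {0..t} s * simple_process m \<tau> \<xi> s \<omega>)
    (simple_integral (\<lambda>t \<omega>. t) m \<tau> \<xi> t \<omega>)"
proof -
  have "has_bochner_integral lborel (\<lambda>s. \<Sum>k<m. \<xi> k \<omega> * indicator ({\<tau> k<..\<tau> (Suc k)} \<inter> {0..t}) s)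
    (simple_integral (\<lambda>t \<omega>. t) m \<tau> \<xi> t \<omega>)"
    unfolding simple_integral_def
  proof (intro has_bochner_integral_sum has_bochner_integral_mult_right)
    fix k assume "k \<in> {..<m}"
    then have k: "0 \<le> \<tau> k" "\<tau> k \<le> \<tau> (Suc k)" using assms(1)[of k] by auto
    show "has_bochner_integral lborel (indicator ({\<tau> k<..\<tau> (Suc k)} \<inter> {0..t})) (min t (\<tau> (Suc k)) - min t (\<tau> k))"
    proof (cases "\<tau> k \<le> t")
      case True
      have "{\<tau> k<..\<tau> (Suc k)} \<inter> {0..t} = {\<tau> k<..min t (\<tau> (Suc k))}" using k by auto
      then show ?thesis
        using True k has_bochner_integral_real_indicator[of "{\<tau> k<..min t (\<tau> (Suc k))}" lborel] by simp
    next
      case False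
      then have "{\<tau> k<..\<tau> (Suc k)} \<inter> {0..t} = {}" by auto
      then show ?thesis using False k has_bochner_integral_zero[of lborel, where 'b = real] by (simp add: indicator_def[abs_def])
    qed
  qed
  also have "(\<lambda>s. \<Sum>k<m. \<xi> k \<omega> * indicator ({\<tau> k<..\<tau> (Suc k)} \<inter> {0..t}) s) =
     (\<lambda>s. indicator {0..t} s * simple_process m \<tau> \<xi> s \<omega>)"
    unfolding simple_process_def sum_distrib_left indicator_inter_arith
    by (intro ext sum.cong) (simp_all only: mult_ac)
  finally show ?thesis .
qed

lemma simple_process_nn_integral_square:
  assumes "\<And>k. k < m \<Longrightarrow> 0 \<le> \<tau> k \<and> \<tau> k \<le> \<tau> (Suc k)" "0 \<le> t"
  shows "(\<integral>\<^sup>+s\<in>{0..t}. ennreal ((simple_process m \<tau> \<xi> s \<omega>)\<^sup>2) \<partial>lborel) =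
    ennreal (simple_integral (\<lambda>t \<omega>. t) m \<tau> (\<lambda>k \<omega>. (\<xi> k \<omega>)\<^sup>2) t \<omega>)"
proof -
  let ?f = "\<lambda>s. indicator {0..t} s * simple_process m \<tau> (\<lambda>k \<omega>. (\<xi> k \<omega>)\<^sup>2) s \<omega>"
  note hb = simple_process_lebesgue_integral[of m \<tau> t "\<lambda>k \<omega>. (\<xi> k \<omega>)\<^sup>2" \<omega>, OF _ assms(2)]
  have sq: "simple_process m \<tau> (\<lambda>k \<omega>. (\<xi> k \<omega>)\<^sup>2) s \<omega> = (simple_process m \<tau> \<xi> s \<omega>)\<^sup>2" for s
    using simple_process_square[of m \<tau> \<xi> s \<omega>] assms by simp
  have "(\<integral>\<^sup>+s\<in>{0..t}. ennreal ((simple_process m \<tau> \<xi> s \<omega>)\<^sup>2) \<partial>lborel) = (\<integral>\<^sup>+s. ennreal (?f s) \<partial>lborel)"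
    by (intro nn_integral_cong) (auto simp: sq indicator_def)
  also have "\<dots> = ennreal (\<integral>s. ?f s \<partial>lborel)"
    using hb assms by (intro nn_integral_eq_integral) (auto simp: sq dest: integrable.intros)
  also have "(\<integral>s. ?f s \<partial>lborel) = simple_integral (\<lambda>t \<omega>. t) m \<tau> (\<lambda>k \<omega>. (\<xi> k \<omega>)\<^sup>2) t \<omega>"
    using hb assms(1) by (blast intro: has_bochner_integral_integral_eq)
  finally show ?thesis .
qed

text \<open>The cells between two points of a sorted list are consecutive, so the increments over
  them telescope. This rewrites one term of a simple sum over a finer grid.\<close>

lemma telescope_sorted_list:
  fixes xs :: "real list" and g :: "real \<Rightarrow> real"
  assumes "sorted_wrt (<) xs" "u \<in> set xs" "v \<in> set xs" "u \<le> v"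
  shows "(\<Sum>j<length xs - 1. if u \<le> xs ! j \<and> xs ! Suc j \<le> v then g (xs ! Suc j) - g (xs ! j) else 0) = g v - g u"
proof -
  obtain a b where ab: "a < length xs" "xs ! a = u" "b < length xs" "xs ! b = v"
    using assms(2,3) by (metis in_set_conv_nth)
  have le: "xs ! i \<le> xs ! j \<longleftrightarrow> i \<le> j" if "i < length xs" "j < length xs" for i j
    using sorted_wrt_nth_less[OF assms(1), of i j] sorted_wrt_nth_less[OF assms(1), of j i] that
    by (cases i j rule: linorder_cases) auto
  have "a \<le> b" using le ab assms(4) by blast
  have "(\<Sum>j<length xs - 1. if u \<le> xs ! j \<and> xs ! Suc j \<le> v then g (xs ! Suc j) - g (xs ! j) else 0) =
     (\<Sum>j<length xs - 1. if j \<in> {a..<b} then g (xs ! Suc j) - g (xs ! j) else 0)"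
  proof (rule sum.cong)
    fix j assume "j \<in> {..<length xs - 1}"
    then have "j < length xs" "Suc j < length xs" by auto
    then show "(if u \<le> xs ! j \<and> xs ! Suc j \<le> v then g (xs ! Suc j) - g (xs ! j) else 0) =
      (if j \<in> {a..<b} then g (xs ! Suc j) - g (xs ! j) else 0)"
      using le[of a j] le[of "Suc j" b] ab by auto
  qed simp
  also have "\<dots> = (\<Sum>j\<in>{a..<b}. g (xs ! Suc j) - g (xs ! j))"
    using ab by (subst sum.inter_restrict[symmetric]) (auto intro!: sum.cong)
  also have "\<dots> = g v - g u" using sum_Suc_diff'[OF \<open>a \<le> b\<close>, of "\<lambda>j. g (xs ! j)"] ab by simp
  finally show ?thesis .
qed

section \<open>Common refinements of simple integrands and uniqueness of the limit of their
  integrals\<close>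

context scalar_bm
begin

lemma simple_integrand_grid:
  assumes "simple_integrand M F m \<tau> \<xi>" "k \<le> m"
  shows "0 \<le> \<tau> k"
  using grid_mono[of m \<tau> 0 k] assms unfolding simple_integrand_def by fastforce

text \<open>Both integrands are rewritten over the union of their grids and subtracted cell by cell.
  Quantifying over \<open>g\<close> yields the difference of the processes and of the integrals from
  one construction.\<close>

lemma simple_integrand_diff:
  assumes 1: "simple_integrand M F m \<tau> \<xi>" and 2: "simple_integrand M F m' \<tau>' \<xi>'"
  obtains l p \<zeta> where "simple_integrand M F l p \<zeta>"
    "\<And>g \<omega>. simple_sum l p \<zeta> g \<omega> = simple_sum m \<tau> \<xi> g \<omega> - simple_sum m' \<tau>' \<xi>' g \<omega>"
proof -
  let ?P = "\<tau> ` {..m} \<union> \<tau>' ` {..m'}"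
  define xs where "xs = sorted_list_of_set ?P"
  have set: "set xs = ?P" and ss: "sorted_wrt (<) xs" unfolding xs_def by simp_all
  define p where "p j = xs ! j" for j
  define l where "l = length xs - 1"
  \<comment> \<open>Value on the cell from \<open>p j\<close> to \<open>p (Suc j)\<close>: only
    those \<open>\<xi> k\<close> contribute whose interval contains the cell. They satisfy
    \<open>\<tau> k \<le> p j\<close> and are hence known at time \<open>p j\<close>.\<close>
  define R where "R m \<tau> \<xi> j \<omega> = (\<Sum>k<m. if \<tau> k \<le> p j \<and> p (Suc j) \<le> \<tau> (Suc k) then \<xi> k \<omega> else 0)"
    for m and \<tau> :: "nat \<Rightarrow> real" and \<xi> :: "nat \<Rightarrow> 'w \<Rightarrow> real" and j \<omega>
  have xs: "xs \<noteq> []" using set by auto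
  have pin: "p j \<in> ?P" if "j \<le> l" for j
    using that xs set nth_mem[of j xs] unfolding p_def l_def by (cases xs) auto
  have ppos: "0 \<le> p j" if "j \<le> l" for j
    using pin[OF that] simple_integrand_grid[OF 1] simple_integrand_grid[OF 2] by auto
  have pmono: "p j \<le> p (Suc j)" if "j < l" for j
    using ss that unfolding p_def l_def strict_sorted_iff by (simp add: sorted_nth_mono)
  have Rsum: "(\<Sum>j<l. R m \<tau> \<xi> j \<omega> * (g (p (Suc j)) - g (p j))) = simple_sum m \<tau> \<xi> g \<omega>"
    if si: "simple_integrand M F m \<tau> \<xi>" and sub: "\<tau> ` {..m} \<subseteq> ?P" for m \<tau> \<xi> g \<omega>
  proof -
    have "(\<Sum>j<l. R m \<tau> \<xi> j \<omega> * (g (p (Suc j)) - g (p j))) =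
      (\<Sum>j<l. \<Sum>k<m. \<xi> k \<omega> * (if \<tau> k \<le> p j \<and> p (Suc j) \<le> \<tau> (Suc k) then g (p (Suc j)) - g (p j) else 0))"
      unfolding R_def sum_distrib_right by (intro sum.cong) auto
    also have "\<dots> = (\<Sum>k<m. \<xi> k \<omega> * (\<Sum>j<l. if \<tau> k \<le> p j \<and> p (Suc j) \<le> \<tau> (Suc k) then g (p (Suc j)) - g (p j) else 0))"
      unfolding sum_distrib_left by (rule sum.swap)
    also have "\<dots> = simple_sum m \<tau> \<xi> g \<omega>"
      unfolding simple_sum_def
    proof (rule sum.cong)
      fix k assume "k \<in> {..<m}"
      then have "\<tau> k \<in> set xs" "\<tau> (Suc k) \<in> set xs" "\<tau> k \<le> \<tau> (Suc k)"
        using subsetD[OF sub, of "\<tau> k"] subsetD[OF sub, of "\<tau> (Suc k)"] set si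
        simple_integrandD(1)[OF si, of k] by auto
      from telescope_sorted_list[OF ss this]
      show "\<xi> k \<omega> * (\<Sum>j<l. if \<tau> k \<le> p j \<and> p (Suc j) \<le> \<tau> (Suc k) then g (p (Suc j)) - g (p j) else 0) =
        \<xi> k \<omega> * (g (\<tau> (Suc k)) - g (\<tau> k))"
        unfolding p_def l_def by simp
    qed simp
    finally show ?thesis .
  qed
  have Rmeas: "R m \<tau> \<xi> j \<in> borel_measurable (F (p j))"
    if si: "simple_integrand M F m \<tau> \<xi>" and "j < l" for m \<tau> \<xi> j
    unfolding R_def
  proof (intro borel_measurable_sum)
    fix k assume "k \<in> {..<m}"
    then have k: "k < m" by simp
    have "\<xi> k \<in> borel_measurable (F (\<tau> k))" using simple_integrandD(2)[OF si k] .
    then have *: "\<xi> k \<in> borel_measurable (F (p j))" if "\<tau> k \<le> p j"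
      using measurable_F_mono simple_integrand_grid[OF si, of k] k that by (metis less_imp_le)
    show "(\<lambda>\<omega>. if \<tau> k \<le> p j \<and> p (Suc j) \<le> \<tau> (Suc k) then \<xi> k \<omega> else 0) \<in> borel_measurable (F (p j))"
    proof (cases "\<tau> k \<le> p j \<and> p (Suc j) \<le> \<tau> (Suc k)")
      case True
      with * show ?thesis by (simp only: simp_thms if_True)
    next
      case False
      then show ?thesis by (simp only: if_False) simp
    qed
  qed
  have Rbdd: "\<exists>C. \<forall>\<omega>\<in>space M. \<bar>R m \<tau> \<xi> j \<omega>\<bar> \<le> C"
    if si: "simple_integrand M F m \<tau> \<xi>" for m \<tau> \<xi> j
  proof -
    define C where "C k = (SOME C. \<forall>\<omega>\<in>space M. \<bar>\<xi> k \<omega>\<bar> \<le> C)" for k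
    have C: "\<forall>\<omega>\<in>space M. \<bar>\<xi> k \<omega>\<bar> \<le> C k" if "k < m" for k
      unfolding C_def by (rule someI_ex[OF simple_integrandD(3)[OF si that]])
    have "\<bar>R m \<tau> \<xi> j \<omega>\<bar> \<le> (\<Sum>k<m. \<bar>C k\<bar>)" if "\<omega> \<in> space M" for \<omega>
      unfolding R_def
    proof (rule order_trans[OF sum_abs sum_mono])
      fix k assume "k \<in> {..<m}"
      then show "\<bar>if \<tau> k \<le> p j \<and> p (Suc j) \<le> \<tau> (Suc k) then \<xi> k \<omega> else 0\<bar> \<le> \<bar>C k\<bar>"
        using C[of k] that order_trans[OF _ abs_ge_self[of "C k"]] by auto
    qed
    then show ?thesis by blast
  qed
  show ?thesis
  proof (rule that[of l p "\<lambda>j \<omega>. R m \<tau> \<xi> j \<omega> - R m' \<tau>' \<xi>' j \<omega>"])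
    have "\<exists>C. \<forall>\<omega>\<in>space M. \<bar>R m \<tau> \<xi> j \<omega> - R m' \<tau>' \<xi>' j \<omega>\<bar> \<le> C" for j
    proof -
      obtain C C' where "\<forall>\<omega>\<in>space M. \<bar>R m \<tau> \<xi> j \<omega>\<bar> \<le> C" "\<forall>\<omega>\<in>space M. \<bar>R m' \<tau>' \<xi>' j \<omega>\<bar> \<le> C'"
        using Rbdd[OF 1] Rbdd[OF 2] by blast
      then have "\<forall>\<omega>\<in>space M. \<bar>R m \<tau> \<xi> j \<omega> - R m' \<tau>' \<xi>' j \<omega>\<bar> \<le> C + C'"
        by (fastforce intro: order_trans[OF abs_triangle_ineq4 add_mono])
      then show ?thesis by blast
    qed
    then show "simple_integrand M F l p (\<lambda>j \<omega>. R m \<tau> \<xi> j \<omega> - R m' \<tau>' \<xi>' j \<omega>)"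
      unfolding simple_integrand_def
      using ppos[of 0] pmono Rmeas[OF 1] Rmeas[OF 2] by (intro conjI allI impI borel_measurable_diff) auto
    show "simple_sum l p (\<lambda>j \<omega>. R m \<tau> \<xi> j \<omega> - R m' \<tau>' \<xi>' j \<omega>) g \<omega> =
       simple_sum m \<tau> \<xi> g \<omega> - simple_sum m' \<tau>' \<xi>' g \<omega>" for g \<omega>
      using Rsum[OF 1, of \<omega> g] Rsum[OF 2, of \<omega> g]
      unfolding simple_sum_def[of l] by (simp add: left_diff_distrib sum_subtractf)
  qed
qed

lemma simple_integral_measurable:
  assumes "simple_integrand M F m \<tau> \<xi>" "0 \<le> t"
  shows "simple_integral B m \<tau> \<xi> t \<in> borel_measurable M"
  unfolding simple_integral_def
proof (intro borel_measurable_sum borel_measurable_times borel_measurable_diff)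
  fix k assume "k \<in> {..<m}"
  then have k: "k < m" by simp
  have "0 \<le> \<tau> k" "0 \<le> \<tau> (Suc k)"
    using simple_integrand_grid[OF assms(1)] k by auto
  then show "\<xi> k \<in> borel_measurable M" "B (min t (\<tau> (Suc k))) \<in> borel_measurable M"
    "B (min t (\<tau> k)) \<in> borel_measurable M"
    using simple_integrandD(2)[OF assms(1) k] measurable_F_M B_measurable_M assms(2) by auto
qed

text \<open>Dropping \<open>\<xi> k\<close> as soon as the integral of the squared integrand up to \<open>\<tau> (Suc k)\<close>
  exceeds \<open>\<delta>\<close> keeps the integrand adapted and makes the isometry applicable.\<close>

lemma simple_integral_prob_le:
  assumes si: "simple_integrand M F m \<tau> \<xi>" and "0 \<le> t" "0 \<le> \<delta>" "0 < \<epsilon>"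
  shows "prob {\<omega>\<in>space M. \<epsilon> < \<bar>simple_integral B m \<tau> \<xi> t \<omega>\<bar>} \<le>
    prob {\<omega>\<in>space M. \<delta> < simple_integral (\<lambda>t \<omega>. t) m \<tau> (\<lambda>k \<omega>. (\<xi> k \<omega>)\<^sup>2) t \<omega>} + \<delta> / \<epsilon>\<^sup>2"
proof -
  define p where "p k = min t (\<tau> k)" for k
  define d where "d k = p (Suc k) - p k" for k
  define q where "q j \<omega> = (\<Sum>i<j. (\<xi> i \<omega>)\<^sup>2 * d i)" for j \<omega>
  \<comment> \<open>The quantity \<open>q (Suc k)\<close> already includes cell \<open>k\<close> and
    is still known at time \<open>\<tau> k\<close>, since the lengths are deterministic and
    \<open>\<xi> k\<close> is known then. For \<open>\<tau> k \<ge> t\<close> the clipped cell is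
    empty and \<open>\<xi> k\<close> may be unknown at time \<open>t\<close>, so it is replaced by
    0.\<close>
  define \<eta> where "\<eta> k \<omega> = (if \<tau> k < t \<and> q (Suc k) \<omega> \<le> \<delta> then \<xi> k \<omega> else 0)" for k \<omega>
  define U where "U \<omega> = (\<Sum>k<m. \<eta> k \<omega> * (B (p (Suc k)) \<omega> - B (p k) \<omega>))" for \<omega>
  have tot: "simple_integral (\<lambda>t \<omega>. t) m \<tau> (\<lambda>k \<omega>. (\<xi> k \<omega>)\<^sup>2) t = q m"
    by (simp add: fun_eq_iff simple_integral_def q_def d_def p_def)
  have p: "0 \<le> p k" "p k \<le> p (Suc k)" if "k < m" for k
    using simple_integrand_grid[OF si, of k] simple_integrandD(1)[OF si that] \<open>0 \<le> t\<close> that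
    by (auto simp: p_def)
  have d: "0 \<le> d k" if "k < m" for k using p[OF that] by (simp add: d_def)
  have qmono: "q i \<omega> \<le> q j \<omega>" if "i \<le> j" "j \<le> m" for i j \<omega>
    unfolding q_def using d that by (intro sum_mono2) auto
  have qmeas: "q (Suc k) \<in> borel_measurable (F (\<tau> k))" if "k < m" for k
    unfolding q_def
  proof (intro borel_measurable_sum borel_measurable_times borel_measurable_power borel_measurable_const)
    fix i assume "i \<in> {..<Suc k}"
    then have "i \<le> k" by simp
    then have "\<tau> i \<le> \<tau> k" using grid_mono[of m \<tau> i k] simple_integrandD(1)[OF si] that by simp
    then show "\<xi> i \<in> borel_measurable (F (\<tau> k))"
      using measurable_F_mono[OF simple_integrandD(2)[OF si]] simple_integrand_grid[OF si] that \<open>i \<le> k\<close>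
      by auto
  qed
  have \<eta>meas: "\<eta> k \<in> borel_measurable (F (p k))" if "k < m" for k
  proof (cases "\<tau> k < t")
    case True
    have [measurable]: "q (Suc k) \<in> borel_measurable (F (\<tau> k))" by (rule qmeas[OF that])
    have [measurable]: "\<xi> k \<in> borel_measurable (F (\<tau> k))" by (rule simple_integrandD(2)[OF si that])
    have "p k = \<tau> k" using True by (simp add: p_def)
    moreover have "(\<lambda>\<omega>. if q (Suc k) \<omega> \<le> \<delta> then \<xi> k \<omega> else 0) \<in> borel_measurable (F (\<tau> k))" by measurable
    ultimately show ?thesis unfolding \<eta>_def using True by (simp only: simp_thms)
  next
    case False
    have "(\<lambda>\<omega>. 0 :: real) \<in> borel_measurable (F (p k))" by simp
    then show ?thesis unfolding \<eta>_def using False by (simp only: simp_thms if_False)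
  qed
  have \<eta>M: "\<eta> k \<in> borel_measurable M" if "k < m" for k
    using measurable_F_M[OF \<eta>meas[OF that]] p[OF that] by simp
  have \<eta>int: "integrable M (\<lambda>\<omega>. (\<eta> k \<omega>)\<^sup>2)" if km: "k < m" for k
  proof -
    obtain C where C: "\<forall>\<omega>\<in>space M. \<bar>\<xi> k \<omega>\<bar> \<le> C" using simple_integrandD(3)[OF si km] by blast
    show ?thesis
    proof (rule integrable_const_bound[where B = "C\<^sup>2"])
      show "AE \<omega> in M. norm ((\<eta> k \<omega>)\<^sup>2) \<le> C\<^sup>2"
      proof (rule AE_I2)
        fix \<omega> assume "\<omega> \<in> space M"
        then have "\<bar>\<xi> k \<omega>\<bar> \<le> C" using C by blast
        then have "\<bar>\<eta> k \<omega>\<bar> \<le> \<bar>C\<bar>" by (auto simp: \<eta>_def)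
        then show "norm ((\<eta> k \<omega>)\<^sup>2) \<le> C\<^sup>2" by (simp add: abs_le_square_iff)
      qed
    qed (use \<eta>M[OF km] in measurable)
  qed
  \<comment> \<open>If the last cell is within the budget, so are all earlier ones; otherwise its
    coefficient is 0 and the sum does not grow.\<close>
  have bound: "n \<le> m \<Longrightarrow> (\<Sum>k<n. (\<eta> k \<omega>)\<^sup>2 * d k) \<le> \<delta>" for n \<omega>
  proof (induction n)
    case (Suc n)
    show ?case
    proof (cases "q (Suc n) \<omega> \<le> \<delta>")
      case True
      have "(\<Sum>k<Suc n. (\<eta> k \<omega>)\<^sup>2 * d k) \<le> q (Suc n) \<omega>"
        unfolding q_def using d Suc.prems by (intro sum_mono mult_right_mono) (auto simp: \<eta>_def)
      with True show ?thesis by simp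
    next
      case False
      then have "\<eta> n \<omega> = 0" by (simp add: \<eta>_def)
      then show ?thesis using Suc by simp
    qed
  qed (simp add: \<open>0 \<le> \<delta>\<close>)
  have iso: "integrable M (\<lambda>\<omega>. (U \<omega>)\<^sup>2)"
    "expectation (\<lambda>\<omega>. (U \<omega>)\<^sup>2) = (\<Sum>k<m. expectation (\<lambda>\<omega>. (\<eta> k \<omega>)\<^sup>2) * d k)"
    unfolding U_def d_def using p \<eta>meas \<eta>int by (intro ito_isometry_sum; simp)+
  have "expectation (\<lambda>\<omega>. (U \<omega>)\<^sup>2) = expectation (\<lambda>\<omega>. \<Sum>k<m. (\<eta> k \<omega>)\<^sup>2 * d k)"
    unfolding iso(2) using \<eta>int by (subst Bochner_Integration.integral_sum) auto
  also have "\<dots> \<le> expectation (\<lambda>\<omega>. \<delta>)"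
    using \<eta>int bound[of m] by (intro integral_mono) auto
  finally have EU: "expectation (\<lambda>\<omega>. (U \<omega>)\<^sup>2) \<le> \<delta>" by (simp add: prob_space)
  have [measurable]: "U \<in> borel_measurable M"
    unfolding U_def
  proof (intro borel_measurable_sum borel_measurable_times borel_measurable_diff)
    fix k assume "k \<in> {..<m}"
    then show "\<eta> k \<in> borel_measurable M" "B (p (Suc k)) \<in> borel_measurable M" "B (p k) \<in> borel_measurable M"
      using \<eta>M[of k] B_measurable_M[of "p k"] B_measurable_M[of "p (Suc k)"] p[of k] by auto
  qed
  have [measurable]: "q m \<in> borel_measurable M"
    unfolding q_def
    using measurable_F_M[OF simple_integrandD(2)[OF si]] simple_integrand_grid[OF si]
    by (intro borel_measurable_sum borel_measurable_times borel_measurable_power) auto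
  \<comment> \<open>On the event that the whole budget is respected nothing has been dropped, so the
    truncated integral is the original one.\<close>
  have agree: "simple_integral B m \<tau> \<xi> t \<omega> = U \<omega>" if "q m \<omega> \<le> \<delta>" for \<omega>
    unfolding simple_integral_def U_def
  proof (rule sum.cong)
    fix k assume "k \<in> {..<m}"
    then have k: "k < m" by simp
    show "\<xi> k \<omega> * (B (min t (\<tau> (Suc k))) \<omega> - B (min t (\<tau> k)) \<omega>) = \<eta> k \<omega> * (B (p (Suc k)) \<omega> - B (p k) \<omega>)"
    proof (cases "\<tau> k < t")
      case True
      have "q (Suc k) \<omega> \<le> \<delta>" using qmono[of "Suc k" m \<omega>] that k by simp
      then show ?thesis using True by (simp add: \<eta>_def p_def)
    next
      case False
      then have "min t (\<tau> (Suc k)) = min t (\<tau> k)" using simple_integrandD(1)[OF si k] by simp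
      then show ?thesis using False by (simp add: \<eta>_def)
    qed
  qed simp
  have "prob {\<omega>\<in>space M. \<epsilon> < \<bar>simple_integral B m \<tau> \<xi> t \<omega>\<bar>}
     \<le> prob ({\<omega>\<in>space M. \<delta> < q m \<omega>} \<union> {\<omega>\<in>space M. \<epsilon> \<le> \<bar>U \<omega>\<bar>})"
  proof (rule finite_measure_mono)
    show "{\<omega>\<in>space M. \<epsilon> < \<bar>simple_integral B m \<tau> \<xi> t \<omega>\<bar>} \<subseteq>
       {\<omega>\<in>space M. \<delta> < q m \<omega>} \<union> {\<omega>\<in>space M. \<epsilon> \<le> \<bar>U \<omega>\<bar>}"
      using agree by (auto simp: not_less) (metis less_imp_le not_le)
  qed measurable
  also have "\<dots> \<le> prob {\<omega>\<in>space M. \<delta> < q m \<omega>} + prob {\<omega>\<in>space M. \<epsilon> \<le> \<bar>U \<omega>\<bar>}"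
    by (rule measure_Un_le) measurable
  also have "prob {\<omega>\<in>space M. \<epsilon> \<le> \<bar>U \<omega>\<bar>} \<le> expectation (\<lambda>\<omega>. (U \<omega>)\<^sup>2) / \<epsilon>\<^sup>2"
    by (rule prob_ge_le_second_moment[OF _ iso(1) \<open>0 < \<epsilon>\<close>]) measurable
  also have "\<dots> \<le> \<delta> / \<epsilon>\<^sup>2" using EU by (simp add: divide_right_mono)
  finally show ?thesis by (simp add: tot)
qed

text \<open>Progressive measurability makes the integrand jointly measurable in time and outcome on
  \<open>{0..T}\<close>, and integrating out the time leaves a measurable function.\<close>

lemma distance_measurable:
  assumes H: "progressively_measurable F H" and si: "simple_integrand M F m \<tau> \<xi>" and "0 \<le> T"
  shows "(\<lambda>\<omega>. \<integral>\<^sup>+s\<in>{0..T}. ennreal ((simple_process m \<tau> \<xi> s \<omega> - H s \<omega>)\<^sup>2) \<partial>lborel) \<in> borel_measurable M"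
proof -
  let ?R = "restrict_space lborel {0..T} :: real measure"
  interpret R: sigma_finite_measure ?R
    by (rule sigma_finite_measure_restrict_space) (auto intro: lborel.sigma_finite_measure_axioms)
  have "(\<lambda>(\<omega>, t). (t, \<omega>)) \<in> M \<Otimes>\<^sub>M ?R \<rightarrow>\<^sub>M restrict_space borel {0..T} \<Otimes>\<^sub>M F T"
  proof -
    have "(\<lambda>x. snd x) \<in> M \<Otimes>\<^sub>M ?R \<rightarrow>\<^sub>M restrict_space borel {0..T}"
      by (intro measurable_snd'' measurable_ident_sets) (simp add: sets_restrict_space)
    moreover have "(\<lambda>x. fst x) \<in> M \<Otimes>\<^sub>M ?R \<rightarrow>\<^sub>M F T"
      using subalg[OF \<open>0 \<le> T\<close>]
      by (intro measurable_fst'' measurable_from_subalg[of M "F T"]) (auto simp: measurable_ident)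
    ultimately show ?thesis by (simp add: case_prod_beta measurable_Pair)
  qed
  from measurable_compose[OF this H[unfolded progressively_measurable_def, rule_format, OF \<open>0 \<le> T\<close>]]
  have Hm[measurable]: "(\<lambda>x. H (snd x) (fst x)) \<in> borel_measurable (M \<Otimes>\<^sub>M ?R)"
    by (simp add: case_prod_beta)
  have Sm[measurable]: "(\<lambda>x. simple_process m \<tau> \<xi> (snd x) (fst x)) \<in> borel_measurable (M \<Otimes>\<^sub>M ?R)"
    unfolding simple_process_def
  proof (intro borel_measurable_sum borel_measurable_times)
    fix k assume "k \<in> {..<m}"
    then have "\<xi> k \<in> borel_measurable M"
      using measurable_F_M[OF simple_integrandD(2)[OF si]] simple_integrand_grid[OF si] by simp
    then show "(\<lambda>x. \<xi> k (fst x)) \<in> borel_measurable (M \<Otimes>\<^sub>M ?R)" by measurable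
    have "indicator {\<tau> k<..\<tau> (Suc k)} \<in> borel_measurable ?R"
      by (intro measurable_restrict_space1) measurable
    then show "(\<lambda>x. indicator {\<tau> k<..\<tau> (Suc k)} (snd x) :: real) \<in> borel_measurable (M \<Otimes>\<^sub>M ?R)"
      by (rule measurable_snd'')
  qed
  have "(\<lambda>\<omega>. \<integral>\<^sup>+s. ennreal ((simple_process m \<tau> \<xi> s \<omega> - H s \<omega>)\<^sup>2) \<partial>?R) \<in> borel_measurable M"
    by (rule R.borel_measurable_nn_integral) (simp add: case_prod_beta, measurable)
  then show ?thesis by (simp add: nn_integral_restrict_space)
qed

text \<open>The difference of the two approximations is again a simple integrand, and it tends to 0
  in L^2(0, t) in probability because both tend to \<open>H\<close>. The truncated isometry
  \<open>simple_integral_prob_le\<close> turns this into convergence of the integrals.\<close>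

lemma simple_integral_limit_unique:
  assumes H: "progressively_measurable F H"
    and 1: "\<And>n. simple_integrand M F (m n) (\<tau> n) (\<xi> n)" and 2: "\<And>n. simple_integrand M F (m' n) (\<tau>' n) (\<xi>' n)"
    and "0 \<le> t"
    and lim1: "\<And>\<epsilon>. 0 < \<epsilon> \<Longrightarrow> (\<lambda>n. prob {\<omega>\<in>space M. ennreal \<epsilon> <
       (\<integral>\<^sup>+s\<in>{0..t}. ennreal ((simple_process (m n) (\<tau> n) (\<xi> n) s \<omega> - H s \<omega>)\<^sup>2) \<partial>lborel)}) \<longlonglongrightarrow> 0"
    and lim2: "\<And>\<epsilon>. 0 < \<epsilon> \<Longrightarrow> (\<lambda>n. prob {\<omega>\<in>space M. ennreal \<epsilon> <
       (\<integral>\<^sup>+s\<in>{0..t}. ennreal ((simple_process (m' n) (\<tau>' n) (\<xi>' n) s \<omega> - H s \<omega>)\<^sup>2) \<partial>lborel)}) \<longlonglongrightarrow> 0"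
  shows "tends_in_prob M (\<lambda>n \<omega>. simple_integral B (m n) (\<tau> n) (\<xi> n) t \<omega> -
     simple_integral B (m' n) (\<tau>' n) (\<xi>' n) t \<omega>) (\<lambda>_. 0)"
  unfolding tends_in_prob_def
proof (intro allI impI LIMSEQ_I)
  fix \<epsilon> e :: real assume "0 < \<epsilon>" "0 < e"
  \<comment> \<open>With this choice the isometry term \<open>\<delta> / \<epsilon>\<^sup>2\<close>
    equals e / 3; the two distances contribute the other two thirds.\<close>
  define \<delta> where "\<delta> = e * \<epsilon>\<^sup>2 / 3"
  have \<delta>: "0 < \<delta>" using \<open>0 < \<epsilon>\<close> \<open>0 < e\<close> by (simp add: \<delta>_def)
  define Q where "Q n \<omega> = (\<integral>\<^sup>+s\<in>{0..t}. ennreal ((simple_process (m n) (\<tau> n) (\<xi> n) s \<omega> - H s \<omega>)\<^sup>2) \<partial>lborel)" for n \<omega>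
  define Q' where "Q' n \<omega> = (\<integral>\<^sup>+s\<in>{0..t}. ennreal ((simple_process (m' n) (\<tau>' n) (\<xi>' n) s \<omega> - H s \<omega>)\<^sup>2) \<partial>lborel)" for n \<omega>
  have [measurable]: "Q n \<in> borel_measurable M" "Q' n \<in> borel_measurable M" for n
    unfolding Q_def Q'_def using distance_measurable[OF H 1 \<open>0 \<le> t\<close>] distance_measurable[OF H 2 \<open>0 \<le> t\<close>] by blast+
  \<comment> \<open>The squared distance of the approximations is at most twice the sum of their
    squared distances to \<open>H\<close>, so it can exceed \<delta> only if one of these exceeds a
    quarter of \<delta>.\<close>
  let ?A = "\<lambda>n. {\<omega>\<in>space M. ennreal (\<delta> / 4) < Q n \<omega>}" and ?A' = "\<lambda>n. {\<omega>\<in>space M. ennreal (\<delta> / 4) < Q' n \<omega>}"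
  have "(\<lambda>n. prob (?A n)) \<longlonglongrightarrow> 0" "(\<lambda>n. prob (?A' n)) \<longlonglongrightarrow> 0"
    using lim1[of "\<delta> / 4"] lim2[of "\<delta> / 4"] \<delta> unfolding Q_def Q'_def by simp_all
  from LIMSEQ_D[OF this(1), of "e / 3"] LIMSEQ_D[OF this(2), of "e / 3"] \<open>0 < e\<close>
  obtain N N' where N: "\<And>n. N \<le> n \<Longrightarrow> prob (?A n) < e / 3" "\<And>n. N' \<le> n \<Longrightarrow> prob (?A' n) < e / 3"
    by auto
  have "prob {\<omega>\<in>space M. \<epsilon> < \<bar>simple_integral B (m n) (\<tau> n) (\<xi> n) t \<omega> -
     simple_integral B (m' n) (\<tau>' n) (\<xi>' n) t \<omega>\<bar>} \<le> prob (?A n) + prob (?A' n) + e / 3" for n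
  proof -
    obtain l p \<zeta> where si: "simple_integrand M F l p \<zeta>"
      and diff: "\<And>g \<omega>. simple_sum l p \<zeta> g \<omega> = simple_sum (m n) (\<tau> n) (\<xi> n) g \<omega> - simple_sum (m' n) (\<tau>' n) (\<xi>' n) g \<omega>"
      using simple_integrand_diff[OF 1 2] by metis
    have pd: "simple_process l p \<zeta> s \<omega> = simple_process (m n) (\<tau> n) (\<xi> n) s \<omega> - simple_process (m' n) (\<tau>' n) (\<xi>' n) s \<omega>" for s \<omega>
      using simple_integrandD(1)[OF si] simple_integrandD(1)[OF 1[of n]] simple_integrandD(1)[OF 2[of n]] diff
      by (simp add: simple_process_eq_sum)
    have grid: "\<And>k. k < l \<Longrightarrow> 0 \<le> p k \<and> p k \<le> p (Suc k)"
      using simple_integrandD(1)[OF si] simple_integrand_grid[OF si] by simp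
    have sub: "{\<omega>\<in>space M. \<delta> < simple_integral (\<lambda>t \<omega>. t) l p (\<lambda>k \<omega>. (\<zeta> k \<omega>)\<^sup>2) t \<omega>} \<subseteq> ?A n \<union> ?A' n"
    proof
      fix \<omega> assume "\<omega> \<in> {\<omega>\<in>space M. \<delta> < simple_integral (\<lambda>t \<omega>. t) l p (\<lambda>k \<omega>. (\<zeta> k \<omega>)\<^sup>2) t \<omega>}"
      then have \<omega>: "\<omega> \<in> space M" and "\<delta> < simple_integral (\<lambda>t \<omega>. t) l p (\<lambda>k \<omega>. (\<zeta> k \<omega>)\<^sup>2) t \<omega>" by auto
      then have "ennreal \<delta> < (\<integral>\<^sup>+s\<in>{0..t}. ennreal ((simple_process l p \<zeta> s \<omega>)\<^sup>2) \<partial>lborel)"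
        using simple_process_nn_integral_square[of l p t \<zeta> \<omega>, OF grid \<open>0 \<le> t\<close>] \<delta> by (simp add: ennreal_less_iff)
      also have "\<dots> \<le> (\<integral>\<^sup>+s\<in>{0..t}. (2 * ennreal ((simple_process (m n) (\<tau> n) (\<xi> n) s \<omega> - H s \<omega>)\<^sup>2) +
           2 * ennreal ((simple_process (m' n) (\<tau>' n) (\<xi>' n) s \<omega> - H s \<omega>)\<^sup>2)) \<partial>lborel)"
      proof (intro nn_integral_mono mult_right_mono)
        fix s
        have gen: "(a - b)\<^sup>2 \<le> 2 * (a - c)\<^sup>2 + 2 * (b - c)\<^sup>2" for a b c :: real
        proof -
          have "0 \<le> ((a - c) + (b - c))\<^sup>2" by simp
          then show ?thesis by (simp add: power2_eq_square algebra_simps)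
        qed
        have "ennreal ((simple_process l p \<zeta> s \<omega>)\<^sup>2) \<le> ennreal (2 * (simple_process (m n) (\<tau> n) (\<xi> n) s \<omega> - H s \<omega>)\<^sup>2 +
           2 * (simple_process (m' n) (\<tau>' n) (\<xi>' n) s \<omega> - H s \<omega>)\<^sup>2)"
          unfolding pd by (intro ennreal_leI gen)
        then show "ennreal ((simple_process l p \<zeta> s \<omega>)\<^sup>2) \<le> 2 * ennreal ((simple_process (m n) (\<tau> n) (\<xi> n) s \<omega> - H s \<omega>)\<^sup>2) +
           2 * ennreal ((simple_process (m' n) (\<tau>' n) (\<xi>' n) s \<omega> - H s \<omega>)\<^sup>2)"
          by (simp add: ennreal_plus ennreal_mult)
      qed simp
      also have "\<dots> = 2 * Q n \<omega> + 2 * Q' n \<omega>"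
      proof -
        have Hs: "(\<lambda>s. ennreal ((simple_process m \<tau> \<xi> s \<omega> - H s \<omega>)\<^sup>2) * indicator {0..t} s) \<in> borel_measurable lborel"
          for m \<tau> \<xi>
        proof -
          have "(\<lambda>s. (s, \<omega>)) \<in> restrict_space borel {0..t} \<rightarrow>\<^sub>M restrict_space borel {0..t} \<Otimes>\<^sub>M F t"
            using \<omega> space_F[OF \<open>0 \<le> t\<close>] by (intro measurable_Pair) (auto simp: measurable_ident)
          from measurable_compose[OF this H[unfolded progressively_measurable_def, rule_format, OF \<open>0 \<le> t\<close>]]
          have "(\<lambda>s. H s \<omega>) \<in> borel_measurable (restrict_space borel {0..t})" by simp
          moreover have "(\<lambda>s. simple_process m \<tau> \<xi> s \<omega>) \<in> borel_measurable (restrict_space borel {0..t})"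
            unfolding simple_process_def by (intro measurable_restrict_space1) measurable
          ultimately have "(\<lambda>s. ennreal ((simple_process m \<tau> \<xi> s \<omega> - H s \<omega>)\<^sup>2)) \<in> borel_measurable (restrict_space borel {0..t})"
            by measurable
          then show ?thesis by (subst (asm) borel_measurable_restrict_space_iff_ennreal) auto
        qed
        show ?thesis
          unfolding Q_def Q'_def distrib_right mult.assoc
          by (subst nn_integral_add)
             (use Hs in \<open>simp_all only: nn_integral_cmult borel_measurable_times_ennreal borel_measurable_const\<close>)
      qed
      finally have "ennreal \<delta> < 2 * Q n \<omega> + 2 * Q' n \<omega>" .
      moreover have "2 * Q n \<omega> + 2 * Q' n \<omega> \<le> ennreal \<delta>" if "Q n \<omega> \<le> ennreal (\<delta> / 4)" "Q' n \<omega> \<le> ennreal (\<delta> / 4)"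
      proof -
        have "2 * Q n \<omega> + 2 * Q' n \<omega> \<le> 2 * ennreal (\<delta> / 4) + 2 * ennreal (\<delta> / 4)"
          using that by (intro add_mono mult_left_mono) auto
        also have "2 * ennreal (\<delta> / 4) = ennreal (\<delta> / 2)"
          using ennreal_mult[of 2 "\<delta> / 4"] \<delta> by simp
        finally show ?thesis using ennreal_plus[of "\<delta> / 2" "\<delta> / 2"] \<delta> by simp
      qed
      ultimately show "\<omega> \<in> ?A n \<union> ?A' n" using \<omega> by (auto simp: not_less) (meson not_le)
    qed
    have "prob {\<omega>\<in>space M. \<epsilon> < \<bar>simple_integral B l p \<zeta> t \<omega>\<bar>} \<le>
       prob {\<omega>\<in>space M. \<delta> < simple_integral (\<lambda>t \<omega>. t) l p (\<lambda>k \<omega>. (\<zeta> k \<omega>)\<^sup>2) t \<omega>} + \<delta> / \<epsilon>\<^sup>2"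
      using simple_integral_prob_le[OF si \<open>0 \<le> t\<close> _ \<open>0 < \<epsilon>\<close>] \<delta> by simp
    also have "\<dots> \<le> prob (?A n \<union> ?A' n) + \<delta> / \<epsilon>\<^sup>2"
      using sub by (intro add_right_mono finite_measure_mono) measurable
    also have "\<dots> \<le> prob (?A n) + prob (?A' n) + \<delta> / \<epsilon>\<^sup>2"
      by (intro add_right_mono measure_Un_le) measurable
    also have "\<delta> / \<epsilon>\<^sup>2 = e / 3" using \<open>0 < \<epsilon>\<close> by (simp add: \<delta>_def)
    finally show ?thesis by (simp only: simple_integral_eq_sum diff)
  qed
  note le = this
  have "norm (prob {\<omega>\<in>space M. \<epsilon> < \<bar>simple_integral B (m n) (\<tau> n) (\<xi> n) t \<omega> -
     simple_integral B (m' n) (\<tau>' n) (\<xi>' n) t \<omega> - 0\<bar>} - 0) < e" if "max N N' \<le> n" for n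
  proof -
    have "prob (?A n) + prob (?A' n) + e / 3 < e"
      using N[of n] that by auto
    then show ?thesis using le[of n] by (simp add: measure_nonneg)
  qed
  then show "\<exists>no. \<forall>n\<ge>no. norm (prob {\<omega>\<in>space M. \<epsilon> < \<bar>simple_integral B (m n) (\<tau> n) (\<xi> n) t \<omega> -
     simple_integral B (m' n) (\<tau>' n) (\<xi>' n) t \<omega> - 0\<bar>} - 0) < e" by blast
qed

end

section \<open>Dyadic Riemann sums\<close>

definition dyadic :: "nat \<Rightarrow> nat \<Rightarrow> real" where
  "dyadic n k = real k / 2 ^ n"

text \<open>The grid point \<open>dyadic n (left_index n s)\<close> is the largest one strictly below \<open>s > 0\<close>.\<close>

definition left_index :: "nat \<Rightarrow> real \<Rightarrow> nat" where
  "left_index n s = nat (\<lceil>s * 2 ^ n\<rceil> - 1)"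

lemma dyadic_nonneg [simp]: "0 \<le> dyadic n k"
  by (simp add: dyadic_def)

lemma dyadic_0 [simp]: "dyadic n 0 = 0"
  by (simp add: dyadic_def)

lemma dyadic_le_iff [simp]: "dyadic n j \<le> dyadic n k \<longleftrightarrow> j \<le> k"
  by (simp add: dyadic_def divide_le_cancel)

lemma dyadic_less_iff [simp]: "dyadic n j < dyadic n k \<longleftrightarrow> j < k"
  by (simp add: dyadic_def divide_less_cancel)

lemma dyadic_Suc: "dyadic n (Suc k) = dyadic n k + 1 / 2 ^ n"
  by (simp add: dyadic_def add_divide_distrib)

lemma dyadic_mult_power [simp]: "dyadic n (T * 2 ^ n) = real T"
  by (simp add: dyadic_def)

lemma left_index:
  assumes "0 < s"
  shows "dyadic n (left_index n s) < s" "s \<le> dyadic n (Suc (left_index n s))"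
proof -
  let ?c = "\<lceil>s * 2 ^ n\<rceil>"
  have "0 < s * 2 ^ n" using assms by simp
  then have "0 < ?c" by simp
  then have r: "real (left_index n s) = of_int ?c - 1" unfolding left_index_def by simp
  have "of_int ?c - 1 < s * 2 ^ n" "s * 2 ^ n \<le> of_int ?c" using ceiling_correct[of "s * 2 ^ n"] by auto
  then show "dyadic n (left_index n s) < s" "s \<le> dyadic n (Suc (left_index n s))"
    using r by (simp_all add: dyadic_def field_simps)
qed

lemma left_index_less:
  assumes "0 < s" "s \<le> real n"
  shows "left_index n s < n * 2 ^ n"
proof -
  have "dyadic n (left_index n s) < dyadic n (n * 2 ^ n)"
    using left_index(1)[OF assms(1), of n] assms(2) by simp
  then show ?thesis by (simp only: dyadic_less_iff)
qed

lemma half_power_tendsto_0: "(\<lambda>n. 1 / 2 ^ n :: real) \<longlonglongrightarrow> 0"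
  using LIMSEQ_power_zero[of "1 / 2 :: real"] by (simp add: power_one_over)

lemma left_index_tendsto:
  assumes "0 < s"
  shows "(\<lambda>n. dyadic n (left_index n s)) \<longlonglongrightarrow> s"
proof (rule tendsto_sandwich)
  have "s - 1 / 2 ^ n \<le> dyadic n (left_index n s)" "dyadic n (left_index n s) \<le> s" for n
    using left_index[OF assms, of n] unfolding dyadic_Suc by linarith+
  then show "\<forall>\<^sub>F n in sequentially. s - 1 / 2 ^ n \<le> dyadic n (left_index n s)"
    "\<forall>\<^sub>F n in sequentially. dyadic n (left_index n s) \<le> s"
    by (auto intro: always_eventually)
  show "(\<lambda>n. s - 1 / 2 ^ n) \<longlonglongrightarrow> s"
    using tendsto_diff[OF tendsto_const half_power_tendsto_0, of s] by simp
qed simp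

lemma continuous_left_index_tendsto:
  fixes h :: "real \<Rightarrow> 'b::topological_space"
  assumes "continuous_on {0..} h" "0 < s"
  shows "(\<lambda>n. h (dyadic n (left_index n s))) \<longlonglongrightarrow> h s"
  using assms left_index_tendsto[OF assms(2)] by (auto simp: continuous_on_sequentially comp_def)

text \<open>Level \<open>n\<close> has \<open>n * 2 ^ n\<close> cells and covers the times up to
  \<open>n\<close>. In \<open>is_ito_integral\<close> one approximating sequence must serve every
  horizon \<open>T\<close>, so the covered interval has to grow with the level.\<close>

lemma dyadic_step_process:
  assumes "0 < s" "s \<le> real n"
  shows "simple_process (n * 2 ^ n) (dyadic n) \<xi> s \<omega> = \<xi> (left_index n s) \<omega>"
  using left_index[OF assms(1)] left_index_less[OF assms] by (intro simple_process_value) auto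

lemma is_ito_integralD:
  assumes "is_ito_integral M F B H J"
  shows "progressively_measurable F H" "0 \<le> t \<Longrightarrow> J t \<in> borel_measurable (F t)"
  using assms by (simp_all add: is_ito_integral_def)

lemma abs_simple_process_le:
  assumes "\<And>k. k < m \<Longrightarrow> \<tau> k \<le> \<tau> (Suc k)" "\<And>k. \<bar>\<xi> k \<omega>\<bar> \<le> C"
  shows "\<bar>simple_process m \<tau> \<xi> s \<omega>\<bar> \<le> C"
proof (cases "\<exists>k<m. s \<in> {\<tau> k<..\<tau> (Suc k)}")
  case True
  then obtain k where "k < m" "\<tau> k < s" "s \<le> \<tau> (Suc k)" by auto
  then have "simple_process m \<tau> \<xi> s \<omega> = \<xi> k \<omega>"
    using assms(1) by (intro simple_process_value) auto
  then show ?thesis using assms(2) by simp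
next
  case False
  then have "simple_process m \<tau> \<xi> s \<omega> = 0"
    unfolding simple_process_def by (intro sum.neutral) auto
  then show ?thesis using assms(2)[of 0] by linarith
qed

text \<open>Dominated convergence with a constant bound on \<open>{0..t}\<close>. The coefficients
  enter only through their value in the cell that ends at or after \<open>s\<close>, so the lemma
  applies both to samples of a continuous path and to the nodes of the Euler scheme.\<close>

lemma dyadic_step_integrals:
  fixes h :: "real \<Rightarrow> real"
  assumes "0 \<le> t" and cont: "continuous_on {0..} h"
    and C: "\<And>n k. \<bar>\<xi> n k \<omega>\<bar> \<le> C" "\<And>s. 0 \<le> s \<Longrightarrow> \<bar>h s\<bar> \<le> C"
    and lim: "\<And>s. 0 < s \<Longrightarrow> (\<lambda>n. \<xi> n (left_index n s) \<omega>) \<longlonglongrightarrow> h s"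
  shows "(\<lambda>n. simple_integral (\<lambda>t \<omega>. t) (n * 2 ^ n) (dyadic n) (\<xi> n) t \<omega>) \<longlonglongrightarrow> (LINT s:{0..t}|lborel. h s)"
    and "(\<lambda>n. \<integral>\<^sup>+s\<in>{0..t}. ennreal ((simple_process (n * 2 ^ n) (dyadic n) (\<xi> n) s \<omega> - h s)\<^sup>2) \<partial>lborel) \<longlonglongrightarrow> 0"
proof -
  let ?\<phi> = "\<lambda>n s. simple_process (n * 2 ^ n) (dyadic n) (\<xi> n) s \<omega>"
  have \<phi>lim: "(\<lambda>n. ?\<phi> n s) \<longlonglongrightarrow> h s" if "0 < s" for s
  proof (rule tendsto_cong[THEN iffD1, OF _ lim[OF that]])
    show "\<forall>\<^sub>F n in sequentially. \<xi> n (left_index n s) \<omega> = ?\<phi> n s"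
      using eventually_ge_at_top[of "nat \<lceil>s\<rceil>"]
    proof eventually_elim
      case (elim n)
      then have "s \<le> real n" by linarith
      then show ?case by (rule dyadic_step_process[OF that, symmetric])
    qed
  qed
  have \<phi>le: "\<bar>?\<phi> n s\<bar> \<le> C" for n s
    using C(1) by (intro abs_simple_process_le) auto
  have C0: "0 \<le> C" using C(2)[of 0] by linarith
  have hm[measurable]: "(\<lambda>s. indicator {0..t} s * h s) \<in> borel_measurable borel"
    using borel_measurable_continuous_on_indicator[of "{0..t}" h] cont continuous_on_subset[of "{0..}" h "{0..t}"]
    by auto
  have \<phi>m[measurable]: "?\<phi> n \<in> borel_measurable borel" for n
    unfolding simple_process_def by measurable
  \<comment> \<open>Cells are open on the left, so the step processes vanish at time 0 and
    convergence may fail there.\<close>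
  have pos: "AE s in lborel. s \<noteq> (0::real)" by (rule AE_lborel_singleton)
  have "(\<lambda>n. \<integral>s. indicator {0..t} s * ?\<phi> n s \<partial>lborel) \<longlonglongrightarrow> (\<integral>s. indicator {0..t} s * h s \<partial>lborel)"
  proof (rule integral_dominated_convergence[where w = "\<lambda>s. indicator {0..t} s * C"])
    show "integrable lborel (\<lambda>s. indicator {0..t} s * C)"
      by (intro integrable_mult_left integrable_real_indicator) (simp_all add: emeasure_lborel_Icc_eq)
    show "AE s in lborel. (\<lambda>n. indicator {0..t} s * ?\<phi> n s) \<longlonglongrightarrow> indicator {0..t} s * h s"
      using pos
    proof eventually_elim
      case (elim s)
      show ?case
      proof (cases "s \<in> {0..t}")
        case True
        then show ?thesis using elim \<phi>lim[of s] by simp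
      qed simp
    qed
    show "AE s in lborel. norm (indicator {0..t} s * ?\<phi> n s) \<le> indicator {0..t} s * C" for n
      using \<phi>le by (auto simp: indicator_def)
  qed measurable
  moreover have "(\<integral>s. indicator {0..t} s * ?\<phi> n s \<partial>lborel) =
      simple_integral (\<lambda>t \<omega>. t) (n * 2 ^ n) (dyadic n) (\<xi> n) t \<omega>" for n
    using \<open>0 \<le> t\<close> by (intro has_bochner_integral_integral_eq simple_process_lebesgue_integral) auto
  ultimately show "(\<lambda>n. simple_integral (\<lambda>t \<omega>. t) (n * 2 ^ n) (dyadic n) (\<xi> n) t \<omega>) \<longlonglongrightarrow> (LINT s:{0..t}|lborel. h s)"
    by (simp add: set_lebesgue_integral_def)
  have "(\<lambda>n. \<integral>\<^sup>+s. ennreal ((indicator {0..t} s * ?\<phi> n s - indicator {0..t} s * h s)\<^sup>2) \<partial>lborel) \<longlonglongrightarrow> (\<integral>\<^sup>+(s::real). 0 \<partial>lborel)"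
  proof (rule nn_integral_dominated_convergence[where w = "\<lambda>s. ennreal ((2 * C)\<^sup>2) * indicator {0..t} s"])
    show "AE s in lborel. ennreal ((indicator {0..t} s * ?\<phi> n s - indicator {0..t} s * h s)\<^sup>2) \<le> ennreal ((2 * C)\<^sup>2) * indicator {0..t} s" for n
    proof (rule AE_I2)
      fix s
      show "ennreal ((indicator {0..t} s * ?\<phi> n s - indicator {0..t} s * h s)\<^sup>2) \<le> ennreal ((2 * C)\<^sup>2) * indicator {0..t} s"
      proof (cases "s \<in> {0..t}")
        case True
        then have "\<bar>?\<phi> n s - h s\<bar> \<le> \<bar>2 * C\<bar>" using \<phi>le[of n s] C(2)[of s] by auto
        then have "(?\<phi> n s - h s)\<^sup>2 \<le> (2 * C)\<^sup>2" by (simp only: abs_le_square_iff)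
        then show ?thesis using True by (simp add: ennreal_leI)
      qed simp
    qed
    show "(\<integral>\<^sup>+s. ennreal ((2 * C)\<^sup>2) * indicator {0..t} s \<partial>lborel) < \<infinity>"
    proof (subst nn_integral_cmult_indicator)
      have "emeasure lborel {0..t} < \<infinity>" by (rule order_le_less_trans[OF eq_refl[OF emeasure_lborel_Icc[OF \<open>0 \<le> t\<close>]]]) simp
      then show "ennreal ((2 * C)\<^sup>2) * emeasure lborel {0..t} < \<infinity>"
        by (simp add: ennreal_mult_less_top)
    qed simp
    show "AE s in lborel. (\<lambda>n. ennreal ((indicator {0..t} s * ?\<phi> n s - indicator {0..t} s * h s)\<^sup>2)) \<longlonglongrightarrow> 0"
      using pos
    proof eventually_elim
      case (elim s)
      show ?case
      proof (cases "s \<in> {0..t}")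
        case True
        have "(\<lambda>n. ?\<phi> n s - h s) \<longlonglongrightarrow> h s - h s"
          using True elim by (intro tendsto_intros \<phi>lim) auto
        from tendsto_power[OF this, of 2]
        have "(\<lambda>n. ennreal ((?\<phi> n s - h s)\<^sup>2)) \<longlonglongrightarrow> ennreal 0" by (intro tendsto_ennrealI) simp
        then show ?thesis using True by simp
      qed simp
    qed
  qed measurable
  moreover have "(\<integral>\<^sup>+s. ennreal ((indicator {0..t} s * ?\<phi> n s - indicator {0..t} s * h s)\<^sup>2) \<partial>lborel) =
     (\<integral>\<^sup>+s\<in>{0..t}. ennreal ((?\<phi> n s - h s)\<^sup>2) \<partial>lborel)" for n
    by (intro nn_integral_cong) (auto simp: indicator_def)
  ultimately show "(\<lambda>n. \<integral>\<^sup>+s\<in>{0..t}. ennreal ((?\<phi> n s - h s)\<^sup>2) \<partial>lborel) \<longlonglongrightarrow> 0"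
    by simp
qed

context scalar_bm
begin

lemma prob_distance_tendsto_0:
  assumes "progressively_measurable F H" "\<And>n. simple_integrand M F (m n) (\<tau> n) (\<xi> n)" "0 \<le> T" "0 < \<epsilon>"
    and lim: "AE \<omega> in M. (\<lambda>n. \<integral>\<^sup>+s\<in>{0..T}. ennreal ((simple_process (m n) (\<tau> n) (\<xi> n) s \<omega> - H s \<omega>)\<^sup>2) \<partial>lborel) \<longlonglongrightarrow> 0"
  shows "(\<lambda>n. prob {\<omega>\<in>space M. ennreal \<epsilon> <
       (\<integral>\<^sup>+s\<in>{0..T}. ennreal ((simple_process (m n) (\<tau> n) (\<xi> n) s \<omega> - H s \<omega>)\<^sup>2) \<partial>lborel)}) \<longlonglongrightarrow> 0"
proof (rule prob_tendsto_0_AE)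
  have [measurable]: "(\<lambda>\<omega>. \<integral>\<^sup>+s\<in>{0..T}. ennreal ((simple_process (m n) (\<tau> n) (\<xi> n) s \<omega> - H s \<omega>)\<^sup>2) \<partial>lborel) \<in> borel_measurable M" for n
    by (rule distance_measurable[OF assms(1,2,3)])
  show "{\<omega>\<in>space M. ennreal \<epsilon> < (\<integral>\<^sup>+s\<in>{0..T}. ennreal ((simple_process (m n) (\<tau> n) (\<xi> n) s \<omega> - H s \<omega>)\<^sup>2) \<partial>lborel)} \<in> events" for n
    by measurable
  show "AE \<omega> in M. \<forall>\<^sub>F n in sequentially. \<omega> \<notin> {\<omega>\<in>space M. ennreal \<epsilon> < (\<integral>\<^sup>+s\<in>{0..T}. ennreal ((simple_process (m n) (\<tau> n) (\<xi> n) s \<omega> - H s \<omega>)\<^sup>2) \<partial>lborel)}"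
    using lim
  proof eventually_elim
    case (elim \<omega>)
    from order_tendstoD(2)[OF elim, of "ennreal \<epsilon>"] \<open>0 < \<epsilon>\<close> show ?case
      by (auto elim!: eventually_mono)
  qed
qed

lemma dyadic_simple_integrand:
  assumes "\<And>k. k < m \<Longrightarrow> \<xi> k \<in> borel_measurable (F (dyadic n k))" "\<And>k \<omega>. \<omega> \<in> space M \<Longrightarrow> \<bar>\<xi> k \<omega>\<bar> \<le> C"
  shows "simple_integrand M F m (dyadic n) \<xi>"
  using assms unfolding simple_integrand_def by auto

text \<open>The definition only provides some unknown approximating sequence. The dyadic samples
  converge to the same integrand, so by uniqueness of the limit their integrals may be used
  instead.\<close>

lemma ito_integral_riemann_sums:
  assumes ito: "is_ito_integral M F B H J"
    and cont: "\<And>\<omega>. \<omega> \<in> space M \<Longrightarrow> continuous_on {0..} (\<lambda>t. H t \<omega>)"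
    and bdd: "\<And>t \<omega>. 0 \<le> t \<Longrightarrow> \<omega> \<in> space M \<Longrightarrow> \<bar>H t \<omega>\<bar> \<le> C"
    and meas: "\<And>t. 0 \<le> t \<Longrightarrow> H t \<in> borel_measurable (F t)" and "0 \<le> t"
  shows "tends_in_prob M (\<lambda>n. simple_integral B (n * 2 ^ n) (dyadic n) (\<lambda>k. H (dyadic n k)) t) (J t)"
proof -
  let ?R = "\<lambda>n. simple_integral B (n * 2 ^ n) (dyadic n) (\<lambda>k. H (dyadic n k)) t"
  note pm = is_ito_integralD(1)[OF ito]
  have Jm: "J t \<in> borel_measurable M" by (rule measurable_F_M[OF is_ito_integralD(2)[OF ito \<open>0 \<le> t\<close>] \<open>0 \<le> t\<close>])
  have "\<exists>m \<tau> \<xi>. (\<forall>n. simple_integrand M F (m n) (\<tau> n) (\<xi> n)) \<and>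
     (\<forall>T\<ge>0. \<forall>\<epsilon>>0. (\<lambda>n. measure M {\<omega>\<in>space M. ennreal \<epsilon> <
        (\<integral>\<^sup>+s\<in>{0..T}. ennreal ((simple_process (m n) (\<tau> n) (\<xi> n) s \<omega> - H s \<omega>)\<^sup>2) \<partial>lborel)}) \<longlonglongrightarrow> 0) \<and>
     (\<forall>t\<ge>0. \<forall>\<epsilon>>0. (\<lambda>n. measure M {\<omega>\<in>space M. \<epsilon> < \<bar>simple_integral B (m n) (\<tau> n) (\<xi> n) t \<omega> - J t \<omega>\<bar>}) \<longlonglongrightarrow> 0)"
    using ito unfolding is_ito_integral_def by (elim conjE) assumption
  then obtain m \<tau> \<xi> where si: "\<And>n. simple_integrand M F (m n) (\<tau> n) (\<xi> n)"
    and lim: "\<And>\<epsilon>. 0 < \<epsilon> \<Longrightarrow> (\<lambda>n. prob {\<omega>\<in>space M. ennreal \<epsilon> <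
        (\<integral>\<^sup>+s\<in>{0..t}. ennreal ((simple_process (m n) (\<tau> n) (\<xi> n) s \<omega> - H s \<omega>)\<^sup>2) \<partial>lborel)}) \<longlonglongrightarrow> 0"
    and Jlim: "tends_in_prob M (\<lambda>n. simple_integral B (m n) (\<tau> n) (\<xi> n) t) (J t)"
    using \<open>0 \<le> t\<close> unfolding tends_in_prob_def by (elim exE conjE) blast
  have si': "simple_integrand M F (n * 2 ^ n) (dyadic n) (\<lambda>k. H (dyadic n k))" for n
    using meas bdd by (intro dyadic_simple_integrand[where C = C]) auto
  have "AE \<omega> in M. (\<lambda>n. \<integral>\<^sup>+s\<in>{0..t}. ennreal ((simple_process (n * 2 ^ n) (dyadic n) (\<lambda>k. H (dyadic n k)) s \<omega> - H s \<omega>)\<^sup>2) \<partial>lborel) \<longlonglongrightarrow> 0"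
    using cont bdd \<open>0 \<le> t\<close>
    by (intro AE_I2 dyadic_step_integrals(2)[where C = C and \<xi> = "\<lambda>n k. H (dyadic n k)"] continuous_left_index_tendsto) auto
  then have lim': "(\<lambda>n. prob {\<omega>\<in>space M. ennreal \<epsilon> <
        (\<integral>\<^sup>+s\<in>{0..t}. ennreal ((simple_process (n * 2 ^ n) (dyadic n) (\<lambda>k. H (dyadic n k)) s \<omega> - H s \<omega>)\<^sup>2) \<partial>lborel)}) \<longlonglongrightarrow> 0"
    if "0 < \<epsilon>" for \<epsilon>
    using that by (intro prob_distance_tendsto_0[OF pm si' \<open>0 \<le> t\<close>])
  note diff = simple_integral_limit_unique[OF pm si' si \<open>0 \<le> t\<close> lim' lim]
  have "tends_in_prob M (\<lambda>n \<omega>. (?R n \<omega> - simple_integral B (m n) (\<tau> n) (\<xi> n) t \<omega>) +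
      simple_integral B (m n) (\<tau> n) (\<xi> n) t \<omega>) (\<lambda>\<omega>. 0 + J t \<omega>)"
    by (intro tends_in_prob_add diff Jlim Jm borel_measurable_diff simple_integral_measurable si si' \<open>0 \<le> t\<close>) auto
  then show ?thesis by simp
qed

end

section \<open>Pathwise uniqueness\<close>

text \<open>Cauchy-Schwarz, with each weight split into two square roots.\<close>

lemma sum_weighted_square_le:
  fixes \<beta> d :: "'i \<Rightarrow> real"
  assumes "\<And>k. k \<in> A \<Longrightarrow> 0 \<le> d k"
  shows "(\<Sum>k\<in>A. \<beta> k * d k)\<^sup>2 \<le> (\<Sum>k\<in>A. d k) * (\<Sum>k\<in>A. (\<beta> k)\<^sup>2 * d k)"
proof -
  have "(\<Sum>k\<in>A. \<beta> k * d k) = (\<Sum>k\<in>A. sqrt (d k) * (\<beta> k * sqrt (d k)))"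
    using assms by (intro sum.cong) (auto simp: mult_ac)
  moreover have "(\<Sum>k\<in>A. d k) = (\<Sum>k\<in>A. (sqrt (d k))\<^sup>2)"
    using assms by (intro sum.cong) auto
  moreover have "(\<Sum>k\<in>A. (\<beta> k)\<^sup>2 * d k) = (\<Sum>k\<in>A. (\<beta> k * sqrt (d k))\<^sup>2)"
    using assms by (intro sum.cong) (auto simp: power_mult_distrib)
  ultimately show ?thesis using Cauchy_Schwarz_ineq_sum by metis
qed

text \<open>A left Riemann sum of an increasing function lies below the integral. Here
  \<open>1 + x \<le> exp x\<close> reduces this to a telescoping sum, and the factor
  \<open>1 / \<kappa>\<close> is what makes the uniqueness iteration contract.\<close>

lemma sum_exp_increment_le:
  fixes p :: "nat \<Rightarrow> real"
  assumes "0 < \<kappa>"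
  shows "(\<Sum>k<m. exp (\<kappa> * p k) * (p (Suc k) - p k)) \<le> exp (\<kappa> * p m) / \<kappa>"
proof -
  have "exp (\<kappa> * p k) * (p (Suc k) - p k) \<le> exp (\<kappa> * p (Suc k)) / \<kappa> - exp (\<kappa> * p k) / \<kappa>" for k
  proof -
    have "exp (\<kappa> * p k) * (1 + \<kappa> * (p (Suc k) - p k)) \<le> exp (\<kappa> * p k) * exp (\<kappa> * (p (Suc k) - p k))"
      by (intro mult_left_mono exp_ge_add_one_self) auto
    also have "\<dots> = exp (\<kappa> * p (Suc k))" by (simp add: exp_add[symmetric] algebra_simps)
    finally show ?thesis using assms by (simp add: field_simps)
  qed
  then have "(\<Sum>k<m. exp (\<kappa> * p k) * (p (Suc k) - p k)) \<le> (\<Sum>k<m. exp (\<kappa> * p (Suc k)) / \<kappa> - exp (\<kappa> * p k) / \<kappa>)"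
    by (intro sum_mono)
  also have "\<dots> = exp (\<kappa> * p m) / \<kappa> - exp (\<kappa> * p 0) / \<kappa>"
    by (rule sum_lessThan_telescope)
  also have "\<dots> \<le> exp (\<kappa> * p m) / \<kappa>" using assms by simp
  finally show ?thesis .
qed

lemma power2_norm_vec: "(norm x)\<^sup>2 = (\<Sum>i\<in>UNIV. (x $ i)\<^sup>2)" for x :: "real ^ 'd"
  by (simp only: power2_norm_eq_inner inner_vec_def) (simp add: power2_eq_square)

text \<open>Nothing is known about \<open>\<phi>\<close> outside \<open>S\<close>; multiplying by
  the indicator of the closed set \<open>S\<close> gives a Borel function that agrees with it along
  \<open>X\<close>.\<close>

lemma measurable_continuous_on_compose:
  fixes \<phi> :: "'a::topological_space \<Rightarrow> real"
  assumes "closed S" "continuous_on S \<phi>" "X \<in> borel_measurable N" "\<And>\<omega>. \<omega> \<in> space N \<Longrightarrow> X \<omega> \<in> S"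
  shows "(\<lambda>\<omega>. \<phi> (X \<omega>)) \<in> borel_measurable N"
proof -
  have "(\<lambda>x. indicator S x *\<^sub>R \<phi> x) \<in> borel_measurable borel"
    using assms(1,2) by (intro borel_measurable_continuous_on_indicator) auto
  from measurable_compose[OF assms(3) this]
  have "(\<lambda>\<omega>. indicator S (X \<omega>) *\<^sub>R \<phi> (X \<omega>)) \<in> borel_measurable N" .
  also have "(\<lambda>\<omega>. indicator S (X \<omega>) *\<^sub>R \<phi> (X \<omega>)) \<in> borel_measurable N \<longleftrightarrow> ?thesis"
    using assms(4) by (intro measurable_cong) auto
  finally show ?thesis .
qed

context scalar_bm
begin

lemma simple_integral_isometry:
  assumes si: "simple_integrand M F m \<tau> \<xi>" and "0 \<le> t"
  shows "integrable M (\<lambda>\<omega>. (simple_integral B m \<tau> \<xi> t \<omega>)\<^sup>2)"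
    and "expectation (\<lambda>\<omega>. (simple_integral B m \<tau> \<xi> t \<omega>)\<^sup>2) =
      (\<Sum>k<m. expectation (\<lambda>\<omega>. (\<xi> k \<omega>)\<^sup>2) * (min t (\<tau> (Suc k)) - min t (\<tau> k)))"
proof -
  define p where "p k = min t (\<tau> k)" for k
  \<comment> \<open>Cells that start at or after \<open>t\<close> become empty by clipping, and
    their coefficients are set to 0 because they may be unknown at time \<open>t\<close>.\<close>
  define \<eta> where "\<eta> k = (if \<tau> k < t then \<xi> k else (\<lambda>_. 0))" for k
  have p: "0 \<le> p k" "p k \<le> p (Suc k)" if "k < m" for k
    using simple_integrand_grid[OF si, of k] simple_integrandD(1)[OF si that] \<open>0 \<le> t\<close> that
    by (auto simp: p_def)
  have pt: "p (Suc k) = p k" if "k < m" "\<not> \<tau> k < t" for k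
    using simple_integrandD(1)[OF si that(1)] that(2) by (simp add: p_def)
  have meas: "\<eta> k \<in> borel_measurable (F (p k))" if "k < m" for k
  proof (cases "\<tau> k < t")
    case True
    then have "p k = \<tau> k" by (simp add: p_def)
    with True simple_integrandD(2)[OF si that] show ?thesis by (simp only: \<eta>_def if_True)
  qed (simp add: \<eta>_def)
  have \<eta>M: "\<eta> k \<in> borel_measurable M" if "k < m" for k
    using measurable_F_M[OF meas[OF that]] p[OF that] by simp
  have int: "integrable M (\<lambda>\<omega>. (\<eta> k \<omega>)\<^sup>2)" if km: "k < m" for k
  proof -
    obtain C where C: "\<forall>\<omega>\<in>space M. \<bar>\<xi> k \<omega>\<bar> \<le> C" using simple_integrandD(3)[OF si km] by blast
    show ?thesis
    proof (rule integrable_const_bound[where B = "C\<^sup>2"])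
      show "AE \<omega> in M. norm ((\<eta> k \<omega>)\<^sup>2) \<le> C\<^sup>2"
      proof (rule AE_I2)
        fix \<omega> assume "\<omega> \<in> space M"
        then have "\<bar>\<xi> k \<omega>\<bar> \<le> C" using C by blast
        then have "\<bar>\<eta> k \<omega>\<bar> \<le> \<bar>C\<bar>" by (auto simp: \<eta>_def)
        then show "norm ((\<eta> k \<omega>)\<^sup>2) \<le> C\<^sup>2" by (simp add: abs_le_square_iff)
      qed
    qed (use \<eta>M[OF km] in measurable)
  qed
  have eq: "simple_integral B m \<tau> \<xi> t \<omega> = (\<Sum>k<m. \<eta> k \<omega> * (B (p (Suc k)) \<omega> - B (p k) \<omega>))" for \<omega>
    unfolding simple_integral_def p_def[symmetric]
  proof (rule sum.cong)
    fix k assume "k \<in> {..<m}"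
    then show "\<xi> k \<omega> * (B (p (Suc k)) \<omega> - B (p k) \<omega>) = \<eta> k \<omega> * (B (p (Suc k)) \<omega> - B (p k) \<omega>)"
      using pt[of k] by (cases "\<tau> k < t") (auto simp: \<eta>_def)
  qed simp
  show "integrable M (\<lambda>\<omega>. (simple_integral B m \<tau> \<xi> t \<omega>)\<^sup>2)"
    unfolding eq using p meas int by (intro ito_isometry_sum(1)) auto
  have "expectation (\<lambda>\<omega>. (simple_integral B m \<tau> \<xi> t \<omega>)\<^sup>2) = (\<Sum>k<m. expectation (\<lambda>\<omega>. (\<eta> k \<omega>)\<^sup>2) * (p (Suc k) - p k))"
    unfolding eq using p meas int by (intro ito_isometry_sum(2)) auto
  also have "\<dots> = (\<Sum>k<m. expectation (\<lambda>\<omega>. (\<xi> k \<omega>)\<^sup>2) * (p (Suc k) - p k))"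
  proof (rule sum.cong)
    fix k assume "k \<in> {..<m}"
    then show "expectation (\<lambda>\<omega>. (\<eta> k \<omega>)\<^sup>2) * (p (Suc k) - p k) = expectation (\<lambda>\<omega>. (\<xi> k \<omega>)\<^sup>2) * (p (Suc k) - p k)"
      using pt[of k] by (cases "\<tau> k < t") (auto simp: \<eta>_def)
  qed simp
  finally show "expectation (\<lambda>\<omega>. (simple_integral B m \<tau> \<xi> t \<omega>)\<^sup>2) =
      (\<Sum>k<m. expectation (\<lambda>\<omega>. (\<xi> k \<omega>)\<^sup>2) * (min t (\<tau> (Suc k)) - min t (\<tau> k)))"
    by (simp add: p_def)
qed

end

lemma sde_solutionD:
  assumes "sde_solution M F W S b \<sigma> x\<^sub>0 X"
  shows "0 \<le> t \<Longrightarrow> X t \<in> borel_measurable (F t)"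
    "\<omega> \<in> space M \<Longrightarrow> continuous_on {0..} (\<lambda>t. X t \<omega>)"
    "\<omega> \<in> space M \<Longrightarrow> 0 \<le> t \<Longrightarrow> X t \<omega> \<in> S"
    "\<exists>J. is_ito_integral M F (\<lambda>t \<omega>. W t \<omega> $ i) (\<lambda>t \<omega>. \<sigma> (X t \<omega>) $ i) J \<and>
        (AE \<omega> in M. \<forall>t\<ge>0. X t \<omega> $ i = x\<^sub>0 $ i + (LINT s:{0..t}|lborel. b (X s \<omega>) $ i) + J t \<omega>)"
proof -
  note D = assms[unfolded sde_solution_def]
  show "0 \<le> t \<Longrightarrow> X t \<in> borel_measurable (F t)"
    "\<omega> \<in> space M \<Longrightarrow> continuous_on {0..} (\<lambda>t. X t \<omega>)"
    "\<omega> \<in> space M \<Longrightarrow> 0 \<le> t \<Longrightarrow> X t \<omega> \<in> S" using D by blast+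
  from D obtain J where J: "is_ito_integral M F (\<lambda>t \<omega>. W t \<omega> $ i) (\<lambda>t \<omega>. \<sigma> (X t \<omega>) $ i) J"
    "AE \<omega> in M. \<forall>t\<ge>0. set_integrable lborel {0..t} (\<lambda>s. b (X s \<omega>) $ i) \<and>
           X t \<omega> $ i = x\<^sub>0 $ i + (LINT s:{0..t}|lborel. b (X s \<omega>) $ i) + J t \<omega>"
    by blast
  from J(2) have "AE \<omega> in M. \<forall>t\<ge>0. X t \<omega> $ i = x\<^sub>0 $ i + (LINT s:{0..t}|lborel. b (X s \<omega>) $ i) + J t \<omega>"
    by eventually_elim blast
  with J(1) show "\<exists>J. is_ito_integral M F (\<lambda>t \<omega>. W t \<omega> $ i) (\<lambda>t \<omega>. \<sigma> (X t \<omega>) $ i) J \<and>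
        (AE \<omega> in M. \<forall>t\<ge>0. X t \<omega> $ i = x\<^sub>0 $ i + (LINT s:{0..t}|lborel. b (X s \<omega>) $ i) + J t \<omega>)"
    by blast
qed

lemma coefficient_path:
  fixes X :: "real \<Rightarrow> 'w \<Rightarrow> real ^ 'd" and \<phi> :: "real ^ 'd \<Rightarrow> real"
  assumes "sde_solution M F W S b \<sigma> x\<^sub>0 X" "scalar_bm M F B" "closed S" "continuous_on S \<phi>"
  shows "0 \<le> t \<Longrightarrow> (\<lambda>\<omega>. \<phi> (X t \<omega>)) \<in> borel_measurable (F t)"
    "\<omega> \<in> space M \<Longrightarrow> continuous_on {0..} (\<lambda>t. \<phi> (X t \<omega>))"
proof -
  interpret scalar_bm M F B by fact
  note D = sde_solutionD[OF assms(1)]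
  show "(\<lambda>\<omega>. \<phi> (X t \<omega>)) \<in> borel_measurable (F t)" if "0 \<le> t"
    by (rule measurable_continuous_on_compose[OF assms(3,4) D(1)[OF that]])
       (use D(3) space_F that in auto)
  show "continuous_on {0..} (\<lambda>t. \<phi> (X t \<omega>))" if "\<omega> \<in> space M"
    by (rule continuous_on_compose2[OF assms(4) D(2)[OF that]]) (use D(3) that in auto)
qed

text \<open>One Picard step in the norm given by the supremum of \<open>exp (- \<kappa> * s)\<close>
  times the second moment of the difference at time \<open>s\<close>: a bound \<open>c\<close>
  improves by a factor of order \<open>1 / \<kappa>\<close>. The estimate is made for Riemann sums
  of both integrals and transferred to the solutions by
  \<open>second_moment_le_in_prob\<close>.\<close>

lemma sde_difference_second_moment:
  fixes b \<sigma> :: "real ^ 'd \<Rightarrow> real ^ 'd" and W X Y :: "real \<Rightarrow> 'w \<Rightarrow> real ^ 'd"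
  assumes bm: "scalar_bm M F (\<lambda>t \<omega>. W t \<omega> $ i)"
    and "closed S" and cont: "continuous_on S (\<lambda>x. b x $ i)" "continuous_on S (\<lambda>x. \<sigma> x $ i)"
    and C: "\<And>x. x \<in> S \<Longrightarrow> norm x \<le> C" "\<And>x. x \<in> S \<Longrightarrow> \<bar>b x $ i\<bar> \<le> C" "\<And>x. x \<in> S \<Longrightarrow> \<bar>\<sigma> x $ i\<bar> \<le> C"
    and K: "\<And>x y. x \<in> S \<Longrightarrow> y \<in> S \<Longrightarrow> \<bar>b x $ i - b y $ i\<bar> \<le> K * norm (x - y)"
      "\<And>x y. x \<in> S \<Longrightarrow> y \<in> S \<Longrightarrow> \<bar>\<sigma> x $ i - \<sigma> y $ i\<bar> \<le> K * norm (x - y)"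
    and X: "sde_solution M F W S b \<sigma> x\<^sub>0 X" and Y: "sde_solution M F W S b \<sigma> x\<^sub>0 Y"
    and "0 \<le> t" "0 < \<kappa>"
    and a: "\<And>s. 0 \<le> s \<Longrightarrow> s \<le> t \<Longrightarrow> (\<integral>\<omega>. (norm (X s \<omega> - Y s \<omega>))\<^sup>2 \<partial>M) \<le> c * exp (\<kappa> * s)" and "0 \<le> c"
  shows "(\<integral>\<omega>. (X t \<omega> $ i - Y t \<omega> $ i)\<^sup>2 \<partial>M) \<le> 2 * (t + 1) * K\<^sup>2 * c / \<kappa> * exp (\<kappa> * t)"
proof -
  interpret scalar_bm M F "\<lambda>t \<omega>. W t \<omega> $ i" by fact
  let ?B = "\<lambda>t \<omega>. W t \<omega> $ i"
  obtain J where J: "is_ito_integral M F ?B (\<lambda>t \<omega>. \<sigma> (X t \<omega>) $ i) J"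
    "AE \<omega> in M. \<forall>t\<ge>0. X t \<omega> $ i = x\<^sub>0 $ i + (LINT s:{0..t}|lborel. b (X s \<omega>) $ i) + J t \<omega>"
    using sde_solutionD(4)[OF X, of i] by blast
  obtain J' where J': "is_ito_integral M F ?B (\<lambda>t \<omega>. \<sigma> (Y t \<omega>) $ i) J'"
    "AE \<omega> in M. \<forall>t\<ge>0. Y t \<omega> $ i = x\<^sub>0 $ i + (LINT s:{0..t}|lborel. b (Y s \<omega>) $ i) + J' t \<omega>"
    using sde_solutionD(4)[OF Y, of i] by blast
  note XS = sde_solutionD(3)[OF X] and YS = sde_solutionD(3)[OF Y]
  note bX = coefficient_path[OF X bm \<open>closed S\<close> cont(1)] and bY = coefficient_path[OF Y bm \<open>closed S\<close> cont(1)]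
  note sX = coefficient_path[OF X bm \<open>closed S\<close> cont(2)] and sY = coefficient_path[OF Y bm \<open>closed S\<close> cont(2)]
  define \<beta> where "\<beta> n k \<omega> = b (X (dyadic n k) \<omega>) $ i - b (Y (dyadic n k) \<omega>) $ i" for n k \<omega>
  define \<eta> where "\<eta> n k \<omega> = \<sigma> (X (dyadic n k) \<omega>) $ i - \<sigma> (Y (dyadic n k) \<omega>) $ i" for n k \<omega>
  define A where "A n = simple_integral (\<lambda>t \<omega>. t) (n * 2 ^ n) (dyadic n) (\<beta> n) t" for n
  define I where "I n = simple_integral ?B (n * 2 ^ n) (dyadic n) (\<eta> n) t" for n
  define IX where "IX n = simple_integral ?B (n * 2 ^ n) (dyadic n) (\<lambda>k \<omega>. \<sigma> (X (dyadic n k) \<omega>) $ i) t" for n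
  define IY where "IY n = simple_integral ?B (n * 2 ^ n) (dyadic n) (\<lambda>k \<omega>. \<sigma> (Y (dyadic n k) \<omega>) $ i) t" for n
  define AL where "AL \<omega> = (LINT s:{0..t}|lborel. b (X s \<omega>) $ i - b (Y s \<omega>) $ i)" for \<omega>
  have \<beta>m: "\<beta> n k \<in> borel_measurable (F (dyadic n k))" and \<eta>m: "\<eta> n k \<in> borel_measurable (F (dyadic n k))" for n k
    unfolding \<beta>_def \<eta>_def by (intro borel_measurable_diff bX(1) bY(1) sX(1) sY(1); simp)+
  have [measurable]: "\<beta> n k \<in> borel_measurable M" "\<eta> n k \<in> borel_measurable M" for n k
    using \<beta>m \<eta>m measurable_F_M dyadic_nonneg by blast+
  have bd: "\<bar>\<beta> n k \<omega>\<bar> \<le> 2 * C" "\<bar>\<eta> n k \<omega>\<bar> \<le> 2 * C" if "\<omega> \<in> space M" for n k \<omega>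
    using C(2,3)[OF XS[OF that, of "dyadic n k"]] C(2,3)[OF YS[OF that, of "dyadic n k"]]
    unfolding \<beta>_def \<eta>_def by auto
  have si: "simple_integrand M F (n * 2 ^ n) (dyadic n) (\<eta> n)" for n
    using \<eta>m bd by (intro dyadic_simple_integrand[where C = "2 * C"]) auto
  have siX: "simple_integrand M F (n * 2 ^ n) (dyadic n) (\<lambda>k \<omega>. \<sigma> (X (dyadic n k) \<omega>) $ i)"
    and siY: "simple_integrand M F (n * 2 ^ n) (dyadic n) (\<lambda>k \<omega>. \<sigma> (Y (dyadic n k) \<omega>) $ i)" for n
    using sX(1) sY(1) C(3) XS YS by (intro dyadic_simple_integrand[where C = C]; simp)+
  have I_eq: "I n \<omega> = IX n \<omega> + - IY n \<omega>" for n \<omega>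
    unfolding I_def IX_def IY_def simple_integral_def \<eta>_def by (simp add: left_diff_distrib sum_subtractf)
  have IXm[measurable]: "IX n \<in> borel_measurable M" and IYm[measurable]: "IY n \<in> borel_measurable M" for n
    unfolding IX_def IY_def by (rule simple_integral_measurable[OF siX \<open>0 \<le> t\<close>] simple_integral_measurable[OF siY \<open>0 \<le> t\<close>])+
  have Jm[measurable]: "J t \<in> borel_measurable M" "J' t \<in> borel_measurable M"
    using is_ito_integralD(2)[OF J(1) \<open>0 \<le> t\<close>] is_ito_integralD(2)[OF J'(1) \<open>0 \<le> t\<close>]
      measurable_F_M[OF _ \<open>0 \<le> t\<close>] by blast+
  have Am[measurable]: "A n \<in> borel_measurable M" for n
    unfolding A_def simple_integral_def by measurable
  have "tends_in_prob M IX (J t)"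
    unfolding IX_def by (rule ito_integral_riemann_sums[OF J(1), where C = C]) (use sX XS C \<open>0 \<le> t\<close> in auto)
  moreover have "tends_in_prob M IY (J' t)"
    unfolding IY_def by (rule ito_integral_riemann_sums[OF J'(1), where C = C]) (use sY YS C \<open>0 \<le> t\<close> in auto)
  ultimately have Ilim: "tends_in_prob M (\<lambda>n \<omega>. IX n \<omega> + - IY n \<omega>) (\<lambda>\<omega>. J t \<omega> + - J' t \<omega>)"
    by (intro tends_in_prob_add tends_in_prob_uminus) measurable
  have cd: "continuous_on {0..} (\<lambda>s. b (X s \<omega>) $ i - b (Y s \<omega>) $ i)" if "\<omega> \<in> space M" for \<omega>
    using bX(2)[OF that] bY(2)[OF that] by (rule continuous_on_diff)
  have Alim: "(\<lambda>n. A n \<omega>) \<longlonglongrightarrow> AL \<omega>" if \<omega>: "\<omega> \<in> space M" for \<omega>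
    unfolding A_def AL_def
  proof (rule dyadic_step_integrals(1)[OF \<open>0 \<le> t\<close> cd[OF \<omega>], where C = "2 * C"])
    show "\<bar>b (X s \<omega>) $ i - b (Y s \<omega>) $ i\<bar> \<le> 2 * C" if "0 \<le> s" for s
      using C(2)[OF XS[OF \<omega> that]] C(2)[OF YS[OF \<omega> that]] by auto
    show "(\<lambda>n. \<beta> n (left_index n s) \<omega>) \<longlonglongrightarrow> b (X s \<omega>) $ i - b (Y s \<omega>) $ i" if "0 < s" for s
      unfolding \<beta>_def by (rule continuous_left_index_tendsto[OF cd[OF \<omega>] that])
  qed (use bd[OF \<omega>] in auto)
  have ALm[measurable]: "AL \<in> borel_measurable M"
    by (rule borel_measurable_LIMSEQ_real[OF Alim Am])
  have "tends_in_prob M A AL"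
    by (rule tends_in_prob_AE) (use Alim in auto)
  \<comment> \<open>The limit on the right is the difference of the two integral equations in
    component \<open>i\<close>, in which the starting values cancel.\<close>
  from tends_in_prob_add[OF _ _ _ _ this Ilim]
  have lim: "tends_in_prob M (\<lambda>n \<omega>. A n \<omega> + I n \<omega>) (\<lambda>\<omega>. AL \<omega> + (J t \<omega> + - J' t \<omega>))"
    unfolding I_eq by simp
  have split: "set_integrable lborel {0..t} (\<lambda>s. b (X s \<omega>) $ i)" "set_integrable lborel {0..t} (\<lambda>s. b (Y s \<omega>) $ i)"
    if "\<omega> \<in> space M" for \<omega>
    using bX(2)[OF that] bY(2)[OF that] by (auto intro!: borel_integrable_atLeastAtMost' elim: continuous_on_subset)
  have eq: "AE \<omega> in M. AL \<omega> + (J t \<omega> + - J' t \<omega>) = X t \<omega> $ i - Y t \<omega> $ i"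
    using J(2) J'(2) AE_space
  proof eventually_elim
    case (elim \<omega>)
    have "AL \<omega> = (LINT s:{0..t}|lborel. b (X s \<omega>) $ i) - (LINT s:{0..t}|lborel. b (Y s \<omega>) $ i)"
      unfolding AL_def using split[OF elim(3)] by (rule set_integral_diff(2))
    then show ?case using elim(1,2) \<open>0 \<le> t\<close> by auto
  qed
  have Xm[measurable]: "X s \<in> borel_measurable M" "Y s \<in> borel_measurable M" if "0 \<le> s" for s
    using sde_solutionD(1)[OF X that] sde_solutionD(1)[OF Y that] measurable_F_M[OF _ that] by blast+
  have nint: "integrable M (\<lambda>\<omega>. (norm (X s \<omega> - Y s \<omega>))\<^sup>2)" if "0 \<le> s" for s
  proof (rule integrable_const_bound[where B = "(2 * C)\<^sup>2"])
    show "AE \<omega> in M. norm ((norm (X s \<omega> - Y s \<omega>))\<^sup>2) \<le> (2 * C)\<^sup>2"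
    proof (rule AE_I2)
      fix \<omega> assume "\<omega> \<in> space M"
      then have "norm (X s \<omega> - Y s \<omega>) \<le> 2 * C"
        using C(1)[OF XS[of \<omega> s]] C(1)[OF YS[of \<omega> s]] that norm_triangle_ineq4[of "X s \<omega>" "Y s \<omega>"] by simp
      from power_mono[OF this norm_ge_zero, of 2]
      show "norm ((norm (X s \<omega> - Y s \<omega>))\<^sup>2) \<le> (2 * C)\<^sup>2" by simp
    qed
  qed (use Xm[OF that] in measurable)
  let ?d = "\<lambda>n k. min t (dyadic n (Suc k)) - min t (dyadic n k)"
  have dstep: "dyadic n k \<le> dyadic n (Suc k)" for n k by simp
  have dnn: "0 \<le> ?d n k" for n k using dstep[of n k] by linarith
  have sqi: "integrable M (\<lambda>\<omega>. (\<beta> n k \<omega>)\<^sup>2)" "integrable M (\<lambda>\<omega>. (\<eta> n k \<omega>)\<^sup>2)"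
    and sqle: "expectation (\<lambda>\<omega>. (\<beta> n k \<omega>)\<^sup>2) \<le> K\<^sup>2 * expectation (\<lambda>\<omega>. (norm (X (dyadic n k) \<omega> - Y (dyadic n k) \<omega>))\<^sup>2)"
     "expectation (\<lambda>\<omega>. (\<eta> n k \<omega>)\<^sup>2) \<le> K\<^sup>2 * expectation (\<lambda>\<omega>. (norm (X (dyadic n k) \<omega> - Y (dyadic n k) \<omega>))\<^sup>2)" for n k
  proof -
    let ?N = "\<lambda>\<omega>. K\<^sup>2 * (norm (X (dyadic n k) \<omega> - Y (dyadic n k) \<omega>))\<^sup>2"
    have N: "integrable M ?N" using nint[of "dyadic n k"] by simp
    have le: "(\<beta> n k \<omega>)\<^sup>2 \<le> ?N \<omega>" "(\<eta> n k \<omega>)\<^sup>2 \<le> ?N \<omega>" if "\<omega> \<in> space M" for \<omega>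
    proof -
      have "\<bar>\<beta> n k \<omega>\<bar> \<le> K * norm (X (dyadic n k) \<omega> - Y (dyadic n k) \<omega>)"
        "\<bar>\<eta> n k \<omega>\<bar> \<le> K * norm (X (dyadic n k) \<omega> - Y (dyadic n k) \<omega>)"
        unfolding \<beta>_def \<eta>_def using XS[OF that] YS[OF that] by (intro K; simp)+
      from power_mono[OF this(1), of 2] power_mono[OF this(2), of 2]
      show "(\<beta> n k \<omega>)\<^sup>2 \<le> ?N \<omega>" "(\<eta> n k \<omega>)\<^sup>2 \<le> ?N \<omega>" by (simp_all add: power_mult_distrib)
    qed
    show i1: "integrable M (\<lambda>\<omega>. (\<beta> n k \<omega>)\<^sup>2)"
      by (rule Bochner_Integration.integrable_bound[OF N]) (use le in auto)
    show i2: "integrable M (\<lambda>\<omega>. (\<eta> n k \<omega>)\<^sup>2)"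
      by (rule Bochner_Integration.integrable_bound[OF N]) (use le in auto)
    show "expectation (\<lambda>\<omega>. (\<beta> n k \<omega>)\<^sup>2) \<le> K\<^sup>2 * expectation (\<lambda>\<omega>. (norm (X (dyadic n k) \<omega> - Y (dyadic n k) \<omega>))\<^sup>2)"
      using integral_mono[OF i1 N le(1)] by simp
    show "expectation (\<lambda>\<omega>. (\<eta> n k \<omega>)\<^sup>2) \<le> K\<^sup>2 * expectation (\<lambda>\<omega>. (norm (X (dyadic n k) \<omega> - Y (dyadic n k) \<omega>))\<^sup>2)"
      using integral_mono[OF i2 N le(2)] by simp
  qed
  have Zbound: "integrable M (\<lambda>\<omega>. (A n \<omega> + I n \<omega>)\<^sup>2) \<and>
    expectation (\<lambda>\<omega>. (A n \<omega> + I n \<omega>)\<^sup>2) \<le> 2 * (t + 1) * K\<^sup>2 * c / \<kappa> * exp (\<kappa> * t)" for n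
  proof -
    let ?m = "n * 2 ^ n"
    have dsum: "(\<Sum>k<?m. ?d n k) \<le> t"
      using sum_lessThan_telescope[of "\<lambda>k. min t (dyadic n k)" ?m] \<open>0 \<le> t\<close> by simp
    \<comment> \<open>Cauchy-Schwarz in time; the total length of the clipped cells is at most
      \<open>t\<close>. This is the origin of the factor \<open>t\<close> in \<open>t + 1\<close>,
      while the 1 comes from the isometry.\<close>
    have Ale: "(A n \<omega>)\<^sup>2 \<le> t * (\<Sum>k<?m. (\<beta> n k \<omega>)\<^sup>2 * ?d n k)" for \<omega>
    proof -
      have "(A n \<omega>)\<^sup>2 \<le> (\<Sum>k<?m. ?d n k) * (\<Sum>k<?m. (\<beta> n k \<omega>)\<^sup>2 * ?d n k)"
        unfolding A_def simple_integral_def using dnn by (intro sum_weighted_square_le)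
      also have "\<dots> \<le> t * (\<Sum>k<?m. (\<beta> n k \<omega>)\<^sup>2 * ?d n k)"
        using dsum dnn by (intro mult_right_mono sum_nonneg mult_nonneg_nonneg) auto
      finally show ?thesis .
    qed
    have Ii: "integrable M (\<lambda>\<omega>. (I n \<omega>)\<^sup>2)"
      "expectation (\<lambda>\<omega>. (I n \<omega>)\<^sup>2) = (\<Sum>k<?m. expectation (\<lambda>\<omega>. (\<eta> n k \<omega>)\<^sup>2) * ?d n k)"
      unfolding I_def using simple_integral_isometry[OF si \<open>0 \<le> t\<close>] by blast+
    have dom: "integrable M (\<lambda>\<omega>. 2 * (t * (\<Sum>k<?m. (\<beta> n k \<omega>)\<^sup>2 * ?d n k)) + 2 * (I n \<omega>)\<^sup>2)"
      using sqi Ii by (intro Bochner_Integration.integrable_add integrable_mult_right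
          Bochner_Integration.integrable_sum integrable_mult_left) auto
    have le: "(A n \<omega> + I n \<omega>)\<^sup>2 \<le> 2 * (t * (\<Sum>k<?m. (\<beta> n k \<omega>)\<^sup>2 * ?d n k)) + 2 * (I n \<omega>)\<^sup>2" for \<omega>
    proof -
      have "0 \<le> (A n \<omega> - I n \<omega>)\<^sup>2" by simp
      then have "(A n \<omega> + I n \<omega>)\<^sup>2 \<le> 2 * (A n \<omega>)\<^sup>2 + 2 * (I n \<omega>)\<^sup>2"
        by (simp add: power2_eq_square algebra_simps)
      then show ?thesis using Ale[of \<omega>] by linarith
    qed
    have int: "integrable M (\<lambda>\<omega>. (A n \<omega> + I n \<omega>)\<^sup>2)"
    proof (rule Bochner_Integration.integrable_bound[OF dom])
      show "AE \<omega> in M. norm ((A n \<omega> + I n \<omega>)\<^sup>2) \<le> norm (2 * (t * (\<Sum>k<?m. (\<beta> n k \<omega>)\<^sup>2 * ?d n k)) + 2 * (I n \<omega>)\<^sup>2)"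
        using order_trans[OF le abs_ge_self] by simp
    qed (simp add: I_eq, measurable)
    \<comment> \<open>The bound \<open>a\<close> is available up to time \<open>t\<close> only; a
      cell that starts later has length 0 after clipping.\<close>
    have exple: "expectation (\<lambda>\<omega>. (norm (X (dyadic n k) \<omega> - Y (dyadic n k) \<omega>))\<^sup>2) * ?d n k
       \<le> c * (exp (\<kappa> * min t (dyadic n k)) * ?d n k)" for k
    proof (cases "dyadic n k \<le> t")
      case True
      from mult_right_mono[OF a[OF dyadic_nonneg True] dnn, of n k] True show ?thesis by (simp add: mult_ac)
    next
      case False
      then have "?d n k = 0" using dstep[of n k] by linarith
      then show ?thesis by simp
    qed
    \<comment> \<open>Drift and noise coefficients satisfy the same Lipschitz bound, so one estimate
      serves for both.\<close>
    have coef: "(\<Sum>k<?m. expectation (\<lambda>\<omega>. (\<zeta> k \<omega>)\<^sup>2) * ?d n k) \<le> K\<^sup>2 * c / \<kappa> * exp (\<kappa> * t)"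
      if "\<And>k. expectation (\<lambda>\<omega>. (\<zeta> k \<omega>)\<^sup>2) \<le> K\<^sup>2 * expectation (\<lambda>\<omega>. (norm (X (dyadic n k) \<omega> - Y (dyadic n k) \<omega>))\<^sup>2)"
      for \<zeta> :: "nat \<Rightarrow> 'w \<Rightarrow> real"
    proof -
      have "(\<Sum>k<?m. expectation (\<lambda>\<omega>. (\<zeta> k \<omega>)\<^sup>2) * ?d n k) \<le> (\<Sum>k<?m. K\<^sup>2 * c * (exp (\<kappa> * min t (dyadic n k)) * ?d n k))"
      proof (rule sum_mono)
        fix k
        have "expectation (\<lambda>\<omega>. (\<zeta> k \<omega>)\<^sup>2) * ?d n k \<le>
           K\<^sup>2 * expectation (\<lambda>\<omega>. (norm (X (dyadic n k) \<omega> - Y (dyadic n k) \<omega>))\<^sup>2) * ?d n k"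
          by (rule mult_right_mono[OF that dnn])
        also have "\<dots> \<le> K\<^sup>2 * (c * (exp (\<kappa> * min t (dyadic n k)) * ?d n k))"
          unfolding mult.assoc[of "K\<^sup>2"] by (intro mult_left_mono exple) simp
        finally show "expectation (\<lambda>\<omega>. (\<zeta> k \<omega>)\<^sup>2) * ?d n k \<le> K\<^sup>2 * c * (exp (\<kappa> * min t (dyadic n k)) * ?d n k)"
          by (simp only: mult.assoc)
      qed
      also have "\<dots> = K\<^sup>2 * c * (\<Sum>k<?m. exp (\<kappa> * min t (dyadic n k)) * ?d n k)"
        by (rule sum_distrib_left[symmetric])
      also have "\<dots> \<le> K\<^sup>2 * c * (exp (\<kappa> * min t (dyadic n ?m)) / \<kappa>)"
        using \<open>0 \<le> c\<close> \<open>0 < \<kappa>\<close> by (intro mult_left_mono sum_exp_increment_le) auto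
      also have "\<dots> \<le> K\<^sup>2 * c * (exp (\<kappa> * t) / \<kappa>)"
        using \<open>0 \<le> c\<close> \<open>0 < \<kappa>\<close> by (intro mult_left_mono divide_right_mono) auto
      finally show ?thesis by simp
    qed
    have "expectation (\<lambda>\<omega>. (A n \<omega> + I n \<omega>)\<^sup>2) \<le>
       expectation (\<lambda>\<omega>. 2 * (t * (\<Sum>k<?m. (\<beta> n k \<omega>)\<^sup>2 * ?d n k)) + 2 * (I n \<omega>)\<^sup>2)"
      by (rule integral_mono[OF int dom le])
    also have "\<dots> = 2 * (t * (\<Sum>k<?m. expectation (\<lambda>\<omega>. (\<beta> n k \<omega>)\<^sup>2) * ?d n k)) +
       2 * (\<Sum>k<?m. expectation (\<lambda>\<omega>. (\<eta> n k \<omega>)\<^sup>2) * ?d n k)"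
      using sqi Ii by (simp add: Bochner_Integration.integral_sum)
    also have "\<dots> \<le> 2 * (t * (K\<^sup>2 * c / \<kappa> * exp (\<kappa> * t))) + 2 * (K\<^sup>2 * c / \<kappa> * exp (\<kappa> * t))"
      using \<open>0 \<le> t\<close> by (intro add_mono mult_left_mono coef sqle) auto
    also have "\<dots> = 2 * (t + 1) * K\<^sup>2 * c / \<kappa> * exp (\<kappa> * t)"
      using \<open>0 < \<kappa>\<close> by (simp add: field_simps)
    finally show ?thesis using int by blast
  qed
  have "expectation (\<lambda>\<omega>. (AL \<omega> + (J t \<omega> + - J' t \<omega>))\<^sup>2) \<le> 2 * (t + 1) * K\<^sup>2 * c / \<kappa> * exp (\<kappa> * t)"
    using Zbound by (intro second_moment_le_in_prob(2)[OF _ _ lim] always_eventually) (simp_all add: I_eq, measurable)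
  also have "expectation (\<lambda>\<omega>. (AL \<omega> + (J t \<omega> + - J' t \<omega>))\<^sup>2) = expectation (\<lambda>\<omega>. (X t \<omega> $ i - Y t \<omega> $ i)\<^sup>2)"
  proof (rule integral_cong_AE)
    have "(\<lambda>x. x $ i) \<in> borel_measurable (borel :: (real ^ 'd) measure)" by measurable
    then show "(\<lambda>\<omega>. (X t \<omega> $ i - Y t \<omega> $ i)\<^sup>2) \<in> borel_measurable M"
      using Xm[OF \<open>0 \<le> t\<close>] by measurable
    show "AE \<omega> in M. (AL \<omega> + (J t \<omega> + - J' t \<omega>))\<^sup>2 = (X t \<omega> $ i - Y t \<omega> $ i)\<^sup>2"
      using eq by eventually_elim simp
  qed measurable
  finally show ?thesis .
qed

text \<open>Boundedness of \<open>S\<close> gives a bound on the second moment of the difference to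
  start from, and each Picard step halves it. The difference hence vanishes at each fixed time, and
  continuity of the paths gathers the exceptional null sets of the dyadic times.\<close>

lemma sde_pathwise_unique:
  fixes b \<sigma> :: "real ^ 'd \<Rightarrow> real ^ 'd" and W X Y :: "real \<Rightarrow> 'w \<Rightarrow> real ^ 'd"
  assumes bm: "\<And>i. scalar_bm M F (\<lambda>t \<omega>. W t \<omega> $ i)"
    and "closed S" and cont: "continuous_on S b" "continuous_on S \<sigma>"
    and C: "\<And>x. x \<in> S \<Longrightarrow> norm x \<le> C" "\<And>x i. x \<in> S \<Longrightarrow> \<bar>b x $ i\<bar> \<le> C" "\<And>x i. x \<in> S \<Longrightarrow> \<bar>\<sigma> x $ i\<bar> \<le> C"
    and K: "\<And>x y i. x \<in> S \<Longrightarrow> y \<in> S \<Longrightarrow> \<bar>b x $ i - b y $ i\<bar> \<le> K * norm (x - y)"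
      "\<And>x y i. x \<in> S \<Longrightarrow> y \<in> S \<Longrightarrow> \<bar>\<sigma> x $ i - \<sigma> y $ i\<bar> \<le> K * norm (x - y)"
    and X: "sde_solution M F W S b \<sigma> x\<^sub>0 X" and Y: "sde_solution M F W S b \<sigma> x\<^sub>0 Y"
  shows "indistinguishable M X Y"
proof -
  \<comment> \<open>An arbitrary component, chosen to make the facts about the filtration
    available.\<close>
  fix i0 :: 'd
  interpret scalar_bm M F "\<lambda>t \<omega>. W t \<omega> $ i0" by (rule bm)
  note XS = sde_solutionD(3)[OF X] and YS = sde_solutionD(3)[OF Y]
  have Xm[measurable]: "X s \<in> borel_measurable M" "Y s \<in> borel_measurable M" if "0 \<le> s" for s
    using sde_solutionD(1)[OF X that] sde_solutionD(1)[OF Y that] measurable_F_M[OF _ that] by blast+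
  define a where "a s = expectation (\<lambda>\<omega>. (norm (X s \<omega> - Y s \<omega>))\<^sup>2)" for s
  have nle: "(norm (X s \<omega> - Y s \<omega>))\<^sup>2 \<le> (2 * C)\<^sup>2" if "0 \<le> s" "\<omega> \<in> space M" for s \<omega>
  proof -
    have "norm (X s \<omega> - Y s \<omega>) \<le> 2 * C"
      using C(1)[OF XS[of \<omega> s]] C(1)[OF YS[of \<omega> s]] that norm_triangle_ineq4[of "X s \<omega>" "Y s \<omega>"] by simp
    from power_mono[OF this norm_ge_zero, of 2] show ?thesis .
  qed
  have nint: "integrable M (\<lambda>\<omega>. (norm (X s \<omega> - Y s \<omega>))\<^sup>2)" if "0 \<le> s" for s
  proof (rule integrable_const_bound[where B = "(2 * C)\<^sup>2"])
    show "AE \<omega> in M. norm ((norm (X s \<omega> - Y s \<omega>))\<^sup>2) \<le> (2 * C)\<^sup>2"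
      using nle[OF that] by (intro AE_I2) simp
  qed (use Xm[OF that] in measurable)
  have cint: "integrable M (\<lambda>\<omega>. (X s \<omega> $ i - Y s \<omega> $ i)\<^sup>2)" if "0 \<le> s" for s i
  proof (rule Bochner_Integration.integrable_bound[OF nint[OF that]])
    have "(\<lambda>x. x $ i) \<in> borel_measurable (borel :: (real ^ 'd) measure)" by measurable
    then show "(\<lambda>\<omega>. (X s \<omega> $ i - Y s \<omega> $ i)\<^sup>2) \<in> borel_measurable M" using Xm[OF that] by measurable
    show "AE \<omega> in M. norm ((X s \<omega> $ i - Y s \<omega> $ i)\<^sup>2) \<le> norm ((norm (X s \<omega> - Y s \<omega>))\<^sup>2)"
    proof (rule AE_I2)
      fix \<omega>
      have "\<bar>(X s \<omega> - Y s \<omega>) $ i\<bar> \<le> norm (X s \<omega> - Y s \<omega>)" by (rule component_le_norm_cart)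
      from power_mono[OF this, of 2] show "norm ((X s \<omega> $ i - Y s \<omega> $ i)\<^sup>2) \<le> norm ((norm (X s \<omega> - Y s \<omega>))\<^sup>2)" by simp
    qed
  qed
  have a_sum: "a s = (\<Sum>i\<in>UNIV. expectation (\<lambda>\<omega>. (X s \<omega> $ i - Y s \<omega> $ i)\<^sup>2))" if "0 \<le> s" for s
    unfolding a_def power2_norm_vec using cint[OF that] by (simp add: Bochner_Integration.integral_sum)
  have zero: "AE \<omega> in M. X T \<omega> = Y T \<omega>" if "0 \<le> T" for T
  proof -
    define D where "D = real CARD('d) * (2 * (T + 1) * K\<^sup>2)"
    \<comment> \<open>\<open>D\<close> collects the constants of one step, summed over all
      components and with \<open>t\<close> replaced by \<open>T\<close>. The step multiplies the
      bound by at most \<open>D / \<kappa>\<close>, which is at most 1 / 2; the summand 1 keeps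
      \<kappa> positive when \<open>D = 0\<close>.\<close>
    define \<kappa> where "\<kappa> = 2 * D + 1"
    have D0: "0 \<le> D" using that by (simp add: D_def)
    have \<kappa>0: "0 < \<kappa>" using D0 by (simp add: \<kappa>_def)
    have "\<forall>t. 0 \<le> t \<and> t \<le> T \<longrightarrow> a t \<le> (2 * C)\<^sup>2 * (1 / 2) ^ p * exp (\<kappa> * t)" for p
    proof (induction p)
      case 0
      show ?case
      proof (intro allI impI)
        fix t assume t: "0 \<le> t \<and> t \<le> T"
        have "a t \<le> expectation (\<lambda>_. (2 * C)\<^sup>2)"
          unfolding a_def using nint nle t by (intro integral_mono) auto
        also have "\<dots> = (2 * C)\<^sup>2 * 1" by (simp add: prob_space)
        also have "\<dots> \<le> (2 * C)\<^sup>2 * exp (\<kappa> * t)" using t \<kappa>0 by (intro mult_left_mono) auto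
        finally show "a t \<le> (2 * C)\<^sup>2 * (1 / 2) ^ 0 * exp (\<kappa> * t)" by simp
      qed
    next
      case (Suc p)
      let ?c = "(2 * C)\<^sup>2 * (1 / 2) ^ p"
      show ?case
      proof (intro allI impI)
        fix t assume t: "0 \<le> t \<and> t \<le> T"
        have "expectation (\<lambda>\<omega>. (X t \<omega> $ i - Y t \<omega> $ i)\<^sup>2) \<le> 2 * (t + 1) * K\<^sup>2 * ?c / \<kappa> * exp (\<kappa> * t)" for i
          using cont C K t \<kappa>0 Suc.IH
          by (intro sde_difference_second_moment[OF bm \<open>closed S\<close> _ _ _ _ _ _ _ X Y, where C = C])
             (auto simp: a_def intro: continuous_intros)
        then have "a t \<le> (\<Sum>i\<in>(UNIV :: 'd set). 2 * (t + 1) * K\<^sup>2 * ?c / \<kappa> * exp (\<kappa> * t))"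
          unfolding a_sum[OF conjunct1[OF t]] by (intro sum_mono)
        also have "\<dots> = real CARD('d) * (2 * (t + 1) * K\<^sup>2) / \<kappa> * (?c * exp (\<kappa> * t))"
          using \<kappa>0 by (simp add: field_simps)
        also have "\<dots> \<le> 1 / 2 * (?c * exp (\<kappa> * t))"
        proof (rule mult_right_mono)
          have "real CARD('d) * (2 * (t + 1) * K\<^sup>2) \<le> D"
            unfolding D_def using t by (intro mult_left_mono mult_right_mono) auto
          also have "D \<le> \<kappa> / 2" using D0 by (simp add: \<kappa>_def)
          finally show "real CARD('d) * (2 * (t + 1) * K\<^sup>2) / \<kappa> \<le> 1 / 2" using \<kappa>0 by (simp add: field_simps)
        qed simp
        finally show "a t \<le> (2 * C)\<^sup>2 * (1 / 2) ^ Suc p * exp (\<kappa> * t)" by (simp add: mult_ac)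
      qed
    qed
    then have bound: "a T \<le> (2 * C)\<^sup>2 * (1 / 2) ^ p * exp (\<kappa> * T)" for p using that by blast
    have lim: "(\<lambda>p. (2 * C)\<^sup>2 * (1 / 2) ^ p * exp (\<kappa> * T)) \<longlonglongrightarrow> (2 * C)\<^sup>2 * 0 * exp (\<kappa> * T)"
      by (intro tendsto_intros LIMSEQ_power_zero) simp
    have "a T \<le> (2 * C)\<^sup>2 * 0 * exp (\<kappa> * T)"
      by (rule LIMSEQ_le_const[OF lim]) (intro exI allI impI, rule bound)
    then have "a T \<le> 0" by simp
    moreover have "0 \<le> a T" unfolding a_def by simp
    ultimately have "AE \<omega> in M. (norm (X T \<omega> - Y T \<omega>))\<^sup>2 = 0"
      using integral_nonneg_eq_0_iff_AE[OF nint[OF that]] unfolding a_def by simp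
    then show ?thesis by eventually_elim simp
  qed
  have "AE \<omega> in M. \<forall>n k. X (dyadic n k) \<omega> = Y (dyadic n k) \<omega>"
    unfolding AE_all_countable using zero by simp
  then show ?thesis
    unfolding indistinguishable_def using AE_space
  proof eventually_elim
    case (elim \<omega>)
    show ?case
    proof (intro allI impI)
      fix t :: real assume "0 \<le> t"
      show "X t \<omega> = Y t \<omega>"
      proof (cases "t = 0")
        case True
        then show ?thesis using elim(1)[rule_format, of 0 0] by simp
      next
        case False
        then have "0 < t" using \<open>0 \<le> t\<close> by simp
        from continuous_left_index_tendsto[OF sde_solutionD(2)[OF X elim(2)] this]
          continuous_left_index_tendsto[OF sde_solutionD(2)[OF Y elim(2)] this]
        show ?thesis using elim(1) by (simp add: LIMSEQ_unique)
      qed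
    qed
  qed
qed

section \<open>The Euler scheme\<close>

text \<open>Cells are closed on the left here, since the Euler scheme freezes the coefficients from
  a grid point onwards. In contrast, \<open>left_index\<close> follows the intervals of
  \<open>simple_process\<close>, which are closed on the right.\<close>

definition cell_index :: "nat \<Rightarrow> real \<Rightarrow> nat" where
  "cell_index n t = nat \<lfloor>t * 2 ^ n\<rfloor>"

lemma cell_index:
  assumes "0 \<le> t"
  shows "dyadic n (cell_index n t) \<le> t" "t < dyadic n (Suc (cell_index n t))"
proof -
  have "0 \<le> t * 2 ^ n" using assms by simp
  then have r: "real (cell_index n t) = of_int \<lfloor>t * 2 ^ n\<rfloor>" unfolding cell_index_def by simp
  have "of_int \<lfloor>t * 2 ^ n\<rfloor> \<le> t * 2 ^ n" "t * 2 ^ n < of_int \<lfloor>t * 2 ^ n\<rfloor> + 1"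
    by (rule of_int_floor_le) (rule real_of_int_floor_add_one_gt)
  then show "dyadic n (cell_index n t) \<le> t" "t < dyadic n (Suc (cell_index n t))"
    using r by (simp_all add: dyadic_def field_simps)
qed

lemma cell_index_unique:
  assumes "dyadic n k \<le> t" "t < dyadic n (Suc k)"
  shows "cell_index n t = k"
proof -
  have t: "0 \<le> t" using assms(1) dyadic_nonneg order_trans by blast
  have "dyadic n k < dyadic n (Suc (cell_index n t))" "dyadic n (cell_index n t) < dyadic n (Suc k)"
    using cell_index[OF t, of n] assms by linarith+
  then show ?thesis by simp
qed

lemma cell_index_dyadic [simp]: "cell_index n (dyadic n k) = k"
  by (rule cell_index_unique) simp_all

lemma dyadic_refine:
  assumes "n \<le> N"
  shows "dyadic n k = dyadic N (k * 2 ^ (N - n))"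
  using assms by (auto simp: dyadic_def le_iff_add power_add)

text \<open>Coarse grid points are also fine grid points, so a fine cell cannot straddle one of them
  and the coarse scheme keeps its coefficients frozen on it.\<close>

lemma dyadic_cell_refine:
  assumes "n \<le> N"
  shows "dyadic N (Suc j) \<le> dyadic n (Suc (cell_index n (dyadic N j)))"
  using cell_index(2)[OF dyadic_nonneg[of N j], of n] unfolding dyadic_refine[OF assms] by simp

lemma discrete_gronwall:
  fixes u :: "nat \<Rightarrow> real"
  assumes "0 \<le> q" "0 \<le> \<gamma>" and u: "\<And>j. j \<le> J \<Longrightarrow> u j \<le> \<gamma> + q * (\<Sum>l<j. u l)"
  shows "j \<le> J \<Longrightarrow> u j \<le> \<gamma> * exp (q * real j)"
proof -
  \<comment> \<open>The sequence \<open>\<gamma> * (1 + q) ^ j\<close> solves the recursion with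
    equality, so it dominates every solution of the inequality.\<close>
  have geo: "\<gamma> + q * (\<Sum>l<j. \<gamma> * (1 + q) ^ l) = \<gamma> * (1 + q) ^ j" for j
    by (induction j) (auto simp: algebra_simps)
  have "j \<le> J \<Longrightarrow> u j \<le> \<gamma> * (1 + q) ^ j" for j
  proof (induction j rule: less_induct)
    case (less j)
    have "u j \<le> \<gamma> + q * (\<Sum>l<j. u l)" by (rule u[OF less.prems])
    also have "\<dots> \<le> \<gamma> + q * (\<Sum>l<j. \<gamma> * (1 + q) ^ l)"
      using less assms(1) by (intro add_left_mono mult_left_mono sum_mono) auto
    finally show ?case unfolding geo .
  qed
  moreover have "\<gamma> * (1 + q) ^ j \<le> \<gamma> * exp (q * real j)" for j
  proof -
    have "(1 + q) ^ j \<le> exp q ^ j" using assms(1) exp_ge_add_one_self by (intro power_mono) auto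
    also have "\<dots> = exp (q * real j)" by (metis exp_of_nat_mult mult.commute)
    finally show ?thesis using assms(2) by (rule mult_left_mono)
  qed
  ultimately show "j \<le> J \<Longrightarrow> u j \<le> \<gamma> * exp (q * real j)" by (meson order_trans)
qed

lemma borel_measurable_vec:
  fixes f :: "'w \<Rightarrow> real ^ 'd"
  shows "f \<in> borel_measurable N \<longleftrightarrow> (\<forall>i. (\<lambda>\<omega>. f \<omega> $ i) \<in> borel_measurable N)"
  unfolding borel_measurable_euclidean_space[of f]
  by (auto simp: Basis_vec_def inner_axis)

locale euler_scheme = prob_space M for M :: "'w measure" +
  fixes F :: "real \<Rightarrow> 'w measure" and W :: "real \<Rightarrow> 'w \<Rightarrow> real ^ 'd"
    and b \<sigma> :: "real ^ 'd \<Rightarrow> real ^ 'd" and x\<^sub>0 :: "real ^ 'd" and C K :: real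
  assumes bm: "\<And>i. scalar_bm M F (\<lambda>t \<omega>. W t \<omega> $ i)"
    and W_continuous: "AE \<omega> in M. continuous_on {0..} (\<lambda>t. W t \<omega>)"
    and b_bound: "\<And>x i. \<bar>b x $ i\<bar> \<le> C" and \<sigma>_bound: "\<And>x i. \<bar>\<sigma> x $ i\<bar> \<le> C"
    and b_lipschitz: "\<And>x y i. \<bar>b x $ i - b y $ i\<bar> \<le> K * norm (x - y)"
    and \<sigma>_lipschitz: "\<And>x y i. \<bar>\<sigma> x $ i - \<sigma> y $ i\<bar> \<le> K * norm (x - y)"
begin

primrec node :: "nat \<Rightarrow> nat \<Rightarrow> 'w \<Rightarrow> real ^ 'd" where
  "node n 0 \<omega> = x\<^sub>0"
| "node n (Suc k) \<omega> = (\<chi> i. node n k \<omega> $ i + b (node n k \<omega>) $ i * (1 / 2 ^ n) +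
     \<sigma> (node n k \<omega>) $ i * (W (dyadic n (Suc k)) \<omega> $ i - W (dyadic n k) \<omega> $ i))"

definition frozen :: "nat \<Rightarrow> real \<Rightarrow> 'w \<Rightarrow> real ^ 'd" where
  "frozen n t \<omega> = node n (cell_index n t) \<omega>"

text \<open>Interpolation between nodes follows the Brownian path itself, so that each level
  satisfies the integral equation with frozen coefficients exactly, at all times; see
  \<open>euler_sum\<close>.\<close>

definition euler :: "nat \<Rightarrow> real \<Rightarrow> 'w \<Rightarrow> real ^ 'd" where
  "euler n t \<omega> = (\<chi> i. frozen n t \<omega> $ i + b (frozen n t \<omega>) $ i * (t - dyadic n (cell_index n t)) +
     \<sigma> (frozen n t \<omega>) $ i * (W t \<omega> $ i - W (dyadic n (cell_index n t)) \<omega> $ i))"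

lemma C_nonneg: "0 \<le> C"
  using order_trans[OF abs_ge_zero b_bound] .

lemma K_nonneg: "0 \<le> K"
proof -
  have "0 \<le> K * norm (axis undefined 1 - (0 :: real ^ 'd))"
    by (rule order_trans[OF abs_ge_zero b_lipschitz])
  then show ?thesis by (simp add: norm_axis_1)
qed

lemma b_component_continuous: "continuous_on S (\<lambda>x. b x $ i)"
  and \<sigma>_component_continuous: "continuous_on S (\<lambda>x. \<sigma> x $ i)"
proof -
  have "K-lipschitz_on UNIV (\<lambda>x. b x $ i)" "K-lipschitz_on UNIV (\<lambda>x. \<sigma> x $ i)"
    using b_lipschitz \<sigma>_lipschitz K_nonneg by (auto intro!: lipschitz_onI simp: dist_real_def dist_norm)
  then show "continuous_on S (\<lambda>x. b x $ i)" "continuous_on S (\<lambda>x. \<sigma> x $ i)"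
    using lipschitz_on_continuous_on continuous_on_subset by blast+
qed

lemma b_measurable [measurable]: "(\<lambda>x. b x $ i) \<in> borel_measurable borel"
  and \<sigma>_measurable [measurable]: "(\<lambda>x. \<sigma> x $ i) \<in> borel_measurable borel"
  using b_component_continuous \<sigma>_component_continuous by (auto intro: borel_measurable_continuous_onI)

text \<open>At the right end of a cell \<open>cell_index\<close> has already moved on, but the
  formula still holds there, because it is the recursion for the next node.\<close>

lemma euler_cell:
  assumes "dyadic n k \<le> t" "t \<le> dyadic n (Suc k)"
  shows "euler n t \<omega> $ i = node n k \<omega> $ i + b (node n k \<omega>) $ i * (t - dyadic n k) +
     \<sigma> (node n k \<omega>) $ i * (W t \<omega> $ i - W (dyadic n k) \<omega> $ i)"
proof (cases "t = dyadic n (Suc k)")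
  case True
  then show ?thesis by (simp add: euler_def frozen_def) (simp add: dyadic_Suc)
next
  case False
  then have "cell_index n t = k" using assms by (intro cell_index_unique) auto
  then show ?thesis by (simp add: euler_def frozen_def)
qed

lemma euler_dyadic [simp]: "euler n (dyadic n k) \<omega> = node n k \<omega>"
  by (simp add: vec_eq_iff euler_def frozen_def)

lemma euler_0 [simp]: "euler n 0 \<omega> = x\<^sub>0"
  using euler_dyadic[of n 0 \<omega>] by simp

text \<open>Over a cell of a finer grid a coarse level moves with its frozen coefficients, so
  different levels can be compared through increments over one common grid.\<close>

lemma euler_fine_step:
  assumes "n \<le> N"
  shows "euler n (dyadic N (Suc j)) \<omega> $ i - euler n (dyadic N j) \<omega> $ i =
    b (frozen n (dyadic N j) \<omega>) $ i * (1 / 2 ^ N) +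
    \<sigma> (frozen n (dyadic N j) \<omega>) $ i * (W (dyadic N (Suc j)) \<omega> $ i - W (dyadic N j) \<omega> $ i)"
proof -
  let ?k = "cell_index n (dyadic N j)"
  have 1: "dyadic n ?k \<le> dyadic N j" by (rule cell_index(1)) simp
  have le: "dyadic N j \<le> dyadic N (Suc j)" by simp
  have 2: "dyadic N (Suc j) \<le> dyadic n (Suc ?k)" by (rule dyadic_cell_refine[OF assms])
  show ?thesis
    unfolding euler_cell[OF 1 order_trans[OF le 2]] euler_cell[OF order_trans[OF 1 le] 2] frozen_def
    by (simp add: dyadic_Suc[of N] algebra_simps)
qed

text \<open>The \<sigma>-algebra is left open: it is taken from the given filtration in the
  estimates, and from the completed natural filtration of \<open>W\<close> to obtain a strong
  solution.\<close>

lemma node_measurable: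
  assumes "\<And>s. 0 \<le> s \<Longrightarrow> s \<le> t \<Longrightarrow> W s \<in> borel_measurable N" "dyadic n k \<le> t"
  shows "node n k \<in> borel_measurable N"
  using assms(2)
proof (induction k)
  case 0
  have "node n 0 = (\<lambda>_. x\<^sub>0)" by (simp add: fun_eq_iff)
  then show ?case by (simp only: borel_measurable_const)
next
  case (Suc k)
  then have k: "dyadic n k \<le> t" by (meson dyadic_le_iff le_SucI order_refl order_trans)
  have [measurable]: "node n k \<in> borel_measurable N" by (rule Suc.IH[OF k])
  have [measurable]: "W (dyadic n k) \<in> borel_measurable N" "W (dyadic n (Suc k)) \<in> borel_measurable N"
    using assms(1) k Suc.prems by simp_all
  have [measurable]: "(\<lambda>\<omega>. W (dyadic n k) \<omega> $ i) \<in> borel_measurable N" "(\<lambda>\<omega>. W (dyadic n (Suc k)) \<omega> $ i) \<in> borel_measurable N"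
    "(\<lambda>\<omega>. node n k \<omega> $ i) \<in> borel_measurable N" for i
    using borel_measurable_vec[of "W (dyadic n k)" N] borel_measurable_vec[of "W (dyadic n (Suc k))" N]
      borel_measurable_vec[of "node n k" N] \<open>W (dyadic n k) \<in> borel_measurable N\<close>
      \<open>W (dyadic n (Suc k)) \<in> borel_measurable N\<close> \<open>node n k \<in> borel_measurable N\<close> by blast+
  show ?case
    unfolding borel_measurable_vec by (simp, measurable)
qed

lemma frozen_measurable:
  assumes "\<And>s. 0 \<le> s \<Longrightarrow> s \<le> t \<Longrightarrow> W s \<in> borel_measurable N" "0 \<le> t"
  shows "frozen n t \<in> borel_measurable N"
proof -
  have "node n (cell_index n t) \<in> borel_measurable N"
    by (rule node_measurable[OF assms(1) cell_index(1)[OF assms(2)]])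
  then show ?thesis by (simp add: frozen_def[abs_def])
qed

lemma euler_measurable:
  assumes "\<And>s. 0 \<le> s \<Longrightarrow> s \<le> t \<Longrightarrow> W s \<in> borel_measurable N" "0 \<le> t"
  shows "euler n t \<in> borel_measurable N"
proof -
  have f: "frozen n t \<in> borel_measurable N" by (rule frozen_measurable[OF assms])
  have w: "W t \<in> borel_measurable N" "W (dyadic n (cell_index n t)) \<in> borel_measurable N"
    using assms cell_index(1)[OF assms(2), of n] by simp_all
  note [measurable] = f
  have [measurable]: "(\<lambda>\<omega>. W t \<omega> $ i) \<in> borel_measurable N" "(\<lambda>\<omega>. W (dyadic n (cell_index n t)) \<omega> $ i) \<in> borel_measurable N"
    "(\<lambda>\<omega>. frozen n t \<omega> $ i) \<in> borel_measurable N" for i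
    using f w borel_measurable_vec by blast+
  show ?thesis
    unfolding borel_measurable_vec by (simp add: euler_def, measurable)
qed

lemma W_measurable: "0 \<le> s \<Longrightarrow> s \<le> t \<Longrightarrow> W s \<in> borel_measurable (F t)"
  unfolding borel_measurable_vec
  using scalar_bm.measurable_F_mono[OF bm scalar_bm.adapted[OF bm]] by blast

lemma F_imp_M: "f \<in> measurable (F t) N \<Longrightarrow> 0 \<le> t \<Longrightarrow> f \<in> measurable M N"
  using scalar_bm.measurable_F_M[OF bm] .

text \<open>The two simple integrals are the discrete forms of the drift and noise terms of the
  equation. Their limits identify the limit of the scheme as a solution.\<close>

lemma euler_sum:
  assumes "0 \<le> t" "t \<le> dyadic n q"
  shows "euler n t \<omega> $ i = x\<^sub>0 $ i + simple_integral (\<lambda>t \<omega>. t) q (dyadic n) (\<lambda>k \<omega>. b (node n k \<omega>) $ i) t \<omega> +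
    simple_integral (\<lambda>t \<omega>. W t \<omega> $ i) q (dyadic n) (\<lambda>k \<omega>. \<sigma> (node n k \<omega>) $ i) t \<omega>"
  using assms
proof (induction q arbitrary: t)
  case 0
  then show ?case by (simp add: simple_integral_def)
next
  case (Suc q)
  show ?case
  proof (cases "t \<le> dyadic n q")
    case True
    then have "min t (dyadic n q) = t" "min t (dyadic n (Suc q)) = t"
      using Suc.prems by simp_all
    then show ?thesis using Suc.IH[OF Suc.prems(1) True] by (simp add: simple_integral_def)
  next
    case False
    have m: "min t (dyadic n j) = dyadic n j" "min (dyadic n q) (dyadic n j) = dyadic n j" if "j \<le> q" for j
    proof -
      have "dyadic n j \<le> dyadic n q" using that by simp
      then show "min t (dyadic n j) = dyadic n j" "min (dyadic n q) (dyadic n j) = dyadic n j" using False by linarith+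
    qed
    have ms: "min t (dyadic n (Suc q)) = t" using Suc.prems by simp
    have "simple_integral B q (dyadic n) \<xi> t \<omega> = simple_integral B q (dyadic n) \<xi> (dyadic n q) \<omega>" for B \<xi>
      unfolding simple_integral_def by (intro sum.cong) (simp_all add: m)
    moreover have "euler n t \<omega> $ i = node n q \<omega> $ i + b (node n q \<omega>) $ i * (t - dyadic n q) +
     \<sigma> (node n q \<omega>) $ i * (W t \<omega> $ i - W (dyadic n q) \<omega> $ i)"
      using False Suc.prems by (intro euler_cell) auto
    moreover have "node n q \<omega> $ i = x\<^sub>0 $ i + simple_integral (\<lambda>t \<omega>. t) q (dyadic n) (\<lambda>k \<omega>. b (node n k \<omega>) $ i) (dyadic n q) \<omega> +
      simple_integral (\<lambda>t \<omega>. W t \<omega> $ i) q (dyadic n) (\<lambda>k \<omega>. \<sigma> (node n k \<omega>) $ i) (dyadic n q) \<omega>"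
      using Suc.IH[of "dyadic n q"] by simp
    moreover have "simple_integral B (Suc q) (dyadic n) \<xi> t \<omega> = simple_integral B q (dyadic n) \<xi> t \<omega> +
        \<xi> q \<omega> * (B t \<omega> - B (dyadic n q) \<omega>)" for B and \<xi> :: "nat \<Rightarrow> 'w \<Rightarrow> real"
      by (simp add: simple_integral_def m ms)
    ultimately show ?thesis by simp
  qed
qed

text \<open>The definition through \<open>cell_index\<close> hides continuity at the grid points. In
  the representation by \<open>euler_sum\<close> all times are clipped, and every term is
  continuous.\<close>

lemma euler_continuous:
  assumes "continuous_on {0..} (\<lambda>t. W t \<omega>)"
  shows "continuous_on {0..real T} (\<lambda>t. euler n t \<omega>)"
proof -
  have "continuous_on {0..real T} (\<lambda>t. euler n t \<omega> $ i)" for i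
  proof -
    have W: "continuous_on {0..real T} (\<lambda>t. W (min t (dyadic n k)) \<omega> $ i)" for k
    proof -
      have "continuous_on {0..real T} (\<lambda>t. W (min t (dyadic n k)) \<omega>)"
        by (rule continuous_on_compose2[OF assms]) (auto intro!: continuous_intros)
      then show ?thesis by (intro continuous_intros)
    qed
    have "continuous_on {0..real T} (\<lambda>t. x\<^sub>0 $ i + simple_integral (\<lambda>t \<omega>. t) (T * 2 ^ n) (dyadic n) (\<lambda>k \<omega>. b (node n k \<omega>) $ i) t \<omega> +
       simple_integral (\<lambda>t \<omega>. W t \<omega> $ i) (T * 2 ^ n) (dyadic n) (\<lambda>k \<omega>. \<sigma> (node n k \<omega>) $ i) t \<omega>)"
      unfolding simple_integral_def by (intro continuous_intros W)
    then show ?thesis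
      using euler_sum[of _ n "T * 2 ^ n" \<omega> i] by (simp cong: continuous_on_cong_simp)
  qed
  then have "continuous_on {0..real T} (\<lambda>t. \<chi> i. euler n t \<omega> $ i)" by (intro continuous_on_vec_lambda)
  then show ?thesis by simp
qed

lemma euler_frozen_second_moment:
  assumes "0 \<le> t"
  shows "integrable M (\<lambda>\<omega>. (norm (euler n t \<omega> - frozen n t \<omega>))\<^sup>2)"
    and "expectation (\<lambda>\<omega>. (norm (euler n t \<omega> - frozen n t \<omega>))\<^sup>2) \<le> real CARD('d) * (4 * C\<^sup>2) / 2 ^ n"
proof -
  let ?s = "dyadic n (cell_index n t)"
  \<comment> \<open>From the square of drift plus noise over part of one cell. With cell length h,
    the drift contributes at most \<open>C\<^sup>2\<close> times the square of h, which is at most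
    h, and the noise at most \<open>C\<^sup>2\<close> times the squared increment, of mean at most
    h. Hence the factor 4 below.\<close>
  define g where "g i \<omega> = 2 * (C\<^sup>2 / 2 ^ n) + 2 * C\<^sup>2 * (W t \<omega> $ i - W ?s \<omega> $ i)\<^sup>2" for i \<omega>
  have s: "0 \<le> ?s" "?s \<le> t" "t - ?s \<le> 1 / 2 ^ n"
    using cell_index[OF assms, of n] by (auto simp: dyadic_Suc)
  have gi: "integrable M (g i)" for i
    unfolding g_def using scalar_bm.increment_moment(1)[OF bm s(1,2), of i 2] by simp
  have Eg: "expectation (g i) \<le> 4 * C\<^sup>2 / 2 ^ n" for i
  proof -
    have "expectation (g i) = 2 * (C\<^sup>2 / 2 ^ n) + 2 * C\<^sup>2 * (t - ?s)"
      unfolding g_def using scalar_bm.increment_moment(1)[OF bm s(1,2), of i 2]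
        scalar_bm.increment_moment(3)[OF bm s(1,2), of i] by (simp add: prob_space)
    also have "\<dots> \<le> 2 * (C\<^sup>2 / 2 ^ n) + 2 * C\<^sup>2 * (1 / 2 ^ n)"
      using s(3) by (intro add_left_mono mult_left_mono) auto
    finally show ?thesis by simp
  qed
  have le: "(norm (euler n t \<omega> - frozen n t \<omega>))\<^sup>2 \<le> (\<Sum>i\<in>UNIV. g i \<omega>)" for \<omega>
    unfolding power2_norm_vec
  proof (rule sum_mono)
    fix i
    let ?u = "b (frozen n t \<omega>) $ i * (t - ?s)" and ?v = "\<sigma> (frozen n t \<omega>) $ i * (W t \<omega> $ i - W ?s \<omega> $ i)"
    have eq: "(euler n t \<omega> - frozen n t \<omega>) $ i = ?u + ?v" by (simp add: euler_def)
    have "0 \<le> (?u - ?v)\<^sup>2" by simp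
    then have 1: "(?u + ?v)\<^sup>2 \<le> 2 * ?u\<^sup>2 + 2 * ?v\<^sup>2" by (simp add: power2_eq_square algebra_simps)
    have "(t - ?s)\<^sup>2 \<le> 1 / 2 ^ n"
    proof -
      have "(t - ?s)\<^sup>2 \<le> (1 / 2 ^ n)\<^sup>2" using s by (intro power_mono) auto
      also have "\<dots> \<le> 1 / 2 ^ n" by (simp add: power2_eq_square divide_simps)
      finally show ?thesis .
    qed
    moreover have "(b (frozen n t \<omega>) $ i)\<^sup>2 \<le> C\<^sup>2" "(\<sigma> (frozen n t \<omega>) $ i)\<^sup>2 \<le> C\<^sup>2"
      using power_mono[OF b_bound abs_ge_zero, of "frozen n t \<omega>" i 2]
        power_mono[OF \<sigma>_bound abs_ge_zero, of "frozen n t \<omega>" i 2] by simp_all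
    ultimately have "?u\<^sup>2 \<le> C\<^sup>2 * (1 / 2 ^ n)" "?v\<^sup>2 \<le> C\<^sup>2 * (W t \<omega> $ i - W ?s \<omega> $ i)\<^sup>2"
      unfolding power_mult_distrib by (intro mult_mono; simp)+
    with 1 show "((euler n t \<omega> - frozen n t \<omega>) $ i)\<^sup>2 \<le> g i \<omega>" unfolding eq g_def by simp
  qed
  have m: "euler n t \<in> borel_measurable M" "frozen n t \<in> borel_measurable M"
    using F_imp_M[OF euler_measurable[OF W_measurable assms]] F_imp_M[OF frozen_measurable[OF W_measurable assms]] assms by simp_all
  have G: "integrable M (\<lambda>\<omega>. \<Sum>i\<in>UNIV. g i \<omega>)" using gi by simp
  show I: "integrable M (\<lambda>\<omega>. (norm (euler n t \<omega> - frozen n t \<omega>))\<^sup>2)"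
  proof (rule Bochner_Integration.integrable_bound[OF G])
    show "AE \<omega> in M. norm ((norm (euler n t \<omega> - frozen n t \<omega>))\<^sup>2) \<le> norm (\<Sum>i\<in>UNIV. g i \<omega>)"
      using order_trans[OF le abs_ge_self] by simp
  qed (use m in measurable)
  have "expectation (\<lambda>\<omega>. (norm (euler n t \<omega> - frozen n t \<omega>))\<^sup>2) \<le> expectation (\<lambda>\<omega>. \<Sum>i\<in>UNIV. g i \<omega>)"
    by (rule integral_mono[OF I G le])
  also have "\<dots> = (\<Sum>i\<in>UNIV. expectation (g i))" using gi by (simp add: Bochner_Integration.integral_sum)
  also have "\<dots> \<le> (\<Sum>i\<in>(UNIV :: 'd set). 4 * C\<^sup>2 / 2 ^ n)" by (intro sum_mono Eg)
  finally show "expectation (\<lambda>\<omega>. (norm (euler n t \<omega> - frozen n t \<omega>))\<^sup>2) \<le> real CARD('d) * (4 * C\<^sup>2) / 2 ^ n" by simp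
qed

end

lemma cell_index_tendsto:
  assumes "0 \<le> t"
  shows "(\<lambda>n. dyadic n (cell_index n t)) \<longlonglongrightarrow> t"
proof (rule tendsto_sandwich)
  have "t - 1 / 2 ^ n \<le> dyadic n (cell_index n t)" "dyadic n (cell_index n t) \<le> t" for n
    using cell_index[OF assms, of n] unfolding dyadic_Suc by linarith+
  then show "\<forall>\<^sub>F n in sequentially. t - 1 / 2 ^ n \<le> dyadic n (cell_index n t)"
    "\<forall>\<^sub>F n in sequentially. dyadic n (cell_index n t) \<le> t"
    by (auto intro: always_eventually)
  show "(\<lambda>n. t - 1 / 2 ^ n) \<longlonglongrightarrow> t"
    using tendsto_diff[OF tendsto_const half_power_tendsto_0, of t] by simp
qed simp

lemma cell_index_le:
  assumes "0 \<le> t" "t \<le> real T"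
  shows "cell_index n t \<le> T * 2 ^ n"
proof -
  have "dyadic n (cell_index n t) \<le> dyadic n (T * 2 ^ n)"
    using cell_index(1)[OF assms(1), of n] assms(2) by simp
  then show ?thesis by (simp only: dyadic_le_iff)
qed

section \<open>Second moments and maxima of the difference of two levels\<close>

context euler_scheme
begin

text \<open>Levels \<open>n\<close> and \<open>m\<close> are compared on a third grid, of level
  \<open>N\<close>, which is finer than both where this is used. Letting \<open>N\<close> grow for
  fixed \<open>n\<close> and \<open>m\<close> later reaches all dyadic times.\<close>

definition drift_gap :: "nat \<Rightarrow> nat \<Rightarrow> nat \<Rightarrow> 'd \<Rightarrow> nat \<Rightarrow> 'w \<Rightarrow> real" where
  "drift_gap n m N i l \<omega> = b (frozen n (dyadic N l) \<omega>) $ i - b (frozen m (dyadic N l) \<omega>) $ i"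

definition noise_gap :: "nat \<Rightarrow> nat \<Rightarrow> nat \<Rightarrow> 'd \<Rightarrow> nat \<Rightarrow> 'w \<Rightarrow> real" where
  "noise_gap n m N i l \<omega> = \<sigma> (frozen n (dyadic N l) \<omega>) $ i - \<sigma> (frozen m (dyadic N l) \<omega>) $ i"

definition drift_sum :: "nat \<Rightarrow> nat \<Rightarrow> nat \<Rightarrow> 'd \<Rightarrow> nat \<Rightarrow> 'w \<Rightarrow> real" where
  "drift_sum n m N i j \<omega> = (\<Sum>l<j. drift_gap n m N i l \<omega> * (1 / 2 ^ N))"

definition noise_sum :: "nat \<Rightarrow> nat \<Rightarrow> nat \<Rightarrow> 'd \<Rightarrow> nat \<Rightarrow> 'w \<Rightarrow> real" where
  "noise_sum n m N i j \<omega> =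
     (\<Sum>l<j. noise_gap n m N i l \<omega> * (W (dyadic N (Suc l)) \<omega> $ i - W (dyadic N l) \<omega> $ i))"

definition frozen_gap :: "nat \<Rightarrow> nat \<Rightarrow> nat \<Rightarrow> nat \<Rightarrow> real" where
  "frozen_gap n m N l = expectation (\<lambda>\<omega>. (norm (frozen n (dyadic N l) \<omega> - frozen m (dyadic N l) \<omega>))\<^sup>2)"

definition euler_gap :: "nat \<Rightarrow> nat \<Rightarrow> nat \<Rightarrow> nat \<Rightarrow> real" where
  "euler_gap n m N j = expectation (\<lambda>\<omega>. (norm (euler n (dyadic N j) \<omega> - euler m (dyadic N j) \<omega>))\<^sup>2)"

lemma euler_difference:
  assumes "n \<le> N" "m \<le> N"
  shows "euler n (dyadic N j) \<omega> $ i - euler m (dyadic N j) \<omega> $ i = drift_sum n m N i j \<omega> + noise_sum n m N i j \<omega>"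
proof (induction j)
  case 0
  then show ?case by (simp add: drift_sum_def noise_sum_def)
next
  case (Suc j)
  have "drift_sum n m N i (Suc j) \<omega> + noise_sum n m N i (Suc j) \<omega> =
     (euler n (dyadic N j) \<omega> $ i - euler m (dyadic N j) \<omega> $ i) +
     (euler n (dyadic N (Suc j)) \<omega> $ i - euler n (dyadic N j) \<omega> $ i) -
     (euler m (dyadic N (Suc j)) \<omega> $ i - euler m (dyadic N j) \<omega> $ i)"
    unfolding euler_fine_step[OF assms(1)] euler_fine_step[OF assms(2)] Suc.IH
    by (simp add: drift_sum_def noise_sum_def drift_gap_def noise_gap_def left_diff_distrib diff_divide_distrib)
  then show ?case by linarith
qed

lemma gap_measurable:
  "drift_gap n m N i l \<in> borel_measurable (F (dyadic N l))"
  "noise_gap n m N i l \<in> borel_measurable (F (dyadic N l))"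
  "drift_gap n m N i l \<in> borel_measurable M"
  "noise_gap n m N i l \<in> borel_measurable M"
proof -
  have [measurable]: "frozen n (dyadic N l) \<in> borel_measurable (F (dyadic N l))" for n
    by (rule frozen_measurable[OF W_measurable]) simp_all
  show 1: "drift_gap n m N i l \<in> borel_measurable (F (dyadic N l))"
    unfolding drift_gap_def[abs_def] by (intro borel_measurable_diff measurable_compose[OF _ b_measurable]) measurable
  show 2: "noise_gap n m N i l \<in> borel_measurable (F (dyadic N l))"
    unfolding noise_gap_def[abs_def] by (intro borel_measurable_diff measurable_compose[OF _ \<sigma>_measurable]) measurable
  show "drift_gap n m N i l \<in> borel_measurable M" "noise_gap n m N i l \<in> borel_measurable M"
    using F_imp_M[OF 1] F_imp_M[OF 2] by simp_all
qed

lemma gap_bound: "\<bar>drift_gap n m N i l \<omega>\<bar> \<le> 2 * C" "\<bar>noise_gap n m N i l \<omega>\<bar> \<le> 2 * C"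
  using b_bound[of "frozen n (dyadic N l) \<omega>" i] b_bound[of "frozen m (dyadic N l) \<omega>" i]
    \<sigma>_bound[of "frozen n (dyadic N l) \<omega>" i] \<sigma>_bound[of "frozen m (dyadic N l) \<omega>" i]
  unfolding drift_gap_def noise_gap_def by linarith+

lemma gap_square_integrable:
  "integrable M (\<lambda>\<omega>. (drift_gap n m N i l \<omega>)\<^sup>2)" "integrable M (\<lambda>\<omega>. (noise_gap n m N i l \<omega>)\<^sup>2)"
proof -
  note [measurable] = gap_measurable(3,4)
  show "integrable M (\<lambda>\<omega>. (drift_gap n m N i l \<omega>)\<^sup>2)"
  proof (rule integrable_const_bound[where B = "(2 * C)\<^sup>2"])
    show "AE \<omega> in M. norm ((drift_gap n m N i l \<omega>)\<^sup>2) \<le> (2 * C)\<^sup>2"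
      using power_mono[OF gap_bound(1) abs_ge_zero, of _ _ _ _ _ _ 2] by simp
  qed measurable
  show "integrable M (\<lambda>\<omega>. (noise_gap n m N i l \<omega>)\<^sup>2)"
  proof (rule integrable_const_bound[where B = "(2 * C)\<^sup>2"])
    show "AE \<omega> in M. norm ((noise_gap n m N i l \<omega>)\<^sup>2) \<le> (2 * C)\<^sup>2"
      using power_mono[OF gap_bound(2) abs_ge_zero, of _ _ _ _ _ _ 2] by simp
  qed measurable
qed

lemma noise_sum_isometry:
  shows "integrable M (\<lambda>\<omega>. (noise_sum n m N i j \<omega>)\<^sup>2)"
    and "expectation (\<lambda>\<omega>. (noise_sum n m N i j \<omega>)\<^sup>2) = (\<Sum>l<j. expectation (\<lambda>\<omega>. (noise_gap n m N i l \<omega>)\<^sup>2) * (1 / 2 ^ N))"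
proof -
  interpret scalar_bm M F "\<lambda>t \<omega>. W t \<omega> $ i" by (rule bm)
  show "integrable M (\<lambda>\<omega>. (noise_sum n m N i j \<omega>)\<^sup>2)"
    unfolding noise_sum_def using gap_measurable(2) gap_square_integrable(2)
    by (intro ito_isometry_sum(1)) auto
  have "expectation (\<lambda>\<omega>. (noise_sum n m N i j \<omega>)\<^sup>2) =
      (\<Sum>l<j. expectation (\<lambda>\<omega>. (noise_gap n m N i l \<omega>)\<^sup>2) * (dyadic N (Suc l) - dyadic N l))"
    unfolding noise_sum_def using gap_measurable(2) gap_square_integrable(2)
    by (intro ito_isometry_sum(2)) auto
  then show "expectation (\<lambda>\<omega>. (noise_sum n m N i j \<omega>)\<^sup>2) = (\<Sum>l<j. expectation (\<lambda>\<omega>. (noise_gap n m N i l \<omega>)\<^sup>2) * (1 / 2 ^ N))"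
    by (simp add: dyadic_Suc)
qed

text \<open>With the absolute values inside, the sum increases with \<open>j\<close>, so that its
  value at the last index controls the maximum of the drift part over all indices. The second moment
  is bounded by Cauchy-Schwarz in time.\<close>

lemma drift_sum_abs_second_moment:
  shows "integrable M (\<lambda>\<omega>. (\<Sum>l<j. \<bar>drift_gap n m N i l \<omega>\<bar> * (1 / 2 ^ N))\<^sup>2)"
    and "expectation (\<lambda>\<omega>. (\<Sum>l<j. \<bar>drift_gap n m N i l \<omega>\<bar> * (1 / 2 ^ N))\<^sup>2) \<le>
      dyadic N j * (\<Sum>l<j. expectation (\<lambda>\<omega>. (drift_gap n m N i l \<omega>)\<^sup>2) * (1 / 2 ^ N))"
proof -
  note [measurable] = gap_measurable(3)
  let ?g = "\<lambda>\<omega>. dyadic N j * (\<Sum>l<j. (drift_gap n m N i l \<omega>)\<^sup>2 * (1 / 2 ^ N))"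
  have g: "integrable M ?g" using gap_square_integrable(1) by simp
  have le: "(\<Sum>l<j. \<bar>drift_gap n m N i l \<omega>\<bar> * (1 / 2 ^ N))\<^sup>2 \<le> ?g \<omega>" for \<omega>
    using sum_weighted_square_le[of "{..<j}" "\<lambda>_. 1 / 2 ^ N" "\<lambda>l. \<bar>drift_gap n m N i l \<omega>\<bar>"]
    by (simp add: dyadic_def)
  show i: "integrable M (\<lambda>\<omega>. (\<Sum>l<j. \<bar>drift_gap n m N i l \<omega>\<bar> * (1 / 2 ^ N))\<^sup>2)"
  proof (rule Bochner_Integration.integrable_bound[OF g])
    show "AE \<omega> in M. norm ((\<Sum>l<j. \<bar>drift_gap n m N i l \<omega>\<bar> * (1 / 2 ^ N))\<^sup>2) \<le> norm (?g \<omega>)"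
      using order_trans[OF le abs_ge_self] by simp
  qed measurable
  show "expectation (\<lambda>\<omega>. (\<Sum>l<j. \<bar>drift_gap n m N i l \<omega>\<bar> * (1 / 2 ^ N))\<^sup>2) \<le>
      dyadic N j * (\<Sum>l<j. expectation (\<lambda>\<omega>. (drift_gap n m N i l \<omega>)\<^sup>2) * (1 / 2 ^ N))"
    using integral_mono[OF i g le] gap_square_integrable(1) by (simp add: Bochner_Integration.integral_sum)
qed

lemma drift_sum_le: "\<bar>drift_sum n m N i j \<omega>\<bar> \<le> (\<Sum>l<j. \<bar>drift_gap n m N i l \<omega>\<bar> * (1 / 2 ^ N))"
  unfolding drift_sum_def by (rule order_trans[OF sum_abs]) (simp add: abs_mult)

lemma euler_M: "0 \<le> t \<Longrightarrow> euler n t \<in> borel_measurable M"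
  and frozen_M: "0 \<le> t \<Longrightarrow> frozen n t \<in> borel_measurable M"
  using F_imp_M[OF euler_measurable[OF W_measurable]] F_imp_M[OF frozen_measurable[OF W_measurable]] by simp_all

lemma euler_difference_second_moment:
  assumes "n \<le> N" "m \<le> N"
  shows "integrable M (\<lambda>\<omega>. (norm (euler n (dyadic N j) \<omega> - euler m (dyadic N j) \<omega>))\<^sup>2)"
    and "euler_gap n m N j \<le> (\<Sum>i\<in>UNIV. 2 * dyadic N j * (\<Sum>l<j. expectation (\<lambda>\<omega>. (drift_gap n m N i l \<omega>)\<^sup>2) * (1 / 2 ^ N)) +
       2 * (\<Sum>l<j. expectation (\<lambda>\<omega>. (noise_gap n m N i l \<omega>)\<^sup>2) * (1 / 2 ^ N)))"
proof -
  let ?Q = "\<lambda>i \<omega>. \<Sum>l<j. \<bar>drift_gap n m N i l \<omega>\<bar> * (1 / 2 ^ N)"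
  let ?g = "\<lambda>\<omega>. \<Sum>i\<in>UNIV. 2 * (?Q i \<omega>)\<^sup>2 + 2 * (noise_sum n m N i j \<omega>)\<^sup>2"
  have gi: "integrable M (\<lambda>\<omega>. 2 * (?Q i \<omega>)\<^sup>2 + 2 * (noise_sum n m N i j \<omega>)\<^sup>2)" for i
    by (intro Bochner_Integration.integrable_add integrable_mult_right drift_sum_abs_second_moment(1) noise_sum_isometry(1))
  then have g: "integrable M ?g" by simp
  have le: "(norm (euler n (dyadic N j) \<omega> - euler m (dyadic N j) \<omega>))\<^sup>2 \<le> ?g \<omega>" for \<omega>
    unfolding power2_norm_vec
  proof (rule sum_mono)
    fix i
    let ?u = "drift_sum n m N i j \<omega>" and ?v = "noise_sum n m N i j \<omega>"
    have eq: "(euler n (dyadic N j) \<omega> - euler m (dyadic N j) \<omega>) $ i = ?u + ?v"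
      using euler_difference[OF assms] by simp
    have "0 \<le> (?u - ?v)\<^sup>2" by simp
    then have 1: "(?u + ?v)\<^sup>2 \<le> 2 * ?u\<^sup>2 + 2 * ?v\<^sup>2" by (simp add: power2_eq_square algebra_simps)
    have "?u\<^sup>2 \<le> (?Q i \<omega>)\<^sup>2" using power_mono[OF drift_sum_le abs_ge_zero, of n m N i j \<omega> 2] by simp
    with 1 show "((euler n (dyadic N j) \<omega> - euler m (dyadic N j) \<omega>) $ i)\<^sup>2 \<le> 2 * (?Q i \<omega>)\<^sup>2 + 2 * ?v\<^sup>2"
      unfolding eq by linarith
  qed
  have [measurable]: "euler n (dyadic N j) \<in> borel_measurable M" for n by (rule euler_M) simp
  show I: "integrable M (\<lambda>\<omega>. (norm (euler n (dyadic N j) \<omega> - euler m (dyadic N j) \<omega>))\<^sup>2)"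
  proof (rule Bochner_Integration.integrable_bound[OF g])
    show "AE \<omega> in M. norm ((norm (euler n (dyadic N j) \<omega> - euler m (dyadic N j) \<omega>))\<^sup>2) \<le> norm (?g \<omega>)"
      using order_trans[OF le abs_ge_self] by simp
  qed measurable
  have "euler_gap n m N j \<le> expectation ?g"
    unfolding euler_gap_def by (rule integral_mono[OF I g le])
  also have "\<dots> = (\<Sum>i\<in>UNIV. expectation (\<lambda>\<omega>. 2 * (?Q i \<omega>)\<^sup>2 + 2 * (noise_sum n m N i j \<omega>)\<^sup>2))"
    by (rule Bochner_Integration.integral_sum[OF gi])
  also have "\<dots> = (\<Sum>i\<in>UNIV. 2 * expectation (\<lambda>\<omega>. (?Q i \<omega>)\<^sup>2) + 2 * expectation (\<lambda>\<omega>. (noise_sum n m N i j \<omega>)\<^sup>2))"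
  proof (rule sum.cong)
    fix i
    show "expectation (\<lambda>\<omega>. 2 * (?Q i \<omega>)\<^sup>2 + 2 * (noise_sum n m N i j \<omega>)\<^sup>2) =
      2 * expectation (\<lambda>\<omega>. (?Q i \<omega>)\<^sup>2) + 2 * expectation (\<lambda>\<omega>. (noise_sum n m N i j \<omega>)\<^sup>2)"
      by (subst Bochner_Integration.integral_add)
         (simp_all only: integrable_mult_right drift_sum_abs_second_moment(1) noise_sum_isometry(1) integral_mult_right_zero)
  qed simp
  also have "\<dots> \<le> (\<Sum>i\<in>UNIV. 2 * (dyadic N j * (\<Sum>l<j. expectation (\<lambda>\<omega>. (drift_gap n m N i l \<omega>)\<^sup>2) * (1 / 2 ^ N))) +
       2 * (\<Sum>l<j. expectation (\<lambda>\<omega>. (noise_gap n m N i l \<omega>)\<^sup>2) * (1 / 2 ^ N)))"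
    unfolding noise_sum_isometry(2)
    by (intro sum_mono add_right_mono mult_left_mono drift_sum_abs_second_moment(2)) simp
  finally show "euler_gap n m N j \<le> (\<Sum>i\<in>UNIV. 2 * dyadic N j * (\<Sum>l<j. expectation (\<lambda>\<omega>. (drift_gap n m N i l \<omega>)\<^sup>2) * (1 / 2 ^ N)) +
       2 * (\<Sum>l<j. expectation (\<lambda>\<omega>. (noise_gap n m N i l \<omega>)\<^sup>2) * (1 / 2 ^ N)))"
    by (simp only: mult.assoc)
qed

lemma frozen_difference_second_moment:
  assumes "n \<le> m" "m \<le> N"
  shows "integrable M (\<lambda>\<omega>. (norm (frozen n (dyadic N l) \<omega> - frozen m (dyadic N l) \<omega>))\<^sup>2)"
    and "frozen_gap n m N l \<le> 3 * (euler_gap n m N l + real CARD('d) * (8 * C\<^sup>2) / 2 ^ n)"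
proof -
  let ?t = "dyadic N l"
  let ?A = "\<lambda>n \<omega>. (norm (euler n ?t \<omega> - frozen n ?t \<omega>))\<^sup>2"
  let ?E = "\<lambda>\<omega>. (norm (euler n ?t \<omega> - euler m ?t \<omega>))\<^sup>2"
  let ?g = "\<lambda>\<omega>. 3 * (?E \<omega> + ?A n \<omega> + ?A m \<omega>)"
  have Ei: "integrable M ?E" using euler_difference_second_moment(1)[of n N m l] assms by simp
  have Ai: "integrable M (?A n)" for n by (rule euler_frozen_second_moment(1)) simp
  have g: "integrable M ?g" using Ei Ai by simp
  have le: "(norm (frozen n ?t \<omega> - frozen m ?t \<omega>))\<^sup>2 \<le> ?g \<omega>" for \<omega>
  proof -
    let ?x = "norm (euler n ?t \<omega> - euler m ?t \<omega>)" and ?y = "norm (euler n ?t \<omega> - frozen n ?t \<omega>)"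
      and ?z = "norm (euler m ?t \<omega> - frozen m ?t \<omega>)"
    have "frozen n ?t \<omega> - frozen m ?t \<omega> = (euler n ?t \<omega> - euler m ?t \<omega>) - (euler n ?t \<omega> - frozen n ?t \<omega>) + (euler m ?t \<omega> - frozen m ?t \<omega>)"
      by simp
    then have "norm (frozen n ?t \<omega> - frozen m ?t \<omega>) \<le> norm ((euler n ?t \<omega> - euler m ?t \<omega>) - (euler n ?t \<omega> - frozen n ?t \<omega>)) + ?z"
      by (metis norm_triangle_ineq)
    also have "norm ((euler n ?t \<omega> - euler m ?t \<omega>) - (euler n ?t \<omega> - frozen n ?t \<omega>)) \<le> ?x + ?y"
      by (rule norm_triangle_ineq4)
    finally have "norm (frozen n ?t \<omega> - frozen m ?t \<omega>) \<le> ?x + ?y + ?z" by simp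
    from power_mono[OF this norm_ge_zero, of 2]
    have "(norm (frozen n ?t \<omega> - frozen m ?t \<omega>))\<^sup>2 \<le> (?x + ?y + ?z)\<^sup>2" .
    also have "\<dots> \<le> 3 * (?x\<^sup>2 + ?y\<^sup>2 + ?z\<^sup>2)"
    proof -
      have "0 \<le> (?x - ?y)\<^sup>2 + (?y - ?z)\<^sup>2 + (?x - ?z)\<^sup>2" by simp
      then show ?thesis by (simp add: power2_eq_square algebra_simps)
    qed
    finally show ?thesis .
  qed
  have [measurable]: "frozen n ?t \<in> borel_measurable M" for n by (rule frozen_M) simp
  show I: "integrable M (\<lambda>\<omega>. (norm (frozen n ?t \<omega> - frozen m ?t \<omega>))\<^sup>2)"
  proof (rule Bochner_Integration.integrable_bound[OF g])
    show "AE \<omega> in M. norm ((norm (frozen n ?t \<omega> - frozen m ?t \<omega>))\<^sup>2) \<le> norm (?g \<omega>)"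
      using order_trans[OF le abs_ge_self] by simp
  qed measurable
  have "frozen_gap n m N l \<le> expectation ?g"
    unfolding frozen_gap_def by (rule integral_mono[OF I g le])
  also have "\<dots> = 3 * (euler_gap n m N l + expectation (?A n) + expectation (?A m))"
    using Ei Ai by (simp add: euler_gap_def)
  also have "\<dots> \<le> 3 * (euler_gap n m N l + real CARD('d) * (4 * C\<^sup>2) / 2 ^ n + real CARD('d) * (4 * C\<^sup>2) / 2 ^ n)"
  proof -
    have "expectation (?A m) \<le> real CARD('d) * (4 * C\<^sup>2) / 2 ^ m" by (rule euler_frozen_second_moment(2)) simp
    also have "\<dots> \<le> real CARD('d) * (4 * C\<^sup>2) / 2 ^ n"
      using assms(1) by (intro divide_left_mono) (auto intro: power_increasing)
    finally have m: "expectation (?A m) \<le> real CARD('d) * (4 * C\<^sup>2) / 2 ^ n" .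
    have n: "expectation (?A n) \<le> real CARD('d) * (4 * C\<^sup>2) / 2 ^ n"
      by (rule euler_frozen_second_moment(2)) simp
    show ?thesis by (intro mult_left_mono add_mono order_refl m n) simp
  qed
  finally show "frozen_gap n m N l \<le> 3 * (euler_gap n m N l + real CARD('d) * (8 * C\<^sup>2) / 2 ^ n)" by simp
qed

lemma gap_second_moment:
  assumes "n \<le> m" "m \<le> N"
  shows "expectation (\<lambda>\<omega>. (drift_gap n m N i l \<omega>)\<^sup>2) \<le> K\<^sup>2 * frozen_gap n m N l"
    "expectation (\<lambda>\<omega>. (noise_gap n m N i l \<omega>)\<^sup>2) \<le> K\<^sup>2 * frozen_gap n m N l"
proof -
  let ?N = "\<lambda>\<omega>. K\<^sup>2 * (norm (frozen n (dyadic N l) \<omega> - frozen m (dyadic N l) \<omega>))\<^sup>2"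
  have N: "integrable M ?N" using frozen_difference_second_moment(1)[OF assms] by simp
  have "\<bar>drift_gap n m N i l \<omega>\<bar> \<le> K * norm (frozen n (dyadic N l) \<omega> - frozen m (dyadic N l) \<omega>)"
    "\<bar>noise_gap n m N i l \<omega>\<bar> \<le> K * norm (frozen n (dyadic N l) \<omega> - frozen m (dyadic N l) \<omega>)" for \<omega>
    unfolding drift_gap_def noise_gap_def by (rule b_lipschitz \<sigma>_lipschitz)+
  from power_mono[OF this(1) abs_ge_zero, of _ 2] power_mono[OF this(2) abs_ge_zero, of _ 2]
  have le: "(drift_gap n m N i l \<omega>)\<^sup>2 \<le> ?N \<omega>" "(noise_gap n m N i l \<omega>)\<^sup>2 \<le> ?N \<omega>" for \<omega>
    by (simp_all add: power_mult_distrib)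
  show "expectation (\<lambda>\<omega>. (drift_gap n m N i l \<omega>)\<^sup>2) \<le> K\<^sup>2 * frozen_gap n m N l"
    using integral_mono[OF gap_square_integrable(1) N le(1)] by (simp add: frozen_gap_def)
  show "expectation (\<lambda>\<omega>. (noise_gap n m N i l \<omega>)\<^sup>2) \<le> K\<^sup>2 * frozen_gap n m N l"
    using integral_mono[OF gap_square_integrable(2) N le(2)] by (simp add: frozen_gap_def)
qed

text \<open>Outcome of the Gronwall argument in \<open>frozen_gap_le\<close>: the exponent is the
  growth constant \<open>\<alpha>\<close> there times the horizon, and the factor in front is three
  times the one-cell error \<open>\<gamma>\<close> without its \<open>2 ^ n\<close>.\<close>

definition gap_const :: "nat \<Rightarrow> real" where
  "gap_const T = 3 * (real CARD('d) * (8 * C\<^sup>2)) * exp (6 * real CARD('d) * (real T + 1) * K\<^sup>2 * real T)"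

text \<open>The Lipschitz condition bounds the difference of the schemes by the earlier frozen gaps,
  and these are bounded by the earlier differences plus one-cell errors, which closes a discrete
  Gronwall inequality. The bound is uniform in the comparison grid \<open>N\<close>.\<close>

lemma frozen_gap_le:
  assumes "n \<le> m" "m \<le> N" "l \<le> T * 2 ^ N"
  shows "frozen_gap n m N l \<le> gap_const T / 2 ^ n"
proof -
  define \<gamma> where "\<gamma> = real CARD('d) * (8 * C\<^sup>2) / 2 ^ n"
  define \<alpha> where "\<alpha> = 6 * real CARD('d) * (real T + 1) * K\<^sup>2"
  define u where "u j = euler_gap n m N j + \<gamma>" for j
  have e: "frozen_gap n m N l \<le> 3 * u l" for l
    unfolding u_def \<gamma>_def by (rule frozen_difference_second_moment(2)[OF assms(1,2)])
  have fnn: "0 \<le> frozen_gap n m N l" for l unfolding frozen_gap_def by simp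
  have \<gamma>0: "0 \<le> \<gamma>" by (simp add: \<gamma>_def)
  have step: "u j \<le> \<gamma> + \<alpha> / 2 ^ N * (\<Sum>l<j. u l)" if "j \<le> T * 2 ^ N" for j
  proof -
    have tj: "dyadic N j \<le> real T" using dyadic_le_iff[of N j "T * 2 ^ N"] that by simp
    let ?S = "\<Sum>l<j. K\<^sup>2 * frozen_gap n m N l * (1 / 2 ^ N)"
    have S0: "0 \<le> ?S" using fnn by (intro sum_nonneg mult_nonneg_nonneg) auto
    have "euler_gap n m N j \<le> (\<Sum>i\<in>UNIV. 2 * dyadic N j * (\<Sum>l<j. expectation (\<lambda>\<omega>. (drift_gap n m N i l \<omega>)\<^sup>2) * (1 / 2 ^ N)) +
       2 * (\<Sum>l<j. expectation (\<lambda>\<omega>. (noise_gap n m N i l \<omega>)\<^sup>2) * (1 / 2 ^ N)))"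
      using assms(1,2) by (intro euler_difference_second_moment(2)) auto
    also have "\<dots> \<le> (\<Sum>i\<in>(UNIV :: 'd set). 2 * dyadic N j * ?S + 2 * ?S)"
      by (intro sum_mono add_mono mult_left_mono mult_right_mono gap_second_moment[OF assms(1,2)]) auto
    also have "\<dots> = real CARD('d) * (2 * (dyadic N j + 1) * ?S)" by (simp add: algebra_simps)
    also have "\<dots> \<le> real CARD('d) * (2 * (real T + 1) * ?S)"
      using tj S0 by (intro mult_left_mono mult_right_mono) auto
    also have "?S \<le> (\<Sum>l<j. K\<^sup>2 * (3 * u l) * (1 / 2 ^ N))"
      by (intro sum_mono mult_right_mono mult_left_mono e) auto
    also have "\<dots> = K\<^sup>2 * 3 / 2 ^ N * (\<Sum>l<j. u l)"
      unfolding sum_distrib_left by (intro sum.cong) simp_all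
    finally have "euler_gap n m N j \<le> real CARD('d) * (2 * (real T + 1) * (K\<^sup>2 * 3 / 2 ^ N * (\<Sum>l<j. u l)))"
      by (simp add: mult_left_mono)
    also have "\<dots> = \<alpha> / 2 ^ N * (\<Sum>l<j. u l)" by (simp add: \<alpha>_def)
    finally show ?thesis by (simp add: u_def)
  qed
  have "u l \<le> \<gamma> * exp (\<alpha> / 2 ^ N * real l)"
    by (rule discrete_gronwall[OF _ \<gamma>0 step assms(3)]) (simp add: \<alpha>_def)
  also have "\<dots> \<le> \<gamma> * exp (\<alpha> * real T)"
  proof -
    have "real l / 2 ^ N \<le> real T" using dyadic_le_iff[of N l "T * 2 ^ N"] assms(3) by (simp add: dyadic_def)
    then have "\<alpha> * (real l / 2 ^ N) \<le> \<alpha> * real T" by (intro mult_left_mono) (simp_all add: \<alpha>_def)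
    then show ?thesis using \<gamma>0 by (intro mult_left_mono) auto
  qed
  finally have "frozen_gap n m N l \<le> 3 * (\<gamma> * exp (\<alpha> * real T))" using e[of l] by simp
  also have "\<dots> = gap_const T / 2 ^ n" by (simp add: gap_const_def \<gamma>_def \<alpha>_def)
  finally show ?thesis .
qed

text \<open>The threshold is split evenly. Chebyshev's inequality for the monotone majorant of the
  drift part contributes the square of \<open>T\<close>, and the maximal inequality for the noise
  part contributes \<open>T\<close>, which makes up the factor \<open>(T + 1) * T\<close>.\<close>

lemma euler_difference_maximal:
  assumes "n \<le> m" "m \<le> N" "0 < \<epsilon>"
  shows "prob {\<omega>\<in>space M. \<exists>j\<le>T * 2 ^ N. 2 * \<epsilon> \<le> \<bar>euler n (dyadic N j) \<omega> $ i - euler m (dyadic N j) \<omega> $ i\<bar>} \<le>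
    (real T + 1) * real T * K\<^sup>2 * (gap_const T / 2 ^ n) / \<epsilon>\<^sup>2"
proof -
  interpret B: scalar_bm M F "\<lambda>t \<omega>. W t \<omega> $ i" by (rule bm)
  let ?J = "T * 2 ^ N"
  let ?c = "gap_const T / 2 ^ n"
  let ?Q = "\<lambda>\<omega>. \<Sum>l<?J. \<bar>drift_gap n m N i l \<omega>\<bar> * (1 / 2 ^ N)"
  note [measurable] = gap_measurable(3,4)
  have [measurable]: "(\<lambda>\<omega>. W (dyadic N l) \<omega> $ i) \<in> borel_measurable M" for l
    by (rule B.B_measurable_M) simp
  have [measurable]: "noise_sum n m N i j \<in> borel_measurable M" for j
    unfolding noise_sum_def[abs_def] by measurable
  have sum_le: "(\<Sum>l<?J. e l * (1 / 2 ^ N)) \<le> real T * (K\<^sup>2 * ?c)" if "\<And>l. e l \<le> K\<^sup>2 * frozen_gap n m N l" for e :: "nat \<Rightarrow> real"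
  proof -
    have "(\<Sum>l<?J. e l * (1 / 2 ^ N)) \<le> (\<Sum>l<?J. K\<^sup>2 * ?c * (1 / 2 ^ N))"
    proof (intro sum_mono mult_right_mono)
      fix l assume "l \<in> {..<?J}"
      then have "frozen_gap n m N l \<le> ?c" by (intro frozen_gap_le[OF assms(1,2)]) simp
      then show "e l \<le> K\<^sup>2 * ?c" using that[of l] mult_left_mono[of "frozen_gap n m N l" ?c "K\<^sup>2"] by simp
    qed simp
    then show ?thesis by simp
  qed
  have "prob {\<omega>\<in>space M. \<exists>j\<le>?J. 2 * \<epsilon> \<le> \<bar>euler n (dyadic N j) \<omega> $ i - euler m (dyadic N j) \<omega> $ i\<bar>}
    \<le> prob ({\<omega>\<in>space M. \<epsilon> \<le> \<bar>?Q \<omega>\<bar>} \<union> {\<omega>\<in>space M. \<exists>j\<le>?J. \<epsilon> \<le> \<bar>noise_sum n m N i j \<omega>\<bar>})"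
  proof (rule finite_measure_mono)
    show "{\<omega>\<in>space M. \<exists>j\<le>?J. 2 * \<epsilon> \<le> \<bar>euler n (dyadic N j) \<omega> $ i - euler m (dyadic N j) \<omega> $ i\<bar>} \<subseteq>
      {\<omega>\<in>space M. \<epsilon> \<le> \<bar>?Q \<omega>\<bar>} \<union> {\<omega>\<in>space M. \<exists>j\<le>?J. \<epsilon> \<le> \<bar>noise_sum n m N i j \<omega>\<bar>}"
    proof
      fix \<omega> assume "\<omega> \<in> {\<omega>\<in>space M. \<exists>j\<le>?J. 2 * \<epsilon> \<le> \<bar>euler n (dyadic N j) \<omega> $ i - euler m (dyadic N j) \<omega> $ i\<bar>}"
      then obtain j where \<omega>: "\<omega> \<in> space M" and j: "j \<le> ?J" and
        big: "2 * \<epsilon> \<le> \<bar>euler n (dyadic N j) \<omega> $ i - euler m (dyadic N j) \<omega> $ i\<bar>" by blast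
      have "2 * \<epsilon> \<le> \<bar>drift_sum n m N i j \<omega> + noise_sum n m N i j \<omega>\<bar>"
        using big euler_difference[of n N m j \<omega> i] assms(1,2) by simp
      moreover have "\<bar>drift_sum n m N i j \<omega>\<bar> \<le> \<bar>?Q \<omega>\<bar>"
      proof -
        have "(\<Sum>l<j. \<bar>drift_gap n m N i l \<omega>\<bar> * (1 / 2 ^ N)) \<le> ?Q \<omega>"
          using j by (intro sum_mono2) auto
        then show ?thesis using drift_sum_le[of n m N i j \<omega>] by linarith
      qed
      ultimately have "\<epsilon> \<le> \<bar>?Q \<omega>\<bar> \<or> \<epsilon> \<le> \<bar>noise_sum n m N i j \<omega>\<bar>" by linarith
      then show "\<omega> \<in> {\<omega>\<in>space M. \<epsilon> \<le> \<bar>?Q \<omega>\<bar>} \<union> {\<omega>\<in>space M. \<exists>j\<le>?J. \<epsilon> \<le> \<bar>noise_sum n m N i j \<omega>\<bar>}"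
        using \<omega> j by blast
    qed
  qed measurable
  also have "\<dots> \<le> prob {\<omega>\<in>space M. \<epsilon> \<le> \<bar>?Q \<omega>\<bar>} + prob {\<omega>\<in>space M. \<exists>j\<le>?J. \<epsilon> \<le> \<bar>noise_sum n m N i j \<omega>\<bar>}"
    by (rule measure_Un_le) measurable
  also have "prob {\<omega>\<in>space M. \<epsilon> \<le> \<bar>?Q \<omega>\<bar>} \<le> expectation (\<lambda>\<omega>. (?Q \<omega>)\<^sup>2) / \<epsilon>\<^sup>2"
    by (rule B.prob_ge_le_second_moment[OF _ drift_sum_abs_second_moment(1) assms(3)]) measurable
  also have "\<dots> \<le> real T * (real T * (K\<^sup>2 * ?c)) / \<epsilon>\<^sup>2"
  proof (rule divide_right_mono)
    have "expectation (\<lambda>\<omega>. (?Q \<omega>)\<^sup>2) \<le> dyadic N ?J * (\<Sum>l<?J. expectation (\<lambda>\<omega>. (drift_gap n m N i l \<omega>)\<^sup>2) * (1 / 2 ^ N))"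
      by (rule drift_sum_abs_second_moment(2))
    also have "\<dots> \<le> dyadic N ?J * (real T * (K\<^sup>2 * ?c))"
      by (intro mult_left_mono sum_le gap_second_moment[OF assms(1,2)]) simp
    finally show "expectation (\<lambda>\<omega>. (?Q \<omega>)\<^sup>2) \<le> real T * (real T * (K\<^sup>2 * ?c))" by simp
  qed simp
  also have "prob {\<omega>\<in>space M. \<exists>j\<le>?J. \<epsilon> \<le> \<bar>noise_sum n m N i j \<omega>\<bar>} \<le>
     (\<Sum>l<?J. expectation (\<lambda>\<omega>. (noise_gap n m N i l \<omega>)\<^sup>2) * (dyadic N (Suc l) - dyadic N l)) / \<epsilon>\<^sup>2"
    unfolding noise_sum_def using gap_measurable(2) gap_square_integrable(2) assms(3)
    by (intro B.maximal_inequality_sum) auto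
  also have "\<dots> \<le> real T * (K\<^sup>2 * ?c) / \<epsilon>\<^sup>2"
  proof -
    have d: "dyadic N (Suc l) - dyadic N l = 1 / 2 ^ N" for l by (simp add: dyadic_Suc)
    show ?thesis unfolding d by (intro divide_right_mono sum_le gap_second_moment(2)[OF assms(1,2)]) simp
  qed
  finally show ?thesis by (simp add: add_divide_distrib algebra_simps)
qed

text \<open>The dyadic grids are nested, so the events for fixed \<open>N\<close> increase with
  \<open>N\<close>, and a bound uniform in \<open>N\<close> passes to their union by continuity from
  below.\<close>

lemma euler_difference_maximal_dyadic:
  assumes "n \<le> m" "0 < \<epsilon>"
  shows "{\<omega>\<in>space M. \<exists>N\<ge>m. \<exists>j\<le>T * 2 ^ N. 2 * \<epsilon> \<le> \<bar>euler n (dyadic N j) \<omega> $ i - euler m (dyadic N j) \<omega> $ i\<bar>} \<in> events"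
    and "prob {\<omega>\<in>space M. \<exists>N\<ge>m. \<exists>j\<le>T * 2 ^ N. 2 * \<epsilon> \<le> \<bar>euler n (dyadic N j) \<omega> $ i - euler m (dyadic N j) \<omega> $ i\<bar>} \<le>
      (real T + 1) * real T * K\<^sup>2 * (gap_const T / 2 ^ n) / \<epsilon>\<^sup>2"
proof -
  define A where "A p = {\<omega>\<in>space M. \<exists>j\<le>T * 2 ^ (m + p). 2 * \<epsilon> \<le>
     \<bar>euler n (dyadic (m + p) j) \<omega> $ i - euler m (dyadic (m + p) j) \<omega> $ i\<bar>}" for p
  have [measurable]: "(\<lambda>\<omega>. euler n (dyadic N j) \<omega> $ i) \<in> borel_measurable M" for n N j
    using euler_M[of "dyadic N j" n] borel_measurable_vec by auto
  have A[measurable]: "A p \<in> events" for p unfolding A_def by measurable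
  have eq: "{\<omega>\<in>space M. \<exists>N\<ge>m. \<exists>j\<le>T * 2 ^ N. 2 * \<epsilon> \<le> \<bar>euler n (dyadic N j) \<omega> $ i - euler m (dyadic N j) \<omega> $ i\<bar>} = (\<Union>p. A p)"
    unfolding A_def by (auto simp: le_iff_add)
  show "{\<omega>\<in>space M. \<exists>N\<ge>m. \<exists>j\<le>T * 2 ^ N. 2 * \<epsilon> \<le> \<bar>euler n (dyadic N j) \<omega> $ i - euler m (dyadic N j) \<omega> $ i\<bar>} \<in> events"
    unfolding eq by measurable
  have inc: "incseq A"
  proof (rule incseq_SucI)
    fix p
    show "A p \<subseteq> A (Suc p)"
    proof
      fix \<omega> assume "\<omega> \<in> A p"
      then obtain j where j: "\<omega> \<in> space M" "j \<le> T * 2 ^ (m + p)"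
        "2 * \<epsilon> \<le> \<bar>euler n (dyadic (m + p) j) \<omega> $ i - euler m (dyadic (m + p) j) \<omega> $ i\<bar>"
        unfolding A_def by blast
      have "dyadic (m + p) j = dyadic (m + Suc p) (j * 2)"
        using dyadic_refine[of "m + p" "m + Suc p" j] by simp
      moreover have "j * 2 \<le> T * 2 ^ (m + Suc p)" using j(2) by simp
      ultimately show "\<omega> \<in> A (Suc p)" using j(1,3) unfolding A_def by (smt (verit) mem_Collect_eq)
    qed
  qed
  have "(\<lambda>p. prob (A p)) \<longlonglongrightarrow> prob (\<Union>p. A p)"
    using A inc by (intro finite_Lim_measure_incseq) auto
  then show "prob {\<omega>\<in>space M. \<exists>N\<ge>m. \<exists>j\<le>T * 2 ^ N. 2 * \<epsilon> \<le> \<bar>euler n (dyadic N j) \<omega> $ i - euler m (dyadic N j) \<omega> $ i\<bar>} \<le>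
      (real T + 1) * real T * K\<^sup>2 * (gap_const T / 2 ^ n) / \<epsilon>\<^sup>2"
    unfolding eq
  proof (rule LIMSEQ_le_const2)
    show "\<exists>N. \<forall>p\<ge>N. prob (A p) \<le> (real T + 1) * real T * K\<^sup>2 * (gap_const T / 2 ^ n) / \<epsilon>\<^sup>2"
      unfolding A_def by (intro exI allI impI euler_difference_maximal[OF assms(1) le_add1 assms(2)])
  qed
qed

section \<open>Almost sure uniform convergence of the scheme\<close>

definition rate :: real where "rate = sqrt (sqrt (1 / 2))"

text \<open>The fourth root of 1 / 2 balances two requirements: with threshold
  \<open>2 * rate ^ n\<close>, Chebyshev's bound of order \<open>1 / 2 ^ n\<close> becomes of order
  \<open>(rate\<^sup>2) ^ n\<close>, so the probabilities as well as the thresholds are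
  summable.\<close>

lemma rate: "0 < rate" "rate < 1" "rate\<^sup>2 = sqrt (1 / 2)" "rate ^ 4 = 1 / 2"
proof -
  show "0 < rate" "rate\<^sup>2 = sqrt (1 / 2)" by (simp_all add: rate_def)
  have "rate ^ 4 = (rate\<^sup>2)\<^sup>2" by simp
  then show "rate ^ 4 = 1 / 2" unfolding \<open>rate\<^sup>2 = _\<close> by simp
  show "rate < 1" by (simp add: rate_def)
qed

lemma euler_close_dyadic:
  "AE \<omega> in M. \<forall>T i. \<forall>\<^sub>F n in sequentially. \<forall>N\<ge>Suc n. \<forall>j\<le>T * 2 ^ N.
     \<bar>euler n (dyadic N j) \<omega> $ i - euler (Suc n) (dyadic N j) \<omega> $ i\<bar> < 2 * rate ^ n"
proof -
  have "AE \<omega> in M. \<forall>\<^sub>F n in sequentially. \<forall>N\<ge>Suc n. \<forall>j\<le>T * 2 ^ N.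
     \<bar>euler n (dyadic N j) \<omega> $ i - euler (Suc n) (dyadic N j) \<omega> $ i\<bar> < 2 * rate ^ n" for T i
  proof -
    define A where "A n = {\<omega>\<in>space M. \<exists>N\<ge>Suc n. \<exists>j\<le>T * 2 ^ N.
       2 * rate ^ n \<le> \<bar>euler n (dyadic N j) \<omega> $ i - euler (Suc n) (dyadic N j) \<omega> $ i\<bar>}" for n
    let ?c = "(real T + 1) * real T * K\<^sup>2 * gap_const T"
    have p: "prob (A n) \<le> ?c * (sqrt (1 / 2)) ^ n" for n
    proof -
      have "prob (A n) \<le> (real T + 1) * real T * K\<^sup>2 * (gap_const T / 2 ^ n) / (rate ^ n)\<^sup>2"
        unfolding A_def using rate(1) by (intro euler_difference_maximal_dyadic(2)) auto
      also have "\<dots> = ?c * ((1 / 2) ^ n / (rate ^ n)\<^sup>2)" by (simp add: power_one_over field_simps)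
      also have "(1 / 2) ^ n / (rate ^ n)\<^sup>2 = (rate\<^sup>2) ^ n"
        unfolding rate(4)[symmetric] using rate(1) by (simp add: power_mult[symmetric] power_add[symmetric] field_simps)
      finally show ?thesis by (simp only: rate(3))
    qed
    have "AE \<omega> in M. \<forall>\<^sub>F n in sequentially. \<omega> \<in> space M - A n"
    proof (rule borel_cantelli_AE1)
      show "A n \<in> events" for n
        unfolding A_def using rate(1) by (intro euler_difference_maximal_dyadic(1)) auto
      show "emeasure M (A n) < \<infinity>" for n by (simp add: emeasure_eq_measure)
      have "sqrt (1 / 2) < 1" by simp
      then have "summable (\<lambda>n. ?c * (sqrt (1 / 2)) ^ n)"
        by (intro summable_mult summable_geometric) simp
      then show "summable (\<lambda>n. prob (A n))"
        by (rule summable_comparison_test'[where N = 0]) (use p in simp)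
    qed
    then show ?thesis
    proof eventually_elim
      case (elim \<omega>)
      then show ?case
      proof eventually_elim
        case (elim n)
        then have "\<not> (\<exists>N\<ge>Suc n. \<exists>j\<le>T * 2 ^ N.
            2 * rate ^ n \<le> \<bar>euler n (dyadic N j) \<omega> $ i - euler (Suc n) (dyadic N j) \<omega> $ i\<bar>)"
          unfolding A_def by blast
        then show ?case by (meson not_le)
      qed
    qed
  qed
  then show ?thesis by (simp add: AE_all_countable AE_finite_all)
qed

text \<open>Where the scheme diverges the value is arbitrary; the solution in
  \<open>euler_limit_solution\<close> is set to the starting point on a null set that contains these
  outcomes.\<close>

definition euler_limit :: "real \<Rightarrow> 'w \<Rightarrow> real ^ 'd" where
  "euler_limit t \<omega> = lim (\<lambda>n. euler n t \<omega>)"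

text \<open>The scheme is the telescoping sum of the differences of consecutive levels, to which the
  Weierstrass test applies.\<close>

lemma euler_uniform_limit:
  "AE \<omega> in M. \<forall>T :: nat. uniform_limit {0..real T} (\<lambda>n t. euler n t \<omega>) (\<lambda>t. euler_limit t \<omega>) sequentially"
  using euler_close_dyadic W_continuous
proof eventually_elim
  case (elim \<omega>)
  show ?case
  proof
    fix T :: nat
    \<comment> \<open>The estimate at dyadic times extends to all times by continuity of the paths,
      at the price of a weak inequality.\<close>
    have close: "\<forall>\<^sub>F n in sequentially. \<forall>t\<in>{0..real T}. \<bar>euler n t \<omega> $ i - euler (Suc n) t \<omega> $ i\<bar> \<le> 2 * rate ^ n" for i
      using elim(1)[rule_format, of T i]
    proof eventually_elim
      case (elim n)
      show ?case
      proof
        fix t assume t: "t \<in> {0..real T}"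
        let ?t = "\<lambda>N. dyadic N (cell_index N t)"
        have t': "?t N \<in> {0..real T}" for N
          using cell_index(1)[of t N] t by simp
        have lim: "(\<lambda>N. euler n (?t N) \<omega> $ i) \<longlonglongrightarrow> euler n t \<omega> $ i" for n
        proof -
          have "?t \<longlonglongrightarrow> t" using t by (intro cell_index_tendsto) simp
          then have "(\<lambda>N. euler n (?t N) \<omega>) \<longlonglongrightarrow> euler n t \<omega>"
            using euler_continuous[OF \<open>continuous_on {0..} (\<lambda>t. W t \<omega>)\<close>, of T n] t t'
            by (auto simp: continuous_on_sequentially comp_def)
          then show ?thesis by (rule tendsto_vec_nth)
        qed
        have "(\<lambda>N. \<bar>euler n (?t N) \<omega> $ i - euler (Suc n) (?t N) \<omega> $ i\<bar>) \<longlonglongrightarrow> \<bar>euler n t \<omega> $ i - euler (Suc n) t \<omega> $ i\<bar>"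
          by (intro tendsto_intros lim)
        then show "\<bar>euler n t \<omega> $ i - euler (Suc n) t \<omega> $ i\<bar> \<le> 2 * rate ^ n"
        proof (rule LIMSEQ_le_const2)
          have "\<bar>euler n (?t N) \<omega> $ i - euler (Suc n) (?t N) \<omega> $ i\<bar> < 2 * rate ^ n" if "Suc n \<le> N" for N
            using elim that cell_index_le[of t T N] t by simp
          then show "\<exists>N0. \<forall>N\<ge>N0. \<bar>euler n (?t N) \<omega> $ i - euler (Suc n) (?t N) \<omega> $ i\<bar> \<le> 2 * rate ^ n"
            by (intro exI[of _ "Suc n"]) (auto intro: less_imp_le)
        qed
      qed
    qed
    let ?f = "\<lambda>n t. euler (Suc n) t \<omega> - euler n t \<omega>"
    let ?S = "\<lambda>t. suminf (\<lambda>n. ?f n t)"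
    have "uniform_limit {0..real T} (\<lambda>n t. \<Sum>k<n. ?f k t) ?S sequentially"
    proof (rule Weierstrass_m_test_ev)
      have "\<forall>\<^sub>F n in sequentially. \<forall>i. \<forall>t\<in>{0..real T}. \<bar>euler n t \<omega> $ i - euler (Suc n) t \<omega> $ i\<bar> \<le> 2 * rate ^ n"
        using close by (rule eventually_all_finite)
      then show "\<forall>\<^sub>F n in sequentially. \<forall>t\<in>{0..real T}. norm (?f n t) \<le> real CARD('d) * 2 * rate ^ n"
      proof eventually_elim
        case (elim n)
        show ?case
        proof
          fix t assume t: "t \<in> {0..real T}"
          have "norm (?f n t) \<le> (\<Sum>i\<in>UNIV. \<bar>?f n t $ i\<bar>)" by (rule norm_le_l1_cart)
          also have "\<dots> \<le> (\<Sum>i\<in>(UNIV :: 'd set). 2 * rate ^ n)"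
            using elim t by (intro sum_mono) (simp add: abs_minus_commute)
          finally show "norm (?f n t) \<le> real CARD('d) * 2 * rate ^ n" by simp
        qed
      qed
      show "summable (\<lambda>n. real CARD('d) * 2 * rate ^ n)"
        using rate by (intro summable_mult summable_geometric) simp
    qed
    then have u: "uniform_limit {0..real T} (\<lambda>n t. euler 0 t \<omega> + (\<Sum>k<n. ?f k t)) (\<lambda>t. euler 0 t \<omega> + ?S t) sequentially"
      by (intro uniform_limit_add uniform_limit_const)
    have eq: "euler 0 t \<omega> + (\<Sum>k<n. ?f k t) = euler n t \<omega>" for n t
      using sum_lessThan_telescope[of "\<lambda>n. euler n t \<omega>" n] by simp
    have lim: "uniform_limit {0..real T} (\<lambda>n t. euler n t \<omega>) (\<lambda>t. euler 0 t \<omega> + ?S t) sequentially"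
      using u unfolding eq .
    have eqL: "euler 0 t \<omega> + ?S t = euler_limit t \<omega>" if "t \<in> {0..real T}" for t
      unfolding euler_limit_def using tendsto_uniform_limitI[OF lim that] by (rule limI[symmetric])
    show "uniform_limit {0..real T} (\<lambda>n t. euler n t \<omega>) (\<lambda>t. euler_limit t \<omega>) sequentially"
      by (rule uniform_limit_cong'[THEN iffD1, OF refl eqL lim])
  qed
qed

end

section \<open>A barrier function\<close>

text \<open>This is \<open>exp (- arsinh z)\<close>: positive, convex and decreasing, close to 1 /
  (2 z) for large positive z and growing linearly on the other side of the face.\<close>

definition barrier :: "real \<Rightarrow> real" where
  "barrier z = sqrt (1 + z\<^sup>2) - z"

lemma abs_less_sqrt_1_plus: "\<bar>z\<bar> < sqrt (1 + z\<^sup>2)" for z :: real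
  by (rule real_less_rsqrt) simp

lemma abs_div_sqrt_1_plus: "\<bar>z / sqrt (1 + z\<^sup>2)\<bar> \<le> 1" for z :: real
proof -
  have "0 < sqrt (1 + z\<^sup>2)" using abs_less_sqrt_1_plus[of z] by linarith
  then show ?thesis
    using abs_less_sqrt_1_plus[of z] by (simp only: abs_divide abs_of_pos divide_le_eq_1_pos less_imp_le)
qed

lemma barrier_pos: "0 < barrier z"
  using abs_less_sqrt_1_plus[of z] by (simp add: barrier_def)

lemma barrier_eq_inverse: "barrier z = 1 / (sqrt (1 + z\<^sup>2) + z)"
proof -
  have "0 < sqrt (1 + z\<^sup>2) + z" using abs_less_sqrt_1_plus[of z] by linarith
  moreover have "(sqrt (1 + z\<^sup>2) - z) * (sqrt (1 + z\<^sup>2) + z) = 1"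
    by (simp add: algebra_simps power2_eq_square[symmetric])
  ultimately show ?thesis unfolding barrier_def by (simp add: field_simps)
qed

text \<open>Evaluated at the scaled distance of the starting point, this gives the factor \<epsilon>
  in the hitting probability.\<close>

lemma barrier_le_inverse: "0 < z \<Longrightarrow> barrier z \<le> 1 / z"
  unfolding barrier_eq_inverse by (intro divide_left_mono mult_pos_pos) (auto intro: add_nonneg_pos)

lemma sqrt_1_plus_derivative:
  "((\<lambda>z. sqrt (1 + z\<^sup>2)) has_real_derivative z / sqrt (1 + z\<^sup>2)) (at z)"
proof -
  have "0 < 1 + z\<^sup>2" by (simp add: add_pos_nonneg)
  then show ?thesis by (auto intro!: derivative_eq_intros simp: field_simps)
qed

lemma barrier_derivatives:
  "(barrier has_real_derivative z / sqrt (1 + z\<^sup>2) - 1) (at z)"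
  "((\<lambda>z. z / sqrt (1 + z\<^sup>2) - 1) has_real_derivative 1 / sqrt (1 + z\<^sup>2) ^ 3) (at z)"
  "((\<lambda>z. 1 / sqrt (1 + z\<^sup>2) ^ 3) has_real_derivative - 3 * z / sqrt (1 + z\<^sup>2) ^ 5) (at z)"
proof -
  let ?w = "sqrt (1 + z\<^sup>2)"
  have w: "0 < ?w" by (simp add: add_pos_nonneg)
  have w2: "?w * ?w = 1 + z * z" by (simp add: power2_eq_square)
  show "(barrier has_real_derivative z / ?w - 1) (at z)"
    unfolding barrier_def[abs_def] by (intro derivative_intros sqrt_1_plus_derivative)
  have "((\<lambda>z. z / sqrt (1 + z\<^sup>2) - 1) has_real_derivative (1 * ?w - z * (z / ?w)) / (?w * ?w) - 0) (at z)"
    using w by (intro DERIV_diff DERIV_divide DERIV_ident sqrt_1_plus_derivative DERIV_const) auto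
  also have "(1 * ?w - z * (z / ?w)) / (?w * ?w) - 0 = 1 / ?w ^ 3"
  proof -
    have "1 * ?w - z * (z / ?w) = (?w * ?w - z * z) / ?w" using w by (simp add: field_simps)
    also have "\<dots> = 1 / ?w" unfolding w2 by simp
    finally have eq: "1 * ?w - z * (z / ?w) = 1 / ?w" .
    have "(1 / x) / (x * x) - 0 = 1 / x ^ 3" for x :: real by (simp add: power3_eq_cube)
    then show ?thesis unfolding eq .
  qed
  finally show "((\<lambda>z. z / sqrt (1 + z\<^sup>2) - 1) has_real_derivative 1 / ?w ^ 3) (at z)" .
  have p: "((\<lambda>z. sqrt (1 + z\<^sup>2) ^ 3) has_real_derivative of_nat 3 * (z / ?w * ?w ^ (3 - Suc 0))) (at z)"
    by (rule DERIV_power[OF sqrt_1_plus_derivative])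
  have "((\<lambda>z. inverse (sqrt (1 + z\<^sup>2) ^ 3)) has_real_derivative
     - (inverse (?w ^ 3) * (of_nat 3 * (z / ?w * ?w ^ (3 - Suc 0))) * inverse (?w ^ 3))) (at z)"
    using w by (intro DERIV_inverse'[OF p]) simp
  also have "- (inverse (?w ^ 3) * (of_nat 3 * (z / ?w * ?w ^ (3 - Suc 0))) * inverse (?w ^ 3)) = - 3 * z / ?w ^ 5"
  proof -
    have "- (inverse (x ^ 3) * (of_nat 3 * (z / x * x ^ (3 - Suc 0))) * inverse (x ^ 3)) = - 3 * z / x ^ 5"
      if "0 < x" for x :: real
      using that by (simp add: field_simps eval_nat_numeral)
    then show ?thesis using w .
  qed
  finally show "((\<lambda>z. 1 / sqrt (1 + z\<^sup>2) ^ 3) has_real_derivative - 3 * z / ?w ^ 5) (at z)"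
    by (simp add: inverse_eq_divide)
qed

lemma barrier_antimono:
  assumes "x \<le> y"
  shows "barrier y \<le> barrier x"
proof (rule DERIV_nonpos_imp_nonincreasing[OF assms])
  fix z :: real
  have "z / sqrt (1 + z\<^sup>2) - 1 \<le> 0" using abs_div_sqrt_1_plus[of z] by linarith
  then show "\<exists>y. DERIV barrier z :> y \<and> y \<le> 0" using barrier_derivatives(1) by blast
qed

text \<open>With w for the square root, the third derivative is - 3 z / w ^ 5 and is bounded by 3,
  because the absolute value of z is below w and w is at least 1. The remainder thus has the
  constant 3 / 6.\<close>

lemma barrier_taylor:
  "barrier (z + \<delta>) \<le> barrier z + (z / sqrt (1 + z\<^sup>2) - 1) * \<delta> + 1 / sqrt (1 + z\<^sup>2) ^ 3 / 2 * \<delta>\<^sup>2 + \<bar>\<delta>\<bar> ^ 3 / 2"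
proof (cases "\<delta> = 0")
  case False
  define d where "d m = (if m = 0 then barrier else if m = 1 then (\<lambda>z. z / sqrt (1 + z\<^sup>2) - 1)
     else if m = 2 then (\<lambda>z. 1 / sqrt (1 + z\<^sup>2) ^ 3) else (\<lambda>z. - 3 * z / sqrt (1 + z\<^sup>2) ^ 5))" for m :: nat
  have "\<exists>t. (if z + \<delta> < z then z + \<delta> < t \<and> t < z else z < t \<and> t < z + \<delta>) \<and>
     barrier (z + \<delta>) = (\<Sum>m<3. (d m z / fact m) * (z + \<delta> - z) ^ m) + (d 3 t / fact 3) * (z + \<delta> - z) ^ 3"
  proof (rule Taylor[where a = "min z (z + \<delta>)" and b = "max z (z + \<delta>)"])
    show "\<forall>m t. m < 3 \<and> min z (z + \<delta>) \<le> t \<and> t \<le> max z (z + \<delta>) \<longrightarrow> DERIV (d m) t :> d (Suc m) t"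
    proof (intro allI impI)
      fix m :: nat and t assume "m < 3 \<and> min z (z + \<delta>) \<le> t \<and> t \<le> max z (z + \<delta>)"
      then have "m = 0 \<or> m = 1 \<or> m = 2" by auto
      then show "DERIV (d m) t :> d (Suc m) t"
        using barrier_derivatives[of t] by (auto simp: d_def)
    qed
  qed (use False in \<open>auto simp: d_def\<close>)
  then obtain t where t: "barrier (z + \<delta>) = (\<Sum>m<3. (d m z / fact m) * (z + \<delta> - z) ^ m) + (d 3 t / fact 3) * (z + \<delta> - z) ^ 3"
    by blast
  let ?w = "sqrt (1 + t\<^sup>2)"
  have w: "1 \<le> ?w" by simp
  have "\<bar>d 3 t\<bar> \<le> 3"
  proof -
    have "\<bar>t\<bar> \<le> ?w ^ 1" using abs_less_sqrt_1_plus[of t] by simp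
    also have "\<dots> \<le> ?w ^ 5" using w by (intro power_increasing) auto
    finally have "\<bar>t\<bar> / ?w ^ 5 \<le> 1"
      using zero_less_power[of ?w 5] w by (simp only: divide_le_eq_1_pos)
    then show ?thesis by (simp add: d_def abs_mult abs_divide)
  qed
  then have "\<bar>d 3 t / 6 * \<delta> ^ 3\<bar> \<le> 3 / 6 * \<bar>\<delta>\<bar> ^ 3"
    unfolding abs_mult power_abs by (intro mult_right_mono) auto
  then have "d 3 t / 6 * \<delta> ^ 3 \<le> \<bar>\<delta>\<bar> ^ 3 / 2" by linarith
  then show ?thesis unfolding t
    by (simp add: d_def numeral_3_eq_3 lessThan_Suc fact_numeral power2_eq_square)
qed simp

text \<open>With w for the square root, 1 - z / w is the barrier divided by w, and the positive part
  of z is at most w.\<close>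

lemma barrier_drift: "max 0 z * (1 - z / sqrt (1 + z\<^sup>2)) \<le> barrier z"
proof -
  let ?w = "sqrt (1 + z\<^sup>2)"
  have w: "0 < ?w" by (simp add: add_pos_nonneg)
  have "1 - z / ?w = barrier z / ?w" using w by (simp add: barrier_def diff_divide_distrib)
  moreover have "max 0 z * (barrier z / ?w) \<le> ?w * (barrier z / ?w)"
    using w abs_less_sqrt_1_plus[of z] barrier_pos[of z] by (intro mult_right_mono) auto
  ultimately show ?thesis using w by simp
qed

text \<open>For positive z, replacing z by the square root w in the numerator leaves 1 / (2 w),
  which is at most 1 / (w + z), and this is the barrier.\<close>

lemma barrier_diffusion: "1 / sqrt (1 + z\<^sup>2) ^ 3 / 2 * (max 0 z)\<^sup>2 \<le> barrier z"
proof (cases "0 < z")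
  case True
  let ?w = "sqrt (1 + z\<^sup>2)"
  have w: "0 < ?w" "z < ?w" using abs_less_sqrt_1_plus[of z] by (auto simp: add_pos_nonneg)
  have "1 / ?w ^ 3 / 2 * z\<^sup>2 \<le> 1 / ?w ^ 3 / 2 * ?w\<^sup>2"
    using w True by (intro mult_left_mono power_mono) auto
  also have "\<dots> = 1 / (?w + ?w)" using w by (simp add: power3_eq_cube power2_eq_square)
  also have "\<dots> \<le> barrier z" unfolding barrier_eq_inverse
    using w True by (intro divide_left_mono mult_pos_pos) auto
  finally show ?thesis using True by (simp only: max.absorb2 less_imp_le)
next
  case False
  then have "max 0 z = 0" by simp
  then show ?thesis using less_imp_le[OF barrier_pos[of z]] by simp
qed

text \<open>Replaces the absolute third moment by even ones. For an increment \<open>x\<close> over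
  a step of length \<open>h\<close> and \<open>r = sqrt h\<close>, both terms on the right have mean
  of order \<open>h * sqrt h\<close>.\<close>

lemma abs_cube_le:
  fixes x r :: real
  assumes "0 < r"
  shows "\<bar>x\<bar> ^ 3 \<le> (r * x\<^sup>2 + x ^ 4 / r) / 2"
proof -
  have "0 \<le> x\<^sup>2 * (r - \<bar>x\<bar>)\<^sup>2 / r" using assms by simp
  also have "x\<^sup>2 * (r - \<bar>x\<bar>)\<^sup>2 / r = r * x\<^sup>2 + x ^ 4 / r - 2 * \<bar>x\<bar> ^ 3"
  proof -
    have "x\<^sup>2 * (r - \<bar>x\<bar>)\<^sup>2 = r * r * x\<^sup>2 + \<bar>x\<bar> ^ 4 - 2 * r * \<bar>x\<bar> ^ 3"
      unfolding power2_abs[of x, symmetric] by (simp add: power2_eq_square power3_eq_cube power4_eq_xxxx algebra_simps)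
    then show ?thesis using assms by (simp add: diff_divide_distrib add_divide_distrib)
  qed
  finally show ?thesis by simp
qed

text \<open>Taylor expansion for one Euler step, sorted by powers of the increment \<open>x\<close>
  so that each coefficient is known before the step. The second-order term in
  \<open>\<gamma>\<^sup>2\<close> is kept exactly, because \<open>barrier_diffusion\<close> is to
  absorb it; the cubic remainder goes into the even powers.\<close>

lemma barrier_step:
  fixes \<zeta> \<beta> \<gamma> h x D K r :: real
  defines "w \<equiv> sqrt (1 + \<zeta>\<^sup>2)"
  assumes "0 \<le> h" "0 < r" "\<bar>\<beta>\<bar> \<le> D" "\<bar>\<gamma>\<bar> \<le> D" "- K * max 0 \<zeta> \<le> \<beta>" "0 \<le> K"
  shows "barrier (\<zeta> + (\<beta> * h + \<gamma> * x)) \<le> (1 + K * h) * barrier \<zeta> + (D\<^sup>2 * h\<^sup>2 + 2 * D ^ 3 * h ^ 3) +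
     ((\<zeta> / w - 1) * \<gamma> + 1 / w ^ 3 * \<beta> * \<gamma> * h) * x + (1 / w ^ 3 / 2 * \<gamma>\<^sup>2 + D ^ 3 * r) * x\<^sup>2 + D ^ 3 / r * x ^ 4"
proof -
  let ?\<delta> = "\<beta> * h + \<gamma> * x"
  have D: "0 \<le> D" using assms(4) by linarith
  have w: "1 \<le> w" unfolding w_def by simp
  have neg: "\<zeta> / w - 1 \<le> 0"
    using abs_div_sqrt_1_plus[of \<zeta>] unfolding w_def by linarith
  have A: "(\<zeta> / w - 1) * (\<beta> * h) \<le> K * h * barrier \<zeta>"
  proof -
    \<comment> \<open>The derivative of the barrier is nonpositive, so a lower bound on the drift
      becomes an upper bound on this term.\<close>
    have "(\<zeta> / w - 1) * \<beta> \<le> (\<zeta> / w - 1) * (- K * max 0 \<zeta>)"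
      using neg assms(6) by (intro mult_left_mono_neg)
    also have "\<dots> = K * (max 0 \<zeta> * (1 - \<zeta> / w))" by (simp add: algebra_simps)
    also have "\<dots> \<le> K * barrier \<zeta>" unfolding w_def by (intro mult_left_mono barrier_drift assms(7))
    finally have "(\<zeta> / w - 1) * \<beta> * h \<le> K * barrier \<zeta> * h" using assms(2) by (rule mult_right_mono)
    then show ?thesis by (simp add: mult_ac)
  qed
  let ?v1 = "\<zeta> / w - 1" and ?v2 = "1 / w ^ 3"
  have v2: "0 \<le> ?v2" "?v2 \<le> 1" using w by (auto simp: divide_le_eq_1 one_le_power)
  have B: "?v2 / 2 * ?\<delta>\<^sup>2 \<le> D\<^sup>2 * h\<^sup>2 + ?v2 * \<beta> * \<gamma> * h * x + ?v2 / 2 * \<gamma>\<^sup>2 * x\<^sup>2"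
  proof -
    have "\<beta>\<^sup>2 \<le> D\<^sup>2" using power_mono[OF assms(4) abs_ge_zero, of 2] by simp
    then have "?v2 / 2 * (\<beta>\<^sup>2 * h\<^sup>2) \<le> 1 * (D\<^sup>2 * h\<^sup>2)"
      using v2 by (intro mult_mono mult_right_mono) auto
    moreover have "?v2 / 2 * ?\<delta>\<^sup>2 = ?v2 / 2 * (\<beta>\<^sup>2 * h\<^sup>2) + ?v2 * \<beta> * \<gamma> * h * x + ?v2 / 2 * \<gamma>\<^sup>2 * x\<^sup>2"
      by (simp add: power2_sum power_mult_distrib distrib_left mult_ac add_ac)
    ultimately show ?thesis by simp
  qed
  have C: "\<bar>?\<delta>\<bar> ^ 3 / 2 \<le> 2 * D ^ 3 * h ^ 3 + D ^ 3 * r * x\<^sup>2 + D ^ 3 / r * x ^ 4"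
  proof -
    have "\<bar>?\<delta>\<bar> \<le> \<bar>\<beta>\<bar> * h + \<bar>\<gamma>\<bar> * \<bar>x\<bar>"
      using abs_triangle_ineq[of "\<beta> * h" "\<gamma> * x"] assms(2) by (simp add: abs_mult)
    also have "\<dots> \<le> D * h + D * \<bar>x\<bar>"
      using assms by (intro add_mono mult_right_mono) auto
    finally have "\<bar>?\<delta>\<bar> ^ 3 \<le> (D * (h + \<bar>x\<bar>)) ^ 3" by (intro power_mono) (auto simp: distrib_left)
    also have "\<dots> = D ^ 3 * (h + \<bar>x\<bar>) ^ 3" by (rule power_mult_distrib)
    also have "\<dots> \<le> D ^ 3 * (4 * (h ^ 3 + \<bar>x\<bar> ^ 3))"
    proof (rule mult_left_mono)
      have "0 \<le> 3 * ((h + \<bar>x\<bar>) * (h - \<bar>x\<bar>)\<^sup>2)" using assms(2) by simp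
      then show "(h + \<bar>x\<bar>) ^ 3 \<le> 4 * (h ^ 3 + \<bar>x\<bar> ^ 3)"
        by (simp add: power3_eq_cube power2_eq_square algebra_simps)
    qed (use D in simp)
    finally have 1: "\<bar>?\<delta>\<bar> ^ 3 / 2 \<le> 2 * D ^ 3 * h ^ 3 + 2 * D ^ 3 * \<bar>x\<bar> ^ 3" by (simp add: algebra_simps)
    have "2 * D ^ 3 * \<bar>x\<bar> ^ 3 \<le> 2 * D ^ 3 * ((r * x\<^sup>2 + x ^ 4 / r) / 2)"
      using D by (intro mult_left_mono abs_cube_le assms(3)) simp
    also have "\<dots> = D ^ 3 * r * x\<^sup>2 + D ^ 3 / r * x ^ 4" by (simp add: distrib_left)
    finally show ?thesis using 1 by linarith
  qed
  have "barrier (\<zeta> + ?\<delta>) \<le> barrier \<zeta> + ?v1 * ?\<delta> + ?v2 / 2 * ?\<delta>\<^sup>2 + \<bar>?\<delta>\<bar> ^ 3 / 2"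
    unfolding w_def by (rule barrier_taylor)
  moreover have "?v1 * ?\<delta> = ?v1 * (\<beta> * h) + ?v1 * \<gamma> * x" by (simp only: distrib_left mult.assoc)
  ultimately show ?thesis using A B C by (simp only: distrib_right mult_1)
qed

section \<open>Mean growth of the barrier function in one time step\<close>

context scalar_bm
begin

text \<open>The factor \<open>\<theta>\<close>, known at time \<open>s\<close>, will be the
  indicator that the scheme has not yet come close to the face. The growth rate consists of
  \<open>K\<close> from the drift and \<open>K\<^sup>2\<close> from the diffusion, and all else is
  of order \<open>h * sqrt h\<close>.\<close>

lemma barrier_expectation_step:
  fixes \<zeta> \<beta> \<gamma> \<theta> :: "'w \<Rightarrow> real"
  assumes st: "0 \<le> s" "s < t" "t - s \<le> 1"
    and meas: "\<zeta> \<in> borel_measurable (F s)" "\<beta> \<in> borel_measurable (F s)" "\<gamma> \<in> borel_measurable (F s)" "\<theta> \<in> borel_measurable (F s)"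
    and int: "integrable M (\<lambda>\<omega>. barrier (\<zeta> \<omega>))"
    and \<theta>: "\<And>\<omega>. 0 \<le> \<theta> \<omega> \<and> \<theta> \<omega> \<le> 1"
    and D: "\<And>\<omega>. \<bar>\<beta> \<omega>\<bar> \<le> D" "\<And>\<omega>. \<bar>\<gamma> \<omega>\<bar> \<le> D"
    and K: "0 \<le> K" "\<And>\<omega>. - K * max 0 (\<zeta> \<omega>) \<le> \<beta> \<omega>" "\<And>\<omega>. \<bar>\<gamma> \<omega>\<bar> \<le> K * max 0 (\<zeta> \<omega>)"
  defines "h \<equiv> t - s"
  defines "Y \<equiv> \<lambda>\<omega>. \<theta> \<omega> * barrier (\<zeta> \<omega> + (\<beta> \<omega> * h + \<gamma> \<omega> * (B t \<omega> - B s \<omega>)))"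
  shows "integrable M Y"
    and "expectation Y \<le> (1 + (K + K\<^sup>2) * h) * expectation (\<lambda>\<omega>. \<theta> \<omega> * barrier (\<zeta> \<omega>)) + (D\<^sup>2 + 6 * D ^ 3) * (h * sqrt h)"
proof -
  have h: "0 < h" "h \<le> 1" using st by (auto simp: h_def)
  have D0: "0 \<le> D" using order_trans[OF abs_ge_zero D(1)] .
  let ?r = "sqrt h" and ?\<Delta> = "\<lambda>\<omega>. B t \<omega> - B s \<omega>"
  let ?w = "\<lambda>\<omega>. sqrt (1 + (\<zeta> \<omega>)\<^sup>2)"
  \<comment> \<open>Coefficients of the powers 0, 1, 2 and 4 of the increment. They are known at
    time \<open>s\<close>, so their expectations factor; the linear term has mean zero.\<close>
  define c0 where "c0 \<omega> = \<theta> \<omega> * ((1 + K * h) * barrier (\<zeta> \<omega>) + (D\<^sup>2 * h\<^sup>2 + 2 * D ^ 3 * h ^ 3))" for \<omega>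
  define c1 where "c1 \<omega> = \<theta> \<omega> * ((\<zeta> \<omega> / ?w \<omega> - 1) * \<gamma> \<omega> + 1 / ?w \<omega> ^ 3 * \<beta> \<omega> * \<gamma> \<omega> * h)" for \<omega>
  define c2 where "c2 \<omega> = \<theta> \<omega> * (1 / ?w \<omega> ^ 3 / 2 * (\<gamma> \<omega>)\<^sup>2 + D ^ 3 * ?r)" for \<omega>
  define c4 where "c4 \<omega> = \<theta> \<omega> * (D ^ 3 / ?r)" for \<omega>
  note [measurable] = meas
  have cm: "c0 \<in> borel_measurable (F s)" "c1 \<in> borel_measurable (F s)" "c2 \<in> borel_measurable (F s)" "c4 \<in> borel_measurable (F s)"
    unfolding c0_def[abs_def] c1_def[abs_def] c2_def[abs_def] c4_def[abs_def] barrier_def by measurable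
  note cM = cm[THEN measurable_F_M, OF st(1)]
  note measM = meas[THEN measurable_F_M, OF st(1)]
  have v: "\<bar>\<zeta> \<omega> / ?w \<omega> - 1\<bar> \<le> 2" "0 \<le> 1 / ?w \<omega> ^ 3" "1 / ?w \<omega> ^ 3 \<le> 1" for \<omega>
  proof -
    have w: "1 \<le> ?w \<omega>" by simp
    have "1 \<le> ?w \<omega> ^ 3" using w by (rule one_le_power)
    then show "0 \<le> 1 / ?w \<omega> ^ 3" "1 / ?w \<omega> ^ 3 \<le> 1" by (simp_all only: zero_le_divide_1_iff divide_le_eq_1_pos)
    show "\<bar>\<zeta> \<omega> / ?w \<omega> - 1\<bar> \<le> 2" using abs_div_sqrt_1_plus[of "\<zeta> \<omega>"] by linarith
  qed
  have g2: "(\<gamma> \<omega>)\<^sup>2 \<le> D\<^sup>2" for \<omega> using power_mono[OF D(2) abs_ge_zero, of \<omega> 2] by simp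
  have i\<theta>: "integrable M (\<lambda>\<omega>. \<theta> \<omega> * barrier (\<zeta> \<omega>))"
  proof (rule Bochner_Integration.integrable_bound[OF int])
    show "AE \<omega> in M. norm (\<theta> \<omega> * barrier (\<zeta> \<omega>)) \<le> norm (barrier (\<zeta> \<omega>))"
      using \<theta> barrier_pos by (intro AE_I2) (simp add: abs_mult mult_left_le_one_le)
  qed (use measM in \<open>unfold barrier_def, measurable\<close>)
  have i\<theta>0: "integrable M \<theta>"
    using \<theta> measM(4) by (intro integrable_const_bound[where B = 1]) auto
  have i0: "integrable M c0"
    using i\<theta> i\<theta>0 unfolding c0_def[abs_def] distrib_left
    by (intro Bochner_Integration.integrable_add) (auto simp: mult.left_commute[of "\<theta> _"])
  have i1: "integrable M c1"
  proof (rule integrable_const_bound[where B = "2 * D + D * D * h"])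
    show "AE \<omega> in M. norm (c1 \<omega>) \<le> 2 * D + D * D * h"
    proof (rule AE_I2)
      fix \<omega>
      let ?x = "(\<zeta> \<omega> / ?w \<omega> - 1) * \<gamma> \<omega>" and ?y = "1 / ?w \<omega> ^ 3 * \<beta> \<omega> * \<gamma> \<omega> * h"
      have "\<bar>?x\<bar> \<le> 2 * D" unfolding abs_mult using v D by (intro mult_mono) auto
      moreover have "\<bar>?y\<bar> \<le> 1 * D * D * h"
        unfolding abs_mult using v(2,3)[of \<omega>] D h D0 by (intro mult_mono mult_nonneg_nonneg) auto
      ultimately have "\<bar>?x + ?y\<bar> \<le> 2 * D + 1 * D * D * h"
        by (rule order_trans[OF abs_triangle_ineq add_mono])
      then have "\<bar>?x + ?y\<bar> \<le> 2 * D + D * D * h" by (simp only: mult_1)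
      moreover have "\<bar>c1 \<omega>\<bar> \<le> 1 * \<bar>?x + ?y\<bar>"
        unfolding c1_def abs_mult[of "\<theta> \<omega>"] using \<theta>[of \<omega>] by (intro mult_right_mono) auto
      ultimately show "norm (c1 \<omega>) \<le> 2 * D + D * D * h" by (simp only: mult_1 real_norm_def)
    qed
  qed (rule cM)
  have i2: "integrable M c2"
  proof (rule integrable_const_bound[where B = "D\<^sup>2 + D ^ 3 * ?r"])
    show "AE \<omega> in M. norm (c2 \<omega>) \<le> D\<^sup>2 + D ^ 3 * ?r"
    proof (rule AE_I2)
      fix \<omega>
      let ?x = "1 / ?w \<omega> ^ 3 / 2 * (\<gamma> \<omega>)\<^sup>2"
      have x: "0 \<le> ?x" using v(2)[of \<omega>] by simp
      have "?x \<le> 1 * D\<^sup>2" using v(2,3)[of \<omega>] g2[of \<omega>] by (intro mult_mono) auto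
      moreover have "\<bar>c2 \<omega>\<bar> \<le> 1 * \<bar>?x + D ^ 3 * ?r\<bar>"
        unfolding c2_def abs_mult[of "\<theta> \<omega>"] using \<theta>[of \<omega>] by (intro mult_right_mono) auto
      moreover have "0 \<le> D ^ 3 * ?r" using D0 h by simp
      ultimately show "norm (c2 \<omega>) \<le> D\<^sup>2 + D ^ 3 * ?r" using x by simp
    qed
  qed (rule cM)
  have i4: "integrable M c4" unfolding c4_def[abs_def] using i\<theta>0 by simp
  let ?G = "\<lambda>\<omega>. c0 \<omega> + c1 \<omega> * ?\<Delta> \<omega> ^ 1 + c2 \<omega> * ?\<Delta> \<omega> ^ 2 + c4 \<omega> * ?\<Delta> \<omega> ^ 4"
  note m1 = expectation_mult_increment[OF st(1) less_imp_le[OF st(2)] cm(2) i1, of 1]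
  note m2 = expectation_mult_increment[OF st(1) less_imp_le[OF st(2)] cm(3) i2, of 2]
  note m4 = expectation_mult_increment[OF st(1) less_imp_le[OF st(2)] cm(4) i4, of 4]
  note mom = increment_moment(2-4)[OF st(1) less_imp_le[OF st(2)]]
  have iG: "integrable M ?G" using i0 m1(1) m2(1) m4(1) by (intro Bochner_Integration.integrable_add)
  have le: "Y \<omega> \<le> ?G \<omega>" for \<omega>
  proof -
    have "barrier (\<zeta> \<omega> + (\<beta> \<omega> * h + \<gamma> \<omega> * ?\<Delta> \<omega>)) \<le> (1 + K * h) * barrier (\<zeta> \<omega>) + (D\<^sup>2 * h\<^sup>2 + 2 * D ^ 3 * h ^ 3) +
       ((\<zeta> \<omega> / ?w \<omega> - 1) * \<gamma> \<omega> + 1 / ?w \<omega> ^ 3 * \<beta> \<omega> * \<gamma> \<omega> * h) * ?\<Delta> \<omega> +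
       (1 / ?w \<omega> ^ 3 / 2 * (\<gamma> \<omega>)\<^sup>2 + D ^ 3 * ?r) * (?\<Delta> \<omega>)\<^sup>2 + D ^ 3 / ?r * ?\<Delta> \<omega> ^ 4"
      using h by (intro barrier_step D K) auto
    from mult_left_mono[OF this conjunct1[OF \<theta>[of \<omega>]]] have "Y \<omega> \<le> \<theta> \<omega> * \<dots>" unfolding Y_def .
    moreover have "\<theta>' * (a0 + a1 * x + a2 * x\<^sup>2 + a4 * x ^ 4) =
        \<theta>' * a0 + \<theta>' * a1 * x ^ 1 + \<theta>' * a2 * x ^ 2 + \<theta>' * a4 * x ^ 4" for \<theta>' a0 a1 a2 a4 x :: real
      by (simp add: distrib_left)
    ultimately show ?thesis unfolding c0_def c1_def c2_def c4_def by (simp only:)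
  qed
  have Y0: "0 \<le> Y \<omega>" for \<omega> unfolding Y_def using \<theta>[of \<omega>] barrier_pos by (intro mult_nonneg_nonneg) (auto intro: less_imp_le)
  have [measurable]: "B t \<in> borel_measurable M" "B s \<in> borel_measurable M"
    using B_measurable_M st by auto
  show iY: "integrable M Y"
  proof (rule Bochner_Integration.integrable_bound[OF iG])
    show "Y \<in> borel_measurable M" unfolding Y_def barrier_def using measM by measurable
    show "AE \<omega> in M. norm (Y \<omega>) \<le> norm (?G \<omega>)"
      unfolding real_norm_def abs_of_nonneg[OF Y0] by (intro AE_I2 order_trans[OF le abs_ge_self])
  qed
  have "expectation Y \<le> expectation ?G" by (rule integral_mono[OF iY iG le])
  also have "\<dots> = expectation c0 + expectation (\<lambda>\<omega>. c1 \<omega> * ?\<Delta> \<omega> ^ 1) + expectation (\<lambda>\<omega>. c2 \<omega> * ?\<Delta> \<omega> ^ 2) + expectation (\<lambda>\<omega>. c4 \<omega> * ?\<Delta> \<omega> ^ 4)"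
    using i0 m1(1) m2(1) m4(1)
    by (subst Bochner_Integration.integral_add, simp_all only: Bochner_Integration.integrable_add)+
  also have "\<dots> = expectation c0 + expectation c2 * h + expectation c4 * (3 * h\<^sup>2)"
    unfolding m1(2) m2(2) m4(2) using mom by (simp add: h_def)
  also have "\<dots> \<le> ((1 + K * h) * expectation (\<lambda>\<omega>. \<theta> \<omega> * barrier (\<zeta> \<omega>)) + (D\<^sup>2 * h\<^sup>2 + 2 * D ^ 3 * h ^ 3)) +
     (K\<^sup>2 * expectation (\<lambda>\<omega>. \<theta> \<omega> * barrier (\<zeta> \<omega>)) + D ^ 3 * ?r) * h + D ^ 3 / ?r * (3 * h\<^sup>2)"
  proof (intro add_mono mult_right_mono)
    have "expectation c0 \<le> expectation (\<lambda>\<omega>. (1 + K * h) * (\<theta> \<omega> * barrier (\<zeta> \<omega>)) + (D\<^sup>2 * h\<^sup>2 + 2 * D ^ 3 * h ^ 3))"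
    proof (rule integral_mono[OF i0])
      show "integrable M (\<lambda>\<omega>. (1 + K * h) * (\<theta> \<omega> * barrier (\<zeta> \<omega>)) + (D\<^sup>2 * h\<^sup>2 + 2 * D ^ 3 * h ^ 3))"
        using i\<theta> by simp
      fix \<omega>
      have "\<theta> \<omega> * (D\<^sup>2 * h\<^sup>2 + 2 * D ^ 3 * h ^ 3) \<le> 1 * (D\<^sup>2 * h\<^sup>2 + 2 * D ^ 3 * h ^ 3)"
        using \<theta>[of \<omega>] D0 h by (intro mult_right_mono) auto
      then show "c0 \<omega> \<le> (1 + K * h) * (\<theta> \<omega> * barrier (\<zeta> \<omega>)) + (D\<^sup>2 * h\<^sup>2 + 2 * D ^ 3 * h ^ 3)"
        unfolding c0_def by (simp only: distrib_left[of "\<theta> \<omega>"] mult.left_commute[of "\<theta> \<omega>"] mult_1)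
    qed
    also have "\<dots> = (1 + K * h) * expectation (\<lambda>\<omega>. \<theta> \<omega> * barrier (\<zeta> \<omega>)) + (D\<^sup>2 * h\<^sup>2 + 2 * D ^ 3 * h ^ 3)"
      using i\<theta> by (subst Bochner_Integration.integral_add) (auto simp: prob_space)
    finally show "expectation c0 \<le> (1 + K * h) * expectation (\<lambda>\<omega>. \<theta> \<omega> * barrier (\<zeta> \<omega>)) + (D\<^sup>2 * h\<^sup>2 + 2 * D ^ 3 * h ^ 3)" .
    have "expectation c2 \<le> expectation (\<lambda>\<omega>. K\<^sup>2 * (\<theta> \<omega> * barrier (\<zeta> \<omega>)) + D ^ 3 * ?r)"
    proof (rule integral_mono[OF i2])
      show "integrable M (\<lambda>\<omega>. K\<^sup>2 * (\<theta> \<omega> * barrier (\<zeta> \<omega>)) + D ^ 3 * ?r)" using i\<theta> by simp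
      fix \<omega>
      have "(\<gamma> \<omega>)\<^sup>2 \<le> K\<^sup>2 * (max 0 (\<zeta> \<omega>))\<^sup>2"
        using power_mono[OF K(3) abs_ge_zero, of \<omega> 2] by (simp add: power_mult_distrib)
      then have "1 / ?w \<omega> ^ 3 / 2 * (\<gamma> \<omega>)\<^sup>2 \<le> 1 / ?w \<omega> ^ 3 / 2 * (K\<^sup>2 * (max 0 (\<zeta> \<omega>))\<^sup>2)"
        using v(2)[of \<omega>] by (intro mult_left_mono) auto
      also have "\<dots> = K\<^sup>2 * (1 / ?w \<omega> ^ 3 / 2 * (max 0 (\<zeta> \<omega>))\<^sup>2)" by (rule mult.left_commute)
      also have "\<dots> \<le> K\<^sup>2 * barrier (\<zeta> \<omega>)" by (intro mult_left_mono barrier_diffusion) simp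
      finally have "\<theta> \<omega> * (1 / ?w \<omega> ^ 3 / 2 * (\<gamma> \<omega>)\<^sup>2) \<le> \<theta> \<omega> * (K\<^sup>2 * barrier (\<zeta> \<omega>))"
        using \<theta>[of \<omega>] by (intro mult_left_mono) auto
      moreover have "\<theta> \<omega> * (D ^ 3 * ?r) \<le> 1 * (D ^ 3 * ?r)"
        using \<theta>[of \<omega>] D0 h by (intro mult_right_mono) auto
      ultimately show "c2 \<omega> \<le> K\<^sup>2 * (\<theta> \<omega> * barrier (\<zeta> \<omega>)) + D ^ 3 * ?r"
        unfolding c2_def distrib_left[of "\<theta> \<omega>"] mult.left_commute[of "K\<^sup>2"] by linarith
    qed
    also have "\<dots> = K\<^sup>2 * expectation (\<lambda>\<omega>. \<theta> \<omega> * barrier (\<zeta> \<omega>)) + D ^ 3 * ?r"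
      using i\<theta> by (subst Bochner_Integration.integral_add) (auto simp: prob_space)
    finally show "expectation c2 \<le> K\<^sup>2 * expectation (\<lambda>\<omega>. \<theta> \<omega> * barrier (\<zeta> \<omega>)) + D ^ 3 * ?r" .
    have "expectation c4 \<le> expectation (\<lambda>\<omega>. D ^ 3 / ?r)"
    proof (rule integral_mono[OF i4])
      show "c4 \<omega> \<le> D ^ 3 / ?r" for \<omega>
        unfolding c4_def using mult_right_mono[of "\<theta> \<omega>" 1 "D ^ 3 / ?r"] \<theta>[of \<omega>] D0 h by simp
    qed simp
    then show "expectation c4 \<le> D ^ 3 / ?r" by (simp add: prob_space)
  qed (use h in auto)
  also have "\<dots> = (1 + (K + K\<^sup>2) * h) * expectation (\<lambda>\<omega>. \<theta> \<omega> * barrier (\<zeta> \<omega>)) +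
     (D\<^sup>2 * h\<^sup>2 + 2 * D ^ 3 * h ^ 3 + D ^ 3 * (h * ?r) + 3 * D ^ 3 * (h\<^sup>2 / ?r))"
    by (simp add: algebra_simps)
  \<comment> \<open>Since \<open>h \<le> 1\<close>, every error is at most its coefficient times
    \<open>h * sqrt h\<close>; the coefficients 2, 1 and 3 of \<open>D ^ 3\<close> add up to
    6.\<close>
  also have "\<dots> \<le> (1 + (K + K\<^sup>2) * h) * expectation (\<lambda>\<omega>. \<theta> \<omega> * barrier (\<zeta> \<omega>)) + (D\<^sup>2 + 6 * D ^ 3) * (h * ?r)"
  proof (rule add_left_mono)
    have hr: "h = ?r * ?r" using h by simp
    have r1: "?r \<le> 1" "0 < ?r" using h by auto
    have e1: "h\<^sup>2 \<le> h * ?r"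
    proof -
      have "?r * ?r \<le> 1 * ?r" using r1 by (intro mult_right_mono) auto
      then show ?thesis using h by (simp add: power2_eq_square)
    qed
    have e2: "h ^ 3 \<le> h * ?r"
    proof -
      have "h ^ 3 \<le> h ^ 2" using h by (intro power_decreasing) auto
      with e1 show ?thesis by simp
    qed
    have e3: "h\<^sup>2 / ?r = h * ?r"
      using r1 hr by (simp add: power2_eq_square field_simps)
    have "D\<^sup>2 * h\<^sup>2 \<le> D\<^sup>2 * (h * ?r)" "2 * D ^ 3 * h ^ 3 \<le> 2 * D ^ 3 * (h * ?r)"
      using e1 e2 D0 by (intro mult_left_mono; simp)+
    then show "D\<^sup>2 * h\<^sup>2 + 2 * D ^ 3 * h ^ 3 + D ^ 3 * (h * ?r) + 3 * D ^ 3 * (h\<^sup>2 / ?r) \<le> (D\<^sup>2 + 6 * D ^ 3) * (h * ?r)"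
      unfolding e3 by (simp only: distrib_right)
  qed
  finally show "expectation Y \<le> (1 + (K + K\<^sup>2) * h) * expectation (\<lambda>\<omega>. \<theta> \<omega> * barrier (\<zeta> \<omega>)) + (D\<^sup>2 + 6 * D ^ 3) * (h * sqrt h)" .
qed

end

section \<open>The limit of the scheme stays in the interior\<close>

primrec stopped_barrier :: "(nat \<Rightarrow> real) \<Rightarrow> nat \<Rightarrow> real" where
  "stopped_barrier z 0 = barrier (z 0)"
| "stopped_barrier z (Suc j) = (if \<exists>i\<le>j. z i \<le> 1 then stopped_barrier z j else barrier (z (Suc j)))"

lemma stopped_barrier_pos: "0 < stopped_barrier z j"
  by (induction j) (auto simp: barrier_pos)

lemma stopped_barrier_alive: "\<not> (\<exists>i\<le>j. z i \<le> 1) \<Longrightarrow> stopped_barrier z j = barrier (z j)"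
  by (cases j) auto

lemma stopped_barrier_hit: "\<exists>i\<le>j. z i \<le> 1 \<Longrightarrow> barrier 1 \<le> stopped_barrier z j"
proof (induction j)
  case 0
  then show ?case by (simp add: barrier_antimono)
next
  case (Suc j)
  show ?case
  proof (cases "\<exists>i\<le>j. z i \<le> 1")
    case True
    then show ?thesis using Suc.IH by simp
  next
    case False
    then have "z (Suc j) \<le> 1" using Suc.prems le_Suc_eq by auto
    moreover have "stopped_barrier z (Suc j) = barrier (z (Suc j))"
      using False by (simp only: stopped_barrier.simps if_False)
    ultimately show ?thesis by (simp add: barrier_antimono del: stopped_barrier.simps)
  qed
qed

lemma affine_recursion_le:
  fixes u :: "nat \<Rightarrow> real"
  assumes "0 \<le> a" "0 \<le> e" "0 \<le> u 0" "\<And>j. u (Suc j) \<le> (1 + a) * u j + e"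
  shows "u k \<le> (u 0 + real k * e) * (1 + a) ^ k"
proof (induction k)
  case (Suc k)
  have "u (Suc k) \<le> (1 + a) * u k + e" by (rule assms(4))
  also have "\<dots> \<le> (1 + a) * ((u 0 + real k * e) * (1 + a) ^ k) + e * (1 + a) ^ Suc k"
  proof (rule add_mono)
    show "(1 + a) * u k \<le> (1 + a) * ((u 0 + real k * e) * (1 + a) ^ k)"
      using Suc assms(1) by (intro mult_left_mono) auto
    have "1 \<le> (1 + a) ^ Suc k" using assms(1) by (intro one_le_power) simp
    then show "e \<le> e * (1 + a) ^ Suc k" using assms(2) mult_left_mono[of 1 "(1 + a) ^ Suc k" e] by simp
  qed
  also have "\<dots> = (u 0 + real (Suc k) * e) * (1 + a) ^ Suc k" by (simp add: algebra_simps)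
  finally show ?case .
qed simp

text \<open>Fatou's lemma for sets: the union over \<open>N\<close> consists of the outcomes that
  lie in all but finitely many of the events.\<close>

lemma (in prob_space) prob_liminf_le:
  assumes A[measurable]: "\<And>n. A n \<in> events" and "\<And>n. prob (A n) \<le> p n" "p \<longlonglongrightarrow> p'"
  shows "(\<Union>N. \<Inter>n. A (N + n)) \<in> events" "prob (\<Union>N. \<Inter>n. A (N + n)) \<le> p'"
proof -
  show "(\<Union>N. \<Inter>n. A (N + n)) \<in> events" by measurable
  have le: "prob (\<Inter>n. A (N + n)) \<le> p'" for N
  proof (rule LIMSEQ_le_const[OF assms(3)])
    have "prob (\<Inter>n. A (N + n)) \<le> p (N + n)" for n
      by (rule order_trans[OF finite_measure_mono assms(2)]) auto
    then show "\<exists>N'. \<forall>n\<ge>N'. prob (\<Inter>n. A (N + n)) \<le> p n"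
      by (intro exI[of _ N]) (auto simp: le_iff_add)
  qed
  have "incseq (\<lambda>N. \<Inter>n. A (N + n))"
  proof (rule incseq_SucI, rule subsetI)
    fix N x assume x: "x \<in> (\<Inter>n. A (N + n))"
    have "x \<in> A (Suc N + n)" for n using INT_D[OF x, of "Suc n"] by simp
    then show "x \<in> (\<Inter>n. A (Suc N + n))" by blast
  qed
  moreover have "range (\<lambda>N. \<Inter>n. A (N + n)) \<subseteq> events" by (auto intro!: sets.countable_INT')
  ultimately have "(\<lambda>N. prob (\<Inter>n. A (N + n))) \<longlonglongrightarrow> prob (\<Union>N. \<Inter>n. A (N + n))"
    by (intro finite_Lim_measure_incseq)
  then show "prob (\<Union>N. \<Inter>n. A (N + n)) \<le> p'"
    by (rule LIMSEQ_le_const2) (intro exI allI impI le)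
qed

context euler_scheme
begin

lemma euler_limit_continuous:
  assumes "uniform_limit {0..real T} (\<lambda>n t. euler n t \<omega>) (\<lambda>t. euler_limit t \<omega>) sequentially"
    and "continuous_on {0..} (\<lambda>t. W t \<omega>)"
  shows "continuous_on {0..real T} (\<lambda>t. euler_limit t \<omega>)"
  by (rule uniform_limit_theorem[OF always_eventually assms(1)]) (simp_all add: euler_continuous[OF assms(2)])

text \<open>Uniform convergence and continuity of the limit allow the time to move with the level.
  Applied to grid times next to \<open>t\<close>, this gives convergence of the nodes.\<close>

lemma euler_diagonal_tendsto:
  assumes ul: "\<forall>T :: nat. uniform_limit {0..real T} (\<lambda>n t. euler n t \<omega>) (\<lambda>t. euler_limit t \<omega>) sequentially"
    and W: "continuous_on {0..} (\<lambda>t. W t \<omega>)"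
    and s: "\<And>n. 0 \<le> s n" "s \<longlonglongrightarrow> t"
  shows "(\<lambda>n. euler n (s n) \<omega>) \<longlonglongrightarrow> euler_limit t \<omega>"
proof -
  obtain c where c: "\<And>n. norm (s n) \<le> c"
    using Bseq_eq_bounded[of s] convergent_imp_Bseq[OF convergentI[OF s(2)]] unfolding Bseq_def by auto
  obtain T :: nat where T: "c \<le> real T" using real_arch_simple by blast
  have sn: "s n \<in> {0..real T}" for n using s(1)[of n] c[of n] T by auto
  then have t: "t \<in> {0..real T}" using closed_sequentially[OF closed_atLeastAtMost _ s(2)] by blast
  note u = ul[rule_format, of T]
  have "(\<lambda>n. euler_limit (s n) \<omega>) \<longlonglongrightarrow> euler_limit t \<omega>"
    using euler_limit_continuous[OF u W] sn t s(2) by (auto simp: continuous_on_sequentially comp_def)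
  moreover have "(\<lambda>n. euler n (s n) \<omega> - euler_limit (s n) \<omega>) \<longlonglongrightarrow> 0"
  proof (rule metric_LIMSEQ_I)
    fix r :: real assume "0 < r"
    from uniform_limitD[OF u this] obtain N where
      N: "\<And>n x. N \<le> n \<Longrightarrow> x \<in> {0..real T} \<Longrightarrow> dist (euler n x \<omega>) (euler_limit x \<omega>) < r"
      unfolding eventually_sequentially by blast
    have "dist (euler n (s n) \<omega> - euler_limit (s n) \<omega>) 0 < r" if "N \<le> n" for n
      using N[OF that sn] by (simp only: dist_norm diff_zero)
    then show "\<exists>no. \<forall>n\<ge>no. dist (euler n (s n) \<omega> - euler_limit (s n) \<omega>) 0 < r" by blast
  qed
  ultimately have "(\<lambda>n. (euler n (s n) \<omega> - euler_limit (s n) \<omega>) + euler_limit (s n) \<omega>) \<longlonglongrightarrow> 0 + euler_limit t \<omega>"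
    by (intro tendsto_add)
  then show ?thesis by simp
qed

lemma node_component_integrable: "integrable M (\<lambda>\<omega>. node n k \<omega> $ i)"
proof (induction k)
  case (Suc k)
  interpret B: scalar_bm M F "\<lambda>t \<omega>. W t \<omega> $ i" by (rule bm)
  have nF: "node n k \<in> borel_measurable (F (dyadic n k))"
    by (rule node_measurable[OF _ order_refl]) (rule W_measurable)
  have \<sigma>F: "(\<lambda>\<omega>. \<sigma> (node n k \<omega>) $ i) \<in> borel_measurable (F (dyadic n k))"
    and bF: "(\<lambda>\<omega>. b (node n k \<omega>) $ i) \<in> borel_measurable (F (dyadic n k))"
    by (rule measurable_compose[OF nF \<sigma>_measurable] measurable_compose[OF nF b_measurable])+
  have \<sigma>i: "integrable M (\<lambda>\<omega>. \<sigma> (node n k \<omega>) $ i)" and bi: "integrable M (\<lambda>\<omega>. b (node n k \<omega>) $ i)"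
    using \<sigma>_bound b_bound F_imp_M[OF \<sigma>F] F_imp_M[OF bF] by (auto intro!: integrable_const_bound[where B = C])
  have "integrable M (\<lambda>\<omega>. \<sigma> (node n k \<omega>) $ i * (W (dyadic n (Suc k)) \<omega> $ i - W (dyadic n k) \<omega> $ i) ^ 1)"
    by (rule B.expectation_mult_increment(1)[OF _ _ \<sigma>F \<sigma>i]) simp_all
  then show ?case using Suc bi by simp
qed simp

text \<open>The sign \<open>s\<close> selects the side: 1 for a lower face at \<open>c\<close>, - 1
  for an upper one. Dividing the distance by \<epsilon> leaves \<open>\<kappa>\<close> unchanged,
  since both bounds are homogeneous in the distance, and turns \<open>C\<close> into
  \<open>C / \<epsilon>\<close>, which affects only the error terms. Markov's inequality for the
  stopped barrier concludes.\<close>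

lemma barrier_hit_prob:
  fixes n k :: nat and i :: 'd and s c \<epsilon> \<kappa> :: real
  assumes s: "s = 1 \<or> s = - 1" and \<epsilon>: "0 < \<epsilon>" and \<kappa>: "0 \<le> \<kappa>"
    and drift: "\<And>x. - \<kappa> * max 0 (s * (x $ i - c)) \<le> s * b x $ i"
    and diffusion: "\<And>x. \<bar>\<sigma> x $ i\<bar> \<le> \<kappa> * max 0 (s * (x $ i - c))"
  defines "h \<equiv> 1 / 2 ^ n"
  shows "{\<omega>\<in>space M. \<exists>j\<le>k. s * (node n j \<omega> $ i - c) \<le> \<epsilon>} \<in> events"
    and "prob {\<omega>\<in>space M. \<exists>j\<le>k. s * (node n j \<omega> $ i - c) \<le> \<epsilon>} \<le>
      (barrier (s * (x\<^sub>0 $ i - c) / \<epsilon>) + real k * (((C / \<epsilon>)\<^sup>2 + 6 * (C / \<epsilon>) ^ 3) * (h * sqrt h))) *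
      (1 + (\<kappa> + \<kappa>\<^sup>2) * h) ^ k / barrier 1"
proof -
  interpret B: scalar_bm M F "\<lambda>t \<omega>. W t \<omega> $ i" by (rule bm)
  define \<zeta> where "\<zeta> j \<omega> = s * (node n j \<omega> $ i - c) / \<epsilon>" for j \<omega>
  define \<beta> where "\<beta> j \<omega> = s * b (node n j \<omega>) $ i / \<epsilon>" for j \<omega>
  define \<gamma> where "\<gamma> j \<omega> = s * \<sigma> (node n j \<omega>) $ i / \<epsilon>" for j \<omega>
  define \<theta> where "\<theta> j \<omega> = (if \<exists>i\<le>j. \<zeta> i \<omega> \<le> 1 then 0 else 1 :: real)" for j \<omega>
  define U where "U j \<omega> = stopped_barrier (\<lambda>i. \<zeta> i \<omega>) j" for j \<omega>
  define err where "err = ((C / \<epsilon>)\<^sup>2 + 6 * (C / \<epsilon>) ^ 3) * (h * sqrt h)"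
  have h: "0 < h" "h \<le> 1" by (auto simp: h_def)
  have abs_s: "\<bar>s\<bar> = 1" using s by auto
  have hit: "s * (node n j \<omega> $ i - c) \<le> \<epsilon> \<longleftrightarrow> \<zeta> j \<omega> \<le> 1" for j \<omega>
    unfolding \<zeta>_def using \<epsilon> by simp
  have nF: "node n i \<in> borel_measurable (F (dyadic n j))" if "i \<le> j" for i j
  proof (rule node_measurable[where t = "dyadic n j"])
    show "dyadic n i \<le> dyadic n j" using that by simp
  qed (rule W_measurable)
  have \<zeta>F: "\<zeta> l \<in> borel_measurable (F (dyadic n j))" if "l \<le> j" for l j
  proof -
    have [measurable]: "(\<lambda>\<omega>. node n l \<omega> $ i) \<in> borel_measurable (F (dyadic n j))"
      using nF[OF that] borel_measurable_vec by blast
    show ?thesis unfolding \<zeta>_def[abs_def] by measurable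
  qed
  have \<beta>F: "\<beta> j \<in> borel_measurable (F (dyadic n j))" and \<gamma>F: "\<gamma> j \<in> borel_measurable (F (dyadic n j))" for j
  proof -
    have [measurable]: "(\<lambda>\<omega>. b (node n j \<omega>) $ i) \<in> borel_measurable (F (dyadic n j))"
      "(\<lambda>\<omega>. \<sigma> (node n j \<omega>) $ i) \<in> borel_measurable (F (dyadic n j))"
      by (rule measurable_compose[OF nF[OF order_refl] b_measurable] measurable_compose[OF nF[OF order_refl] \<sigma>_measurable])+
    show "\<beta> j \<in> borel_measurable (F (dyadic n j))" "\<gamma> j \<in> borel_measurable (F (dyadic n j))"
      unfolding \<beta>_def[abs_def] \<gamma>_def[abs_def] by measurable
  qed
  have \<theta>F: "\<theta> j \<in> borel_measurable (F (dyadic n j))" for j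
  proof -
    have [measurable]: "\<zeta> l \<in> borel_measurable (F (dyadic n j))" if "l \<in> {..j}" for l using \<zeta>F that by simp
    have "(\<lambda>\<omega>. if \<exists>l\<in>{..j}. \<zeta> l \<omega> \<le> 1 then 0 else 1 :: real) \<in> borel_measurable (F (dyadic n j))" by measurable
    then show ?thesis unfolding \<theta>_def[abs_def] Bex_def atMost_iff .
  qed
  have \<zeta>M[measurable]: "\<zeta> j \<in> borel_measurable M" for j by (rule F_imp_M[OF \<zeta>F[OF order_refl]]) simp
  have \<theta>M[measurable]: "\<theta> j \<in> borel_measurable M" for j by (rule F_imp_M[OF \<theta>F]) simp
  have \<theta>01: "0 \<le> \<theta> j \<omega> \<and> \<theta> j \<omega> \<le> 1" for j \<omega> by (simp add: \<theta>_def)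
  have bar_int: "integrable M (\<lambda>\<omega>. barrier (\<zeta> j \<omega>))" for j
  proof -
    have "integrable M (\<lambda>\<omega>. \<zeta> j \<omega>)" unfolding \<zeta>_def using node_component_integrable by simp
    then have g: "integrable M (\<lambda>\<omega>. 1 + 2 * \<bar>\<zeta> j \<omega>\<bar>)" by simp
    show ?thesis
    proof (rule Bochner_Integration.integrable_bound[OF g])
      have "barrier z \<le> 1 + 2 * \<bar>z\<bar>" for z
        using sqrt_add_le_add_sqrt[of 1 "z\<^sup>2"] unfolding barrier_def by simp
      then show "AE \<omega> in M. norm (barrier (\<zeta> j \<omega>)) \<le> norm (1 + 2 * \<bar>\<zeta> j \<omega>\<bar>)"
        using barrier_pos by (auto simp: less_imp_le)
    qed (unfold barrier_def, measurable)
  qed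
  have next_\<zeta>: "\<zeta> (Suc j) \<omega> = \<zeta> j \<omega> + (\<beta> j \<omega> * (dyadic n (Suc j) - dyadic n j) +
      \<gamma> j \<omega> * (W (dyadic n (Suc j)) \<omega> $ i - W (dyadic n j) \<omega> $ i))" for j \<omega>
    unfolding \<zeta>_def \<beta>_def \<gamma>_def using \<epsilon> by (simp add: dyadic_Suc field_simps)
  have step: "integrable M (\<lambda>\<omega>. \<theta> j \<omega> * barrier (\<zeta> (Suc j) \<omega>))"
    "expectation (\<lambda>\<omega>. \<theta> j \<omega> * barrier (\<zeta> (Suc j) \<omega>)) \<le> (1 + (\<kappa> + \<kappa>\<^sup>2) * h) * expectation (\<lambda>\<omega>. \<theta> j \<omega> * barrier (\<zeta> j \<omega>)) + err" for j
  proof -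
    have d: "dyadic n (Suc j) - dyadic n j = h" by (simp add: dyadic_Suc h_def)
    have D: "\<bar>\<beta> j \<omega>\<bar> \<le> C / \<epsilon>" "\<bar>\<gamma> j \<omega>\<bar> \<le> C / \<epsilon>" for \<omega>
      unfolding \<beta>_def \<gamma>_def using \<epsilon> abs_s b_bound \<sigma>_bound by (simp_all add: abs_mult divide_right_mono)
    have m: "max 0 (\<zeta> j \<omega>) = max 0 (s * (node n j \<omega> $ i - c)) / \<epsilon>" for \<omega>
      unfolding \<zeta>_def using \<epsilon> by (simp add: max_def divide_le_0_iff zero_le_divide_iff)
    have K: "- \<kappa> * max 0 (\<zeta> j \<omega>) \<le> \<beta> j \<omega>" "\<bar>\<gamma> j \<omega>\<bar> \<le> \<kappa> * max 0 (\<zeta> j \<omega>)" for \<omega>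
      unfolding m \<beta>_def \<gamma>_def using divide_right_mono[OF drift, of \<epsilon> "node n j \<omega>"]
        divide_right_mono[OF diffusion, of \<epsilon> "node n j \<omega>"] \<epsilon> abs_s by (simp_all add: abs_mult)
    note st = B.barrier_expectation_step[where s = "dyadic n j" and t = "dyadic n (Suc j)" and D = "C / \<epsilon>" and K = \<kappa>,
      OF _ _ _ \<zeta>F[OF order_refl] \<beta>F \<gamma>F \<theta>F bar_int \<theta>01 D \<kappa> K, unfolded next_\<zeta>[symmetric], unfolded d]
    show "integrable M (\<lambda>\<omega>. \<theta> j \<omega> * barrier (\<zeta> (Suc j) \<omega>))"
      by (rule st(1)) (use h in simp_all)
    show "expectation (\<lambda>\<omega>. \<theta> j \<omega> * barrier (\<zeta> (Suc j) \<omega>)) \<le> (1 + (\<kappa> + \<kappa>\<^sup>2) * h) * expectation (\<lambda>\<omega>. \<theta> j \<omega> * barrier (\<zeta> j \<omega>)) + err"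
      unfolding err_def by (rule st(2)) (use h in simp_all)
  qed
  have U_Suc: "U (Suc j) \<omega> = (1 - \<theta> j \<omega>) * U j \<omega> + \<theta> j \<omega> * barrier (\<zeta> (Suc j) \<omega>)" for j \<omega>
    unfolding U_def \<theta>_def stopped_barrier.simps by (cases "\<exists>i\<le>j. \<zeta> i \<omega> \<le> 1") (simp_all only: if_True if_False, simp_all)
  have \<theta>U: "\<theta> j \<omega> * barrier (\<zeta> j \<omega>) = \<theta> j \<omega> * U j \<omega>" for j \<omega>
    using stopped_barrier_alive[of j "\<lambda>i. \<zeta> i \<omega>"] by (simp add: U_def \<theta>_def)
  have Upos: "0 \<le> U j \<omega>" for j \<omega> unfolding U_def by (rule less_imp_le[OF stopped_barrier_pos])
  have U_int: "integrable M (U j)" for j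
  proof (induction j)
    case 0
    then show ?case using bar_int[of 0] by (simp add: U_def[abs_def])
  next
    case (Suc j)
    note [measurable] = borel_measurable_integrable[OF Suc]
    have "integrable M (\<lambda>\<omega>. (1 - \<theta> j \<omega>) * U j \<omega>)"
      by (rule Bochner_Integration.integrable_bound[OF Suc]) (use \<theta>01 Upos in \<open>auto simp: abs_mult intro!: mult_left_le_one_le\<close>)
    then show ?case unfolding U_Suc[abs_def] using step(1) by (intro Bochner_Integration.integrable_add)
  qed
  have rec: "expectation (U (Suc j)) \<le> (1 + (\<kappa> + \<kappa>\<^sup>2) * h) * expectation (U j) + err" for j
  proof -
    note [measurable] = borel_measurable_integrable[OF U_int]
    have i1: "integrable M (\<lambda>\<omega>. (1 - \<theta> j \<omega>) * U j \<omega>)"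
      by (rule Bochner_Integration.integrable_bound[OF U_int[of j]]) (use \<theta>01 Upos in \<open>auto simp: abs_mult intro!: mult_left_le_one_le\<close>)
    have i2: "integrable M (\<lambda>\<omega>. \<theta> j \<omega> * U j \<omega>)"
      by (rule Bochner_Integration.integrable_bound[OF U_int[of j]]) (use \<theta>01 Upos in \<open>auto simp: abs_mult intro!: mult_left_le_one_le\<close>)
    have sum: "expectation (U j) = expectation (\<lambda>\<omega>. (1 - \<theta> j \<omega>) * U j \<omega>) + expectation (\<lambda>\<omega>. \<theta> j \<omega> * U j \<omega>)"
      by (subst Bochner_Integration.integral_add[OF i1 i2, symmetric]) (simp add: algebra_simps)
    have "expectation (U (Suc j)) = expectation (\<lambda>\<omega>. (1 - \<theta> j \<omega>) * U j \<omega>) + expectation (\<lambda>\<omega>. \<theta> j \<omega> * barrier (\<zeta> (Suc j) \<omega>))"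
      unfolding U_Suc[abs_def] by (rule Bochner_Integration.integral_add[OF i1 step(1)])
    also have "\<dots> \<le> expectation (\<lambda>\<omega>. (1 - \<theta> j \<omega>) * U j \<omega>) + ((1 + (\<kappa> + \<kappa>\<^sup>2) * h) * expectation (\<lambda>\<omega>. \<theta> j \<omega> * U j \<omega>) + err)"
      using step(2)[of j] unfolding \<theta>U by (rule add_left_mono)
    also have "\<dots> \<le> (1 + (\<kappa> + \<kappa>\<^sup>2) * h) * expectation (\<lambda>\<omega>. (1 - \<theta> j \<omega>) * U j \<omega>) + ((1 + (\<kappa> + \<kappa>\<^sup>2) * h) * expectation (\<lambda>\<omega>. \<theta> j \<omega> * U j \<omega>) + err)"
    proof (rule add_right_mono)
      have "0 \<le> expectation (\<lambda>\<omega>. (1 - \<theta> j \<omega>) * U j \<omega>)"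
        using \<theta>01 Upos by (intro integral_nonneg_AE AE_I2 mult_nonneg_nonneg) auto
      then show "expectation (\<lambda>\<omega>. (1 - \<theta> j \<omega>) * U j \<omega>) \<le> (1 + (\<kappa> + \<kappa>\<^sup>2) * h) * expectation (\<lambda>\<omega>. (1 - \<theta> j \<omega>) * U j \<omega>)"
        using \<kappa> h by (simp add: mult_le_cancel_right1)
    qed
    finally show ?thesis unfolding sum by (simp only: distrib_left add.assoc)
  qed
  have D0: "0 \<le> C / \<epsilon>" using C_nonneg \<epsilon> by simp
  have err0: "0 \<le> err" unfolding err_def using D0 h by (intro mult_nonneg_nonneg add_nonneg_nonneg) auto
  have U0: "expectation (U 0) = barrier (s * (x\<^sub>0 $ i - c) / \<epsilon>)"
    by (simp add: U_def[abs_def] \<zeta>_def prob_space)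
  have Uk: "expectation (U k) \<le> (barrier (s * (x\<^sub>0 $ i - c) / \<epsilon>) + real k * err) * (1 + (\<kappa> + \<kappa>\<^sup>2) * h) ^ k"
    using affine_recursion_le[of "(\<kappa> + \<kappa>\<^sup>2) * h" err "\<lambda>j. expectation (U j)" k] \<kappa> h err0 rec
    unfolding U0 by (simp add: less_imp_le barrier_pos)
  have "{\<omega>\<in>space M. \<exists>j\<in>{..k}. \<zeta> j \<omega> \<le> 1} \<in> events" by measurable
  then show E: "{\<omega>\<in>space M. \<exists>j\<le>k. s * (node n j \<omega> $ i - c) \<le> \<epsilon>} \<in> events"
    unfolding hit Bex_def atMost_iff .
  note [measurable] = borel_measurable_integrable[OF U_int]
  have "prob {\<omega>\<in>space M. \<exists>j\<le>k. s * (node n j \<omega> $ i - c) \<le> \<epsilon>} \<le> prob {\<omega>\<in>space M. barrier 1 \<le> U k \<omega>}"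
  proof (rule finite_measure_mono)
    show "{\<omega>\<in>space M. \<exists>j\<le>k. s * (node n j \<omega> $ i - c) \<le> \<epsilon>} \<subseteq> {\<omega>\<in>space M. barrier 1 \<le> U k \<omega>}"
      using stopped_barrier_hit[of k "\<lambda>j. \<zeta> j _"] by (auto simp only: hit U_def)
  qed measurable
  also have "\<dots> \<le> expectation (U k) / barrier 1"
    using Upos by (intro integral_Markov_inequality_measure[where A = "{}"] U_int) (auto simp: barrier_pos)
  also have "\<dots> \<le> (barrier (s * (x\<^sub>0 $ i - c) / \<epsilon>) + real k * err) * (1 + (\<kappa> + \<kappa>\<^sup>2) * h) ^ k / barrier 1"
    using Uk barrier_pos by (intro divide_right_mono) (auto intro: less_imp_le)
  finally show "prob {\<omega>\<in>space M. \<exists>j\<le>k. s * (node n j \<omega> $ i - c) \<le> \<epsilon>} \<le>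
      (barrier (s * (x\<^sub>0 $ i - c) / \<epsilon>) + real k * (((C / \<epsilon>)\<^sup>2 + 6 * (C / \<epsilon>) ^ 3) * (h * sqrt h))) *
      (1 + (\<kappa> + \<kappa>\<^sup>2) * h) ^ k / barrier 1" unfolding err_def .
qed

text \<open>If the limit reaches or crosses the face at time \<open>t\<close>, then for every
  \<epsilon> the nodes next to \<open>t\<close> are below \<epsilon> at all sufficiently high
  levels. The probability of this is estimated by letting the level grow for fixed \<epsilon>, where
  the accumulated error is of order \<open>sqrt (1 / 2 ^ n)\<close>, and letting \<epsilon> tend to
  0 afterwards.\<close>

lemma euler_limit_interior:
  assumes s: "s = 1 \<or> s = - 1" and \<kappa>: "0 \<le> \<kappa>"
    and drift: "\<And>x. - \<kappa> * max 0 (s * (x $ i - c)) \<le> s * b x $ i"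
    and diffusion: "\<And>x. \<bar>\<sigma> x $ i\<bar> \<le> \<kappa> * max 0 (s * (x $ i - c))"
    and start: "0 < s * (x\<^sub>0 $ i - c)"
  shows "AE \<omega> in M. \<forall>t\<ge>0. 0 < s * (euler_limit t \<omega> $ i - c)"
proof -
  let ?z = "s * (x\<^sub>0 $ i - c)"
  define \<epsilon> where "\<epsilon> m = 1 / real (Suc m)" for m
  define E where "E T m n = {\<omega>\<in>space M. \<exists>j\<le>T * 2 ^ n. s * (node n j \<omega> $ i - c) \<le> \<epsilon> m}" for T m n
  have \<epsilon>: "0 < \<epsilon> m" for m by (simp add: \<epsilon>_def)
  have Em: "E T m n \<in> events" for T m n
    unfolding E_def by (rule barrier_hit_prob(1)[OF s \<epsilon> \<kappa> drift diffusion])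
  \<comment> \<open>Outcomes for which the scheme comes within \<open>\<epsilon> m\<close> of the
    face up to time \<open>T\<close> at all sufficiently high levels.\<close>
  define B where "B T m = (\<Union>N. \<Inter>n. E T m (N + n))" for T m
  let ?g = "\<lambda>T. exp ((\<kappa> + \<kappa>\<^sup>2) * real T) / barrier 1"
  have B: "B T m \<in> events" "prob (B T m) \<le> barrier (?z / \<epsilon> m) * ?g T" for T m
  proof -
    let ?c = "(C / \<epsilon> m)\<^sup>2 + 6 * (C / \<epsilon> m) ^ 3"
    have "0 \<le> C / \<epsilon> m" using C_nonneg \<epsilon>[of m] by simp
    then have c0: "0 \<le> ?c" by simp
    have le: "prob (E T m n) \<le> (barrier (?z / \<epsilon> m) + real T * ?c * sqrt (1 / 2 ^ n)) * ?g T" for n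
    proof -
      let ?h = "1 / 2 ^ n :: real"
      have "prob (E T m n) \<le> (barrier (?z / \<epsilon> m) + real (T * 2 ^ n) * (?c * (?h * sqrt ?h))) *
        (1 + (\<kappa> + \<kappa>\<^sup>2) * ?h) ^ (T * 2 ^ n) / barrier 1"
        unfolding E_def by (rule barrier_hit_prob(2)[OF s \<epsilon> \<kappa> drift diffusion])
      also have "real (T * 2 ^ n) * (?c * (?h * sqrt ?h)) = real T * ?c * sqrt ?h" by simp
      also have "(barrier (?z / \<epsilon> m) + real T * ?c * sqrt ?h) * (1 + (\<kappa> + \<kappa>\<^sup>2) * ?h) ^ (T * 2 ^ n) / barrier 1
         \<le> (barrier (?z / \<epsilon> m) + real T * ?c * sqrt ?h) * exp ((\<kappa> + \<kappa>\<^sup>2) * real T) / barrier 1"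
      proof (intro divide_right_mono mult_left_mono)
        have "(1 + (\<kappa> + \<kappa>\<^sup>2) * ?h) ^ (T * 2 ^ n) \<le> exp ((\<kappa> + \<kappa>\<^sup>2) * ?h) ^ (T * 2 ^ n)"
          using \<kappa> by (intro power_mono exp_ge_add_one_self) auto
        also have "\<dots> = exp (real (T * 2 ^ n) * ((\<kappa> + \<kappa>\<^sup>2) * ?h))" by (rule exp_of_nat_mult[symmetric])
        also have "real (T * 2 ^ n) * ((\<kappa> + \<kappa>\<^sup>2) * ?h) = (\<kappa> + \<kappa>\<^sup>2) * real T" by simp
        finally show "(1 + (\<kappa> + \<kappa>\<^sup>2) * ?h) ^ (T * 2 ^ n) \<le> exp ((\<kappa> + \<kappa>\<^sup>2) * real T)" .
        show "0 \<le> barrier (?z / \<epsilon> m) + real T * ?c * sqrt ?h"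
          by (intro add_nonneg_nonneg less_imp_le[OF barrier_pos] mult_nonneg_nonneg c0 real_sqrt_ge_zero) simp_all
        show "0 \<le> barrier 1" by (rule less_imp_le[OF barrier_pos])
      qed
      finally show ?thesis by simp
    qed
    have sl: "(\<lambda>n. sqrt (1 / 2 ^ n)) \<longlonglongrightarrow> sqrt 0" by (intro tendsto_real_sqrt half_power_tendsto_0)
    have "(\<lambda>n. (barrier (?z / \<epsilon> m) + real T * ?c * sqrt (1 / 2 ^ n)) * ?g T) \<longlonglongrightarrow>
        (barrier (?z / \<epsilon> m) + real T * ?c * sqrt 0) * ?g T" by (intro tendsto_mult tendsto_add tendsto_const sl)
    then have lim: "(\<lambda>n. (barrier (?z / \<epsilon> m) + real T * ?c * sqrt (1 / 2 ^ n)) * ?g T) \<longlonglongrightarrow> barrier (?z / \<epsilon> m) * ?g T" by simp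
    show "B T m \<in> events" "prob (B T m) \<le> barrier (?z / \<epsilon> m) * ?g T"
      unfolding B_def by (rule prob_liminf_le[OF Em le lim])+
  qed
  have null: "AE \<omega> in M. \<omega> \<notin> (\<Inter>m. B T m)" for T
  proof -
    have ev: "(\<Inter>m. B T m) \<in> events" using B(1) by (auto intro!: sets.countable_INT')
    have "prob (\<Inter>m. B T m) \<le> ?g T / ?z * \<epsilon> m" for m
    proof -
      have "prob (\<Inter>m. B T m) \<le> prob (B T m)" using B(1) by (intro finite_measure_mono) auto
      also have "\<dots> \<le> barrier (?z / \<epsilon> m) * ?g T" by (rule B(2))
      also have "\<dots> \<le> 1 / (?z / \<epsilon> m) * ?g T"
        using start \<epsilon>[of m] barrier_pos[of 1] by (intro mult_right_mono barrier_le_inverse) auto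
      finally show ?thesis by (simp add: mult_ac)
    qed
    moreover have "(\<lambda>m. ?g T / ?z * \<epsilon> m) \<longlonglongrightarrow> ?g T / ?z * 0"
      unfolding \<epsilon>_def by (intro tendsto_intros LIMSEQ_Suc[OF lim_1_over_n])
    ultimately have "prob (\<Inter>m. B T m) \<le> ?g T / ?z * 0"
      by (intro LIMSEQ_le_const[of "\<lambda>m. ?g T / ?z * \<epsilon> m"]) auto
    then have "prob (\<Inter>m. B T m) \<le> 0" by simp
    then have "prob (\<Inter>m. B T m) = 0" by (rule antisym[OF _ measure_nonneg])
    then show ?thesis using prob_eq_0[OF ev] by simp
  qed
  then have "AE \<omega> in M. \<forall>T. \<omega> \<notin> (\<Inter>m. B T m)" by (simp add: AE_all_countable)
  then show ?thesis
    using euler_uniform_limit W_continuous AE_space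
  proof eventually_elim
    case (elim \<omega>)
    show ?case
    proof (intro allI impI, rule ccontr)
      fix t :: real assume t: "0 \<le> t" and neg: "\<not> 0 < s * (euler_limit t \<omega> $ i - c)"
      obtain T :: nat where T: "t \<le> real T" using real_arch_simple by blast
      let ?j = "\<lambda>n. cell_index n t"
      have "(\<lambda>n. euler n (dyadic n (?j n)) \<omega>) \<longlonglongrightarrow> euler_limit t \<omega>"
        using elim(2,3) cell_index_tendsto[OF t] by (intro euler_diagonal_tendsto) auto
      then have "(\<lambda>n. node n (?j n) \<omega>) \<longlonglongrightarrow> euler_limit t \<omega>" by simp
      then have lim: "(\<lambda>n. s * (node n (?j n) \<omega> $ i - c)) \<longlonglongrightarrow> s * (euler_limit t \<omega> $ i - c)"
        by (intro tendsto_intros)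
      have "\<omega> \<in> B T m" for m
      proof -
        have "s * (euler_limit t \<omega> $ i - c) < \<epsilon> m" using neg \<epsilon>[of m] by linarith
        from order_tendstoD(2)[OF lim this] obtain N where
          N: "\<And>n. N \<le> n \<Longrightarrow> s * (node n (?j n) \<omega> $ i - c) < \<epsilon> m" unfolding eventually_sequentially by blast
        have "\<omega> \<in> E T m (N + n)" for n
          unfolding E_def using N[of "N + n"] cell_index_le[OF t T, of "N + n"] elim(4) by (auto intro: less_imp_le)
        then show ?thesis unfolding B_def by blast
      qed
      then show False using elim(1) by blast
    qed
  qed
qed

end

section \<open>The limit solves the equation\<close>

lemma continuous_on_halfline:
  fixes h :: "real \<Rightarrow> 'b::topological_space"
  assumes "\<And>T :: nat. continuous_on {0..real T} h"
  shows "continuous_on {0..} h"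
  unfolding continuous_on_eq_continuous_within
proof
  fix t :: real assume "t \<in> {0..}"
  obtain T :: nat where T: "t < real T" using reals_Archimedean2 by blast
  have "continuous (at t within {0..real T}) h"
    using assms[of T] \<open>t \<in> {0..}\<close> T by (auto simp: continuous_on_eq_continuous_within)
  moreover have "(at t within {0..real T}) = (at t within {0..})"
    by (rule at_within_nhd[where S = "{..<real T}"]) (use T in auto)
  ultimately show "continuous (at t within {0..}) h" by simp
qed

text \<open>The path is the limit of its values at the left ends of the dyadic cells. Clipping at
  \<open>T\<close> makes the sampled variables measurable at time \<open>T\<close> for every index
  and does not alter the samples at times up to \<open>T\<close>.\<close>

lemma continuous_adapted_progressive:
  fixes Y :: "real \<Rightarrow> 'w \<Rightarrow> real"
  assumes mono: "\<And>s t. 0 \<le> s \<Longrightarrow> s \<le> t \<Longrightarrow> Y s \<in> borel_measurable (F t)"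
    and space: "\<And>t. 0 \<le> t \<Longrightarrow> space (F t) = \<Omega>"
    and cont: "\<And>\<omega>. \<omega> \<in> \<Omega> \<Longrightarrow> continuous_on {0..} (\<lambda>t. Y t \<omega>)"
  shows "progressively_measurable F Y"
  unfolding progressively_measurable_def
proof (intro allI impI)
  fix T :: real assume T: "0 \<le> T"
  let ?P = "restrict_space borel {0..T} \<Otimes>\<^sub>M F T"
  show "(\<lambda>(t, \<omega>). Y t \<omega>) \<in> borel_measurable ?P"
  proof (rule borel_measurable_LIMSEQ_real)
    fix n
    have "(\<lambda>x. Y (min T (dyadic n k)) (snd x)) \<in> borel_measurable ?P" for k
      by (rule measurable_snd''[OF mono]) (use T in auto)
    moreover have "(\<lambda>x. cell_index n (fst x)) \<in> measurable ?P (count_space UNIV)"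
    proof (rule measurable_fst'')
      have "cell_index n \<in> measurable borel (count_space UNIV)"
        unfolding cell_index_def[abs_def] by measurable
      then show "cell_index n \<in> measurable (restrict_space borel {0..T}) (count_space UNIV)"
        by (rule measurable_restrict_space1)
    qed
    ultimately show "(\<lambda>x. Y (min T (dyadic n (cell_index n (fst x)))) (snd x)) \<in> borel_measurable ?P"
      by (rule measurable_compose_countable)
  next
    fix x assume "x \<in> space ?P"
    then have x: "0 \<le> fst x" "fst x \<le> T" "snd x \<in> \<Omega>"
      using space[OF T] by (auto simp: space_pair_measure space_restrict_space)
    have "min T (dyadic n (cell_index n (fst x))) = dyadic n (cell_index n (fst x))" for n
      using cell_index(1)[OF x(1), of n] x(2) by simp
    moreover have "(\<lambda>n. Y (dyadic n (cell_index n (fst x))) (snd x)) \<longlonglongrightarrow> Y (fst x) (snd x)"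
      using cont[OF x(3)] cell_index_tendsto[OF x(1)] x(1) by (auto simp: continuous_on_sequentially comp_def)
    ultimately show "(\<lambda>n. Y (min T (dyadic n (cell_index n (fst x)))) (snd x)) \<longlonglongrightarrow> (case x of (t, \<omega>) \<Rightarrow> Y t \<omega>)"
      by (simp add: case_prod_beta)
  qed
qed

lemma continuous_on_set_integral:
  fixes h :: "real \<Rightarrow> real"
  assumes "continuous_on {0..} h"
  shows "continuous_on {0..} (\<lambda>t. LINT s:{0..t}|lborel. h s)"
proof (rule continuous_on_halfline)
  fix T :: nat
  have h: "continuous_on {0..t} h" for t by (rule continuous_on_subset[OF assms]) auto
  have "(LINT s:{0..t}|lborel. h s) = integral {0..t} h" for t
    by (rule set_borel_integral_eq_integral(2)) (rule borel_integrable_atLeastAtMost'[OF h])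
  then show "continuous_on {0..real T} (\<lambda>t. LINT s:{0..t}|lborel. h s)"
    using indefinite_integral_continuous_1[OF integrable_continuous_real[OF h]] by simp
qed

context euler_scheme
begin

text \<open>A solution must be continuous and have values in \<open>S\<close> for every outcome, so
  the limit is replaced by the constant \<open>x\<^sub>0\<close> on one null set that covers all
  exceptional outcomes. Both filtrations contain this null set, so adaptedness is preserved.\<close>

lemma euler_limit_solution:
  fixes D :: "(real ^ 'd) set"
  assumes null: "\<And>N. N \<in> null_sets M \<Longrightarrow> N \<in> sets (F 0)"
    and W_adapted: "\<And>t. 0 \<le> t \<Longrightarrow> W t \<in> borel_measurable (F t)"
    and interior: "AE \<omega> in M. \<forall>t\<ge>0. euler_limit t \<omega> \<in> D"
    and x0: "x\<^sub>0 \<in> D" and "D \<subseteq> S"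
  obtains X where "sde_solution M F W S b \<sigma> x\<^sub>0 X" "\<And>t \<omega>. X t \<omega> \<in> D"
    "\<And>t. 0 \<le> t \<Longrightarrow> X t \<in> borel_measurable (completed_natural_filtration M W t)"
proof -
  let ?P = "\<lambda>\<omega>. continuous_on {0..} (\<lambda>t. W t \<omega>) \<and>
    (\<forall>T :: nat. uniform_limit {0..real T} (\<lambda>n t. euler n t \<omega>) (\<lambda>t. euler_limit t \<omega>) sequentially) \<and>
    (\<forall>t\<ge>0. euler_limit t \<omega> \<in> D)"
  have "AE \<omega> in M. ?P \<omega>" using W_continuous euler_uniform_limit interior by eventually_elim blast
  then obtain Nul where Nul: "Nul \<in> null_sets M" "{\<omega>\<in>space M. \<not> ?P \<omega>} \<subseteq> Nul"
    unfolding eventually_ae_filter by blast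
  have good: "?P \<omega>" if "\<omega> \<in> space M" "\<omega> \<notin> Nul" for \<omega> using Nul(2) that by blast
  have AE_good: "AE \<omega> in M. \<omega> \<notin> Nul" by (rule AE_not_in[OF Nul(1)])
  define X where "X t \<omega> = (if \<omega> \<in> space M \<and> \<omega> \<notin> Nul \<and> 0 \<le> t then euler_limit t \<omega> else x\<^sub>0)" for t \<omega>
  have X_good: "X t \<omega> = euler_limit t \<omega>" if "\<omega> \<in> space M" "\<omega> \<notin> Nul" "0 \<le> t" for t \<omega>
    using that by (simp add: X_def)
  have XD: "X t \<omega> \<in> D" for t \<omega> using good x0 by (auto simp: X_def)
  have space_F: "space (F t) = space M" if "0 \<le> t" for t
    using scalar_bm.space_F[OF bm that] .
  \<comment> \<open>Applied twice, to the given filtration and to the completed natural filtration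
    of \<open>W\<close>.\<close>
  have Xmeas: "X t \<in> borel_measurable N"
    if "space N = space M" "Nul \<in> sets N" "\<And>s. 0 \<le> s \<Longrightarrow> s \<le> t \<Longrightarrow> W s \<in> borel_measurable N" "0 \<le> t" for N t
  proof (rule borel_measurable_LIMSEQ_metric)
    fix n
    have [measurable]: "euler n t \<in> borel_measurable N" by (rule euler_measurable[OF that(3,4)])
    note [measurable] = that(2)
    show "(\<lambda>\<omega>. if \<omega> \<in> Nul then x\<^sub>0 else euler n t \<omega>) \<in> borel_measurable N" by measurable
  next
    fix \<omega> assume "\<omega> \<in> space N"
    then have \<omega>: "\<omega> \<in> space M" using that(1) by simp
    show "(\<lambda>n. if \<omega> \<in> Nul then x\<^sub>0 else euler n t \<omega>) \<longlonglongrightarrow> X t \<omega>"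
    proof (cases "\<omega> \<in> Nul")
      case True
      then show ?thesis by (simp add: X_def)
    next
      case False
      have "(\<lambda>n. euler n t \<omega>) \<longlonglongrightarrow> euler_limit t \<omega>"
        using good[OF \<omega> False] that(4) by (intro euler_diagonal_tendsto) auto
      then show ?thesis using False X_good[OF \<omega> False that(4)] by simp
    qed
  qed
  have XF: "X s \<in> borel_measurable (F t)" if "0 \<le> s" "s \<le> t" for s t
  proof -
    have "Nul \<in> sets (F s)"
      using null[OF Nul(1)] scalar_bm.filtration_mono[OF bm order_refl that(1)] by blast
    then have "X s \<in> borel_measurable (F s)"
      using that W_measurable by (intro Xmeas space_F) auto
    then show ?thesis using scalar_bm.measurable_F_mono[OF bm] that by blast
  qed
  have XN: "X t \<in> borel_measurable (completed_natural_filtration M W t)" if "0 \<le> t" for t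
  proof -
    let ?G = "{W s -` A \<inter> space M | s A. 0 \<le> s \<and> s \<le> t \<and> A \<in> sets borel} \<union> {N. \<exists>A\<in>null_sets M. N \<subseteq> A}"
    have G: "?G \<subseteq> Pow (space M)" using sets.sets_into_space by (fastforce simp: null_sets_def)
    have sets: "sets (completed_natural_filtration M W t) = sigma_sets (space M) ?G"
      unfolding completed_natural_filtration_def by (rule sets_measure_of[OF G])
    have sp: "space (completed_natural_filtration M W t) = space M"
      unfolding completed_natural_filtration_def by (rule space_measure_of[OF G])
    show ?thesis
    proof (rule Xmeas[OF sp _ _ that])
      show "Nul \<in> sets (completed_natural_filtration M W t)"
        unfolding sets using Nul(1) by (intro sigma_sets.Basic) blast
      show "W s \<in> borel_measurable (completed_natural_filtration M W t)" if "0 \<le> s" "s \<le> t" for s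
      proof (rule measurableI)
        show "W s -` A \<inter> space (completed_natural_filtration M W t) \<in> sets (completed_natural_filtration M W t)"
          if "A \<in> sets borel" for A
          unfolding sets sp using that \<open>0 \<le> s\<close> \<open>s \<le> t\<close> by (intro sigma_sets.Basic) blast
      qed simp
    qed
  qed
  have Xcont: "continuous_on {0..} (\<lambda>t. X t \<omega>)" if "\<omega> \<in> space M" for \<omega>
  proof (cases "\<omega> \<in> Nul")
    case True
    then show ?thesis by (simp add: X_def)
  next
    case False
    have "continuous_on {0..} (\<lambda>t. euler_limit t \<omega>)"
      by (rule continuous_on_halfline, rule euler_limit_continuous) (use good[OF that False] in auto)
    then show ?thesis using X_good[OF that False] by (simp cong: continuous_on_cong_simp)
  qed
  have bcont: "continuous_on {0..} (\<lambda>t. b (X t \<omega>) $ i)" and \<sigma>cont: "continuous_on {0..} (\<lambda>t. \<sigma> (X t \<omega>) $ i)"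
    if "\<omega> \<in> space M" for \<omega> i
    using continuous_on_compose2[OF b_component_continuous[of UNIV] Xcont[OF that]]
      continuous_on_compose2[OF \<sigma>_component_continuous[of UNIV] Xcont[OF that]] by auto
  have bF: "(\<lambda>\<omega>. b (X s \<omega>) $ i) \<in> borel_measurable (F t)" and \<sigma>F: "(\<lambda>\<omega>. \<sigma> (X s \<omega>) $ i) \<in> borel_measurable (F t)"
    if "0 \<le> s" "s \<le> t" for s t i
    using measurable_compose[OF XF[OF that] b_measurable] measurable_compose[OF XF[OF that] \<sigma>_measurable] .
  have node_tendsto: "(\<lambda>n. node n (left_index n s) \<omega>) \<longlonglongrightarrow> X s \<omega>"
    if "\<omega> \<in> space M" "\<omega> \<notin> Nul" "0 < s" for \<omega> s
  proof -
    have "(\<lambda>n. euler n (dyadic n (left_index n s)) \<omega>) \<longlonglongrightarrow> euler_limit s \<omega>"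
      using good[OF that(1,2)] left_index_tendsto[OF that(3)] by (intro euler_diagonal_tendsto) auto
    then show ?thesis using X_good[OF that(1,2)] that(3) by simp
  qed
  have "\<exists>J. is_ito_integral M F (\<lambda>t \<omega>. W t \<omega> $ i) (\<lambda>t \<omega>. \<sigma> (X t \<omega>) $ i) J \<and>
        (AE \<omega> in M. \<forall>t\<ge>0. set_integrable lborel {0..t} (\<lambda>s. b (X s \<omega>) $ i) \<and>
           X t \<omega> $ i = x\<^sub>0 $ i + (LINT s:{0..t}|lborel. b (X s \<omega>) $ i) + J t \<omega>)" for i
  proof -
    interpret B: scalar_bm M F "\<lambda>t \<omega>. W t \<omega> $ i" by (rule bm)
    let ?B = "\<lambda>t \<omega>. W t \<omega> $ i" and ?H = "\<lambda>t \<omega>. \<sigma> (X t \<omega>) $ i"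
    define A where "A t \<omega> = (LINT s:{0..t}|lborel. b (X s \<omega>) $ i)" for t \<omega>
    \<comment> \<open>The noise term is defined as the remainder of the equation, which then holds
      trivially; what has to be shown is that it is the Ito integral.\<close>
    define J where "J t \<omega> = X t \<omega> $ i - x\<^sub>0 $ i - A t \<omega>" for t \<omega>
    let ?\<xi> = "\<lambda>n k \<omega>. \<sigma> (node n k \<omega>) $ i"
    have prog: "progressively_measurable F ?H"
      by (rule continuous_adapted_progressive[OF \<sigma>F space_F \<sigma>cont])
    have A_F: "A t \<in> borel_measurable (F t)" if t: "0 \<le> t" for t
    proof (rule borel_measurable_LIMSEQ_real)
      fix n
      show "simple_integral (\<lambda>t \<omega>. t) (n * 2 ^ n) (dyadic n) (\<lambda>k \<omega>. b (X (dyadic n k) \<omega>) $ i) t \<in> borel_measurable (F t)"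
        unfolding simple_integral_def[abs_def]
      proof (rule borel_measurable_sum)
        fix k
        show "(\<lambda>\<omega>. b (X (dyadic n k) \<omega>) $ i * (min t (dyadic n (Suc k)) - min t (dyadic n k))) \<in> borel_measurable (F t)"
        proof (cases "dyadic n k \<le> t")
          case True
          then show ?thesis using bF[of "dyadic n k" t i] by simp
        next
          case False
          have "dyadic n k \<le> dyadic n (Suc k)" by simp
          then have "min t (dyadic n (Suc k)) - min t (dyadic n k) = 0" using False by linarith
          then show ?thesis by simp
        qed
      qed
    next
      fix \<omega> assume "\<omega> \<in> space (F t)"
      then have \<omega>: "\<omega> \<in> space M" using space_F[OF t] by simp
      show "(\<lambda>n. simple_integral (\<lambda>t \<omega>. t) (n * 2 ^ n) (dyadic n) (\<lambda>k \<omega>. b (X (dyadic n k) \<omega>) $ i) t \<omega>) \<longlonglongrightarrow> A t \<omega>"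
        unfolding A_def
        by (rule dyadic_step_integrals(1)[where C = C and \<xi> = "\<lambda>n k \<omega>. b (X (dyadic n k) \<omega>) $ i", OF t bcont[OF \<omega>]])
           (use b_bound continuous_left_index_tendsto[OF bcont[OF \<omega>]] in auto)
    qed
    have J_F: "J t \<in> borel_measurable (F t)" if "0 \<le> t" for t
      unfolding J_def[abs_def] using A_F[OF that] XF[OF that order_refl] borel_measurable_vec[of "X t" "F t"]
      by (intro borel_measurable_diff borel_measurable_const) auto
    have \<xi>F: "?\<xi> n k \<in> borel_measurable (F (dyadic n k))" for n k
    proof (rule measurable_compose[OF _ \<sigma>_measurable])
      show "node n k \<in> borel_measurable (F (dyadic n k))"
        by (rule node_measurable[OF _ order_refl]) (rule W_measurable)
    qed
    have si: "simple_integrand M F (n * 2 ^ n) (dyadic n) (?\<xi> n)" for n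
      using \<xi>F \<sigma>_bound by (intro B.dyadic_simple_integrand[where C = C])
    have step: "(\<lambda>n. simple_integral (\<lambda>t \<omega>. t) (n * 2 ^ n) (dyadic n) (\<lambda>k \<omega>. b (node n k \<omega>) $ i) t \<omega>) \<longlonglongrightarrow> A t \<omega>"
      "(\<lambda>n. \<integral>\<^sup>+s\<in>{0..t}. ennreal ((simple_process (n * 2 ^ n) (dyadic n) (?\<xi> n) s \<omega> - ?H s \<omega>)\<^sup>2) \<partial>lborel) \<longlonglongrightarrow> 0"
      if t: "0 \<le> t" and \<omega>: "\<omega> \<in> space M" "\<omega> \<notin> Nul" for t \<omega>
    proof -
      have nb: "(\<lambda>n. b (node n (left_index n s) \<omega>) $ i) \<longlonglongrightarrow> b (X s \<omega>) $ i"
        and n\<sigma>: "(\<lambda>n. \<sigma> (node n (left_index n s) \<omega>) $ i) \<longlonglongrightarrow> \<sigma> (X s \<omega>) $ i" if "0 < s" for s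
        using continuous_on_tendsto_compose[OF b_component_continuous[of UNIV] node_tendsto[OF \<omega> that]]
          continuous_on_tendsto_compose[OF \<sigma>_component_continuous[of UNIV] node_tendsto[OF \<omega> that]] by auto
      show "(\<lambda>n. simple_integral (\<lambda>t \<omega>. t) (n * 2 ^ n) (dyadic n) (\<lambda>k \<omega>. b (node n k \<omega>) $ i) t \<omega>) \<longlonglongrightarrow> A t \<omega>"
        unfolding A_def
        by (rule dyadic_step_integrals(1)[where C = C and \<xi> = "\<lambda>n k \<omega>. b (node n k \<omega>) $ i", OF t bcont[OF \<omega>(1)]])
           (use b_bound nb in auto)
      show "(\<lambda>n. \<integral>\<^sup>+s\<in>{0..t}. ennreal ((simple_process (n * 2 ^ n) (dyadic n) (?\<xi> n) s \<omega> - ?H s \<omega>)\<^sup>2) \<partial>lborel) \<longlonglongrightarrow> 0"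
        by (rule dyadic_step_integrals(2)[where C = C and \<xi> = ?\<xi>, OF t \<sigma>cont[OF \<omega>(1)]])
           (use \<sigma>_bound n\<sigma> in auto)
    qed
    have Jlim: "tends_in_prob M (\<lambda>n. simple_integral ?B (n * 2 ^ n) (dyadic n) (?\<xi> n) t) (J t)" if t: "0 \<le> t" for t
    proof (rule tends_in_prob_AE)
      show "simple_integral ?B (n * 2 ^ n) (dyadic n) (?\<xi> n) t \<in> borel_measurable M" for n
        by (rule B.simple_integral_measurable[OF si t])
      show "J t \<in> borel_measurable M" by (rule F_imp_M[OF J_F[OF t] t])
      show "AE \<omega> in M. (\<lambda>n. simple_integral ?B (n * 2 ^ n) (dyadic n) (?\<xi> n) t \<omega>) \<longlonglongrightarrow> J t \<omega>"
        using AE_good AE_space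
      proof eventually_elim
        case (elim \<omega>)
        have "(\<lambda>n. euler n t \<omega>) \<longlonglongrightarrow> euler_limit t \<omega>"
          using good[OF elim(2,1)] t by (intro euler_diagonal_tendsto) auto
        then have "(\<lambda>n. euler n t \<omega> $ i) \<longlonglongrightarrow> X t \<omega> $ i"
          unfolding X_good[OF elim(2,1) t] by (rule tendsto_vec_nth)
        then have "(\<lambda>n. euler n t \<omega> $ i - x\<^sub>0 $ i - simple_integral (\<lambda>t \<omega>. t) (n * 2 ^ n) (dyadic n) (\<lambda>k \<omega>. b (node n k \<omega>) $ i) t \<omega>) \<longlonglongrightarrow> J t \<omega>"
          unfolding J_def by (intro tendsto_diff tendsto_const step(1)[OF t elim(2,1)])
        moreover have "\<forall>\<^sub>F n in sequentially. euler n t \<omega> $ i - x\<^sub>0 $ i - simple_integral (\<lambda>t \<omega>. t) (n * 2 ^ n) (dyadic n) (\<lambda>k \<omega>. b (node n k \<omega>) $ i) t \<omega>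
           = simple_integral ?B (n * 2 ^ n) (dyadic n) (?\<xi> n) t \<omega>"
          using eventually_ge_at_top[of "nat \<lceil>t\<rceil>"]
        proof eventually_elim
          case (elim n)
          then have "t \<le> real n" by linarith
          then have "t \<le> dyadic n (n * 2 ^ n)" by simp
          from euler_sum[OF t this, of \<omega> i] show ?case by linarith
        qed
        ultimately show ?case by (rule Lim_transform_eventually)
      qed
    qed
    have "is_ito_integral M F ?B ?H J"
      unfolding is_ito_integral_def
    proof (intro conjI allI impI exI)
      show "progressively_measurable F ?H" by (rule prog)
      show "J t \<in> borel_measurable (F t)" if "0 \<le> t" for t by (rule J_F[OF that])
      show "AE \<omega> in M. (\<integral>\<^sup>+s\<in>{0..T}. ennreal ((?H s \<omega>)\<^sup>2) \<partial>lborel) < \<infinity>" if "0 \<le> T" for T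
      proof (rule AE_I2)
        fix \<omega>
        have "(\<integral>\<^sup>+s\<in>{0..T}. ennreal ((?H s \<omega>)\<^sup>2) \<partial>lborel) \<le> (\<integral>\<^sup>+s\<in>{0..T}. ennreal (C\<^sup>2) \<partial>lborel)"
        proof (intro nn_integral_mono mult_right_mono ennreal_leI)
          show "(?H s \<omega>)\<^sup>2 \<le> C\<^sup>2" for s using power_mono[OF \<sigma>_bound abs_ge_zero, of "X s \<omega>" i 2] by simp
        qed simp
        also have "\<dots> = ennreal (C\<^sup>2) * emeasure lborel {0..T}" by (rule nn_integral_cmult_indicator) simp
        also have "\<dots> < \<infinity>" by (simp add: emeasure_lborel_Icc_eq ennreal_mult_less_top)
        finally show "(\<integral>\<^sup>+s\<in>{0..T}. ennreal ((?H s \<omega>)\<^sup>2) \<partial>lborel) < \<infinity>" .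
      qed
      show "AE \<omega> in M. continuous_on {0..} (\<lambda>t. J t \<omega>)"
      proof (rule AE_I2)
        fix \<omega> assume \<omega>: "\<omega> \<in> space M"
        have "continuous_on {0..} (\<lambda>t. X t \<omega> $ i)" by (intro continuous_intros Xcont[OF \<omega>])
        then show "continuous_on {0..} (\<lambda>t. J t \<omega>)"
          unfolding J_def A_def by (intro continuous_on_diff continuous_on_const continuous_on_set_integral bcont[OF \<omega>])
      qed
      show "simple_integrand M F (n * 2 ^ n) (dyadic n) (?\<xi> n)" for n by (rule si)
      show "(\<lambda>n. prob {\<omega>\<in>space M. ennreal \<epsilon> <
         (\<integral>\<^sup>+s\<in>{0..T}. ennreal ((simple_process (n * 2 ^ n) (dyadic n) (?\<xi> n) s \<omega> - ?H s \<omega>)\<^sup>2) \<partial>lborel)}) \<longlonglongrightarrow> 0"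
        if "0 \<le> T" "0 < \<epsilon>" for T \<epsilon>
      proof (rule B.prob_distance_tendsto_0[OF prog si that])
        show "AE \<omega> in M. (\<lambda>n. \<integral>\<^sup>+s\<in>{0..T}. ennreal ((simple_process (n * 2 ^ n) (dyadic n) (?\<xi> n) s \<omega> - ?H s \<omega>)\<^sup>2) \<partial>lborel) \<longlonglongrightarrow> 0"
          using AE_good AE_space by eventually_elim (rule step(2)[OF that(1)])
      qed
      show "(\<lambda>n. prob {\<omega>\<in>space M. \<epsilon> < \<bar>simple_integral ?B (n * 2 ^ n) (dyadic n) (?\<xi> n) t \<omega> - J t \<omega>\<bar>}) \<longlonglongrightarrow> 0"
        if "0 \<le> t" "0 < \<epsilon>" for t \<epsilon>
        using Jlim[OF that(1)] that(2) unfolding tends_in_prob_def by blast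
    qed
    moreover have "AE \<omega> in M. \<forall>t\<ge>0. set_integrable lborel {0..t} (\<lambda>s. b (X s \<omega>) $ i) \<and>
           X t \<omega> $ i = x\<^sub>0 $ i + (LINT s:{0..t}|lborel. b (X s \<omega>) $ i) + J t \<omega>"
    proof (intro AE_I2 allI impI conjI)
      fix \<omega> and t :: real assume \<omega>: "\<omega> \<in> space M"
      show "set_integrable lborel {0..t} (\<lambda>s. b (X s \<omega>) $ i)"
        by (rule borel_integrable_atLeastAtMost'[OF continuous_on_subset[OF bcont[OF \<omega>]]]) auto
      show "X t \<omega> $ i = x\<^sub>0 $ i + (LINT s:{0..t}|lborel. b (X s \<omega>) $ i) + J t \<omega>"
        by (simp add: J_def A_def)
    qed
    ultimately show ?thesis by blast
  qed
  moreover have "AE \<omega> in M. X 0 \<omega> = x\<^sub>0"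
  proof (rule AE_I2)
    fix \<omega>
    have "euler_limit 0 \<omega> = x\<^sub>0" by (simp add: euler_limit_def)
    then show "X 0 \<omega> = x\<^sub>0" by (simp add: X_def)
  qed
  ultimately have "sde_solution M F W S b \<sigma> x\<^sub>0 X"
    unfolding sde_solution_def using XF Xcont XD \<open>D \<subseteq> S\<close> by blast
  then show ?thesis using XD XN by (rule that)
qed

end

section \<open>Reduction to the Euler scheme\<close>

definition clamp_box :: "real ^ 'd \<Rightarrow> real ^ 'd \<Rightarrow> real ^ 'd \<Rightarrow> real ^ 'd" where
  "clamp_box L R x = (\<chi> i. max (L $ i) (min (R $ i) (x $ i)))"

lemma clamp_box_in: "(\<And>i. L $ i \<le> R $ i) \<Longrightarrow> clamp_box L R x \<in> cbox L R"
  by (auto simp: clamp_box_def mem_box_cart)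

lemma clamp_box_id: "x \<in> cbox L R \<Longrightarrow> clamp_box L R x = x"
  by (auto simp: clamp_box_def mem_box_cart vec_eq_iff)

lemma norm_clamp_box_diff: "norm (clamp_box L R x - clamp_box L R y) \<le> norm (x - y)"
proof (rule norm_le_componentwise_cart)
  fix i
  show "norm ((clamp_box L R x - clamp_box L R y) $ i) \<le> norm ((x - y) $ i)"
  proof -
    have "\<bar>max l (min r a) - max l (min r b)\<bar> \<le> \<bar>a - b\<bar>" for l r a b :: real by linarith
    then show ?thesis by (simp add: clamp_box_def)
  qed
qed

lemma continuous_component_bounded_cbox:
  fixes h :: "real ^ 'd \<Rightarrow> real ^ 'd"
  assumes "continuous_on (cbox L R) h"
  obtains B where "0 \<le> B" "\<And>x i. x \<in> cbox L R \<Longrightarrow> \<bar>h x $ i\<bar> \<le> B"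
proof -
  have "bounded (h ` cbox L R)"
    by (intro compact_imp_bounded compact_continuous_image assms compact_cbox)
  then obtain B where B: "0 < B" "\<forall>y\<in>h ` cbox L R. norm y \<le> B"
    unfolding bounded_pos by blast
  show ?thesis
  proof (rule that[of B])
    show "\<bar>h x $ i\<bar> \<le> B" if "x \<in> cbox L R" for x i
      using component_le_norm_cart[of "h x" i] B(2) that by (meson imageI order_trans)
  qed (use B(1) in simp)
qed

text \<open>The derivative extends continuously to the compact closed box and is therefore bounded.
  The mean value inequality on the convex open box gives a Lipschitz bound, which passes to the
  closure by continuity.\<close>

lemma C1_closure_lipschitz:
  fixes h :: "real ^ 'd \<Rightarrow> real ^ 'd"
  assumes "C1_closure (box L R) h" "box L R \<noteq> {}"
  obtains K where "0 \<le> K" "\<And>x y i. x \<in> cbox L R \<Longrightarrow> y \<in> cbox L R \<Longrightarrow> \<bar>h x $ i - h y $ i\<bar> \<le> K * norm (x - y)"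
proof -
  have cl: "closure (box L R) = cbox L R" by (rule closure_box[OF assms(2)])
  note D = assms(1)[unfolded C1_closure_def]
  note cont = conjunct1[OF D]
  from conjunct2[OF D] obtain h' where D': "continuous_on (closure (box L R)) h' \<and>
    (\<forall>y\<in>box L R. (h has_derivative blinfun_apply (h' y)) (at y))" by (rule exE)
  have h'c: "continuous_on (cbox L R) h'" using conjunct1[OF D'] unfolding cl .
  note h' = bspec[OF conjunct2[OF D']]
  have "bounded (h' ` cbox L R)"
    by (intro compact_imp_bounded compact_continuous_image h'c compact_cbox)
  then obtain K where K: "0 < K" "\<forall>y\<in>h' ` cbox L R. norm y \<le> K"
    unfolding bounded_pos by blast
  have "K-lipschitz_on (box L R) h"
  proof (rule lipschitz_onI)
    fix x y assume xy: "x \<in> box L R" "y \<in> box L R"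
    have "norm (h x - h y) \<le> K * norm (x - y)"
    proof (rule differentiable_bound[OF convex_box(2)[of L R]])
      show "(h has_derivative blinfun_apply (h' z)) (at z within box L R)" if "z \<in> box L R" for z
        using h'[OF that] by (rule has_derivative_at_withinI)
      show "onorm (blinfun_apply (h' z)) \<le> K" if "z \<in> box L R" for z
      proof -
        have "h' z \<in> h' ` cbox L R" using box_subset_cbox[of L R] that by blast
        then show ?thesis unfolding norm_blinfun.rep_eq[symmetric] using K(2) by blast
      qed
    qed (use xy in auto)
    then show "dist (h x) (h y) \<le> K * dist x y" by (simp add: dist_norm)
  qed (use K in simp)
  from lipschitz_on_closure[OF this cont] have lip: "K-lipschitz_on (cbox L R) h" unfolding cl .
  show ?thesis
  proof (rule that[of K])
    show "\<bar>h x $ i - h y $ i\<bar> \<le> K * norm (x - y)" if "x \<in> cbox L R" "y \<in> cbox L R" for x y i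
      using component_le_norm_cart[of "h x - h y" i] lipschitz_onD[OF lip that] by (simp add: dist_norm)
  qed (use K in simp)
qed

text \<open>A component of the increment is measurable with respect to the \<sigma>-algebra of the
  vector increment, so independence is inherited by passing to smaller \<sigma>-algebras.\<close>

lemma brownian_motion_component:
  fixes W :: "real \<Rightarrow> 'w \<Rightarrow> real ^ 'd"
  assumes "prob_space M" "usual_conditions M F" "brownian_motion M F W"
  shows "scalar_bm M F (\<lambda>t \<omega>. W t \<omega> $ i)"
proof -
  interpret prob_space M by fact
  note U = assms(2)[unfolded usual_conditions_def] and Bm = assms(3)[unfolded brownian_motion_def]
  have sub: "\<And>t. 0 \<le> t \<Longrightarrow> subalgebra M (F t)"
    and mono: "\<And>s t. 0 \<le> s \<Longrightarrow> s \<le> t \<Longrightarrow> sets (F s) \<subseteq> sets (F t)"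
    using conjunct1[OF U] conjunct1[OF conjunct2[OF U]] by simp_all
  have W: "\<And>t. 0 \<le> t \<Longrightarrow> W t \<in> borel_measurable (F t)"
    and ind: "\<And>s t. 0 \<le> s \<Longrightarrow> s < t \<Longrightarrow> indep_set (sets (F s)) (sets (vimage_algebra (space M) (\<lambda>\<omega>. W t \<omega> - W s \<omega>) borel))"
    and dist: "\<And>s t. 0 \<le> s \<Longrightarrow> s < t \<Longrightarrow> distributed M lborel (\<lambda>\<omega>. W t \<omega> $ i - W s \<omega> $ i) (normal_density 0 (sqrt (t - s)))"
    using conjunct1[OF Bm] conjunct2[OF conjunct2[OF conjunct2[OF Bm]]] by simp_all
  show ?thesis
  proof
    show "(\<lambda>\<omega>. W t \<omega> $ i) \<in> borel_measurable (F t)" if "0 \<le> t" for t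
      using W[OF that] borel_measurable_vec by blast
    fix s t :: real and Z :: "'w \<Rightarrow> real"
    assume st: "0 \<le> s" "s < t" and Z: "Z \<in> borel_measurable (F s)"
    let ?D = "\<lambda>\<omega>. W t \<omega> $ i - W s \<omega> $ i" and ?V = "vimage_algebra (space M) (\<lambda>\<omega>. W t \<omega> - W s \<omega>) borel"
    have spF: "space (F s) = space M" using sub[OF st(1)] by (simp add: subalgebra_def)
    have ZM: "Z \<in> borel_measurable M" by (rule measurable_from_subalg[OF sub[OF st(1)] Z])
    have DM: "?D \<in> borel_measurable M"
      using distributed_measurable[OF dist[OF st]] by simp
    have DV: "?D \<in> borel_measurable ?V"
    proof -
      have "(\<lambda>\<omega>. W t \<omega> - W s \<omega>) \<in> borel_measurable ?V"
        by (rule measurable_vimage_algebra1) simp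
      then have "\<forall>i. (\<lambda>\<omega>. (W t \<omega> - W s \<omega>) $ i) \<in> borel_measurable ?V"
        unfolding borel_measurable_vec .
      then show ?thesis unfolding vector_minus_component by blast
    qed
    have 1: "sigma_sets (space M) {Z -` A \<inter> space M |A. A \<in> sets borel} \<subseteq> sets (F s)"
      using measurable_sets[OF Z] unfolding spF[symmetric] by (intro sets.sigma_sets_subset) auto
    have 2: "sigma_sets (space M) {?D -` A \<inter> space M |A. A \<in> sets borel} \<subseteq> sets ?V"
    proof -
      have "sigma_sets (space ?V) {?D -` A \<inter> space ?V |A. A \<in> sets borel} \<subseteq> sets ?V"
        using measurable_sets[OF DV] by (intro sets.sigma_sets_subset) auto
      then show ?thesis by (simp only: space_vimage_algebra)
    qed
    have "indep_set (sigma_sets (space M) {Z -` A \<inter> space M |A. A \<in> sets borel})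
        (sigma_sets (space M) {?D -` A \<inter> space M |A. A \<in> sets borel})"
      using ind[OF st] unfolding indep_set_def by (rule indep_sets_mono_sets) (use 1 2 in \<open>auto split: bool.split\<close>)
    then show "indep_var borel Z borel ?D"
      unfolding indep_var_eq using ZM DM by blast
  qed (use sub mono dist in auto)
qed

lemma sde_solution_cong:
  assumes "\<And>x. x \<in> S \<Longrightarrow> b x = b' x" "\<And>x. x \<in> S \<Longrightarrow> \<sigma> x = \<sigma>' x" "\<And>t \<omega>. X t \<omega> \<in> S"
  shows "sde_solution M F W S b \<sigma> x\<^sub>0 X \<longleftrightarrow> sde_solution M F W S b' \<sigma>' x\<^sub>0 X"
proof -
  have "\<And>t \<omega>. b (X t \<omega>) = b' (X t \<omega>)" "\<And>t \<omega>. \<sigma> (X t \<omega>) = \<sigma>' (X t \<omega>)"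
    using assms by blast+
  then show ?thesis unfolding sde_solution_def by simp
qed

theorem theorem1:
  fixes L R :: "real ^ 'd"
    and f g G :: "real ^ 'd \<Rightarrow> real ^ 'd"
    and x\<^sub>0 :: "real ^ 'd"
    and M :: "'w measure"
    and F :: "real \<Rightarrow> 'w measure"
    and W :: "real \<Rightarrow> 'w \<Rightarrow> real ^ 'd"
  assumes "prob_space M"
    and "usual_conditions M F"
    and "brownian_motion M F W"
    and "\<And>i. L $ i < R $ i"
    and "C1_closure (box L R) f"
    and "C1_closure (box L R) g"
    and "\<And>i y. y \<in> closure (box L R) \<Longrightarrow> f (replace_coord i (L $ i) y) $ i \<ge> 0"
    and "\<And>i y. y \<in> closure (box L R) \<Longrightarrow> f (replace_coord i (R $ i) y) $ i \<le> 0"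
    and "\<And>i y. y \<in> closure (box L R) \<Longrightarrow> G y $ i = g y $ i * (y $ i - L $ i) * (R $ i - y $ i)"
    and "x\<^sub>0 \<in> box L R"
  shows "\<exists>X. strong_solution M F W (closure (box L R)) f G x\<^sub>0 X \<and>
             (\<forall>Y. sde_solution M F W (closure (box L R)) f G x\<^sub>0 Y \<longrightarrow> indistinguishable M X Y) \<and>
             (\<forall>i. measure M {\<omega>\<in>space M. \<forall>t\<ge>0. X t \<omega> $ i \<in> {L $ i<..<R $ i}} = 1)"
proof -
  interpret prob_space M by fact
  let ?S = "cbox L R"
  have ne: "box L R \<noteq> {}" using assms(10) by blast
  have cl: "closure (box L R) = ?S" by (rule closure_box[OF ne])
  note fL = assms(7)[unfolded cl] and fR = assms(8)[unfolded cl] and G = assms(9)[unfolded cl]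
  note bm = brownian_motion_component[OF assms(1-3)]
  have box: "L $ i \<le> y $ i \<and> y $ i \<le> R $ i" if "y \<in> ?S" for y i using that by (simp add: mem_box_cart)
  note fc = conjunct1[OF assms(5)[unfolded C1_closure_def cl]]
  note gc = conjunct1[OF assms(6)[unfolded C1_closure_def cl]]
  obtain Cf where Cf: "0 \<le> Cf" "\<And>x i. x \<in> ?S \<Longrightarrow> \<bar>f x $ i\<bar> \<le> Cf"
    using continuous_component_bounded_cbox[OF fc] by blast
  obtain Cg where Cg: "0 \<le> Cg" "\<And>x i. x \<in> ?S \<Longrightarrow> \<bar>g x $ i\<bar> \<le> Cg"
    using continuous_component_bounded_cbox[OF gc] by blast
  obtain Kf where Kf: "0 \<le> Kf" "\<And>x y i. x \<in> ?S \<Longrightarrow> y \<in> ?S \<Longrightarrow> \<bar>f x $ i - f y $ i\<bar> \<le> Kf * norm (x - y)"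
    using C1_closure_lipschitz[OF assms(5) ne] by blast
  obtain Kg where Kg: "0 \<le> Kg" "\<And>x y i. x \<in> ?S \<Longrightarrow> y \<in> ?S \<Longrightarrow> \<bar>g x $ i - g y $ i\<bar> \<le> Kg * norm (x - y)"
    using C1_closure_lipschitz[OF assms(6) ne] by blast
  obtain CS where CS: "\<And>x. x \<in> ?S \<Longrightarrow> norm x \<le> CS"
    using bounded_cbox[of L R] unfolding bounded_iff by blast
  \<comment> \<open>The sum of the side lengths serves as a common bound for all of them.\<close>
  define w where "w = (\<Sum>i\<in>UNIV. R $ i - L $ i)"
  have wi: "R $ i - L $ i \<le> w" for i
    unfolding w_def using assms(4) by (intro member_le_sum) (auto intro: less_imp_le)
  have w0: "0 \<le> w" using wi[of undefined] assms(4)[of undefined] by linarith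
  define p where "p y i = (y $ i - L $ i) * (R $ i - y $ i)" for y i
  have Gp: "G y $ i = g y $ i * p y i" if "y \<in> ?S" for y i using G[OF that] by (simp add: p_def)
  have p_bound: "\<bar>p y i\<bar> \<le> w * w" if "y \<in> ?S" for y i
    unfolding p_def abs_mult using box[OF that, of i] wi[of i] by (intro mult_mono) auto
  have p_lip: "\<bar>p x i - p y i\<bar> \<le> w * norm (x - y)" if "x \<in> ?S" "y \<in> ?S" for x y i
  proof -
    \<comment> \<open>The first factor is the difference of the distances of \<open>x\<close> to the
      right face and of \<open>y\<close> to the left face, so it is at most one side length in
      absolute value.\<close>
    have "p x i - p y i = (L $ i + R $ i - x $ i - y $ i) * (x - y) $ i" by (simp add: p_def algebra_simps)
    also have "\<bar>\<dots>\<bar> \<le> w * norm (x - y)"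
      unfolding abs_mult using box[OF that(1), of i] box[OF that(2), of i] wi[of i] w0
      by (intro mult_mono component_le_norm_cart) (auto simp: abs_le_iff)
    finally show ?thesis .
  qed
  have G_bound: "\<bar>G y $ i\<bar> \<le> Cg * (w * w)" if "y \<in> ?S" for y i
    unfolding Gp[OF that] abs_mult using Cg p_bound[OF that] that by (intro mult_mono) auto
  have G_lip: "\<bar>G x $ i - G y $ i\<bar> \<le> (Kg * (w * w) + Cg * w) * norm (x - y)" if xy: "x \<in> ?S" "y \<in> ?S" for x y i
  proof -
    have "G x $ i - G y $ i = (g x $ i - g y $ i) * p x i + g y $ i * (p x i - p y i)"
      unfolding Gp[OF xy(1)] Gp[OF xy(2)] by (simp add: algebra_simps)
    also have "\<bar>\<dots>\<bar> \<le> \<bar>g x $ i - g y $ i\<bar> * \<bar>p x i\<bar> + \<bar>g y $ i\<bar> * \<bar>p x i - p y i\<bar>"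
      unfolding abs_mult[symmetric] by (rule abs_triangle_ineq)
    also have "\<dots> \<le> (Kg * norm (x - y)) * (w * w) + Cg * (w * norm (x - y))"
      using Kg Cg xy p_bound p_lip by (intro add_mono mult_mono) auto
    finally show ?thesis by (simp add: algebra_simps)
  qed
  define C where "C = max CS (max Cf (Cg * (w * w)))"
  define K where "K = max Kf (Kg * (w * w) + Cg * w)"
  have C: "CS \<le> C" "Cf \<le> C" "Cg * (w * w) \<le> C" by (auto simp: C_def)
  have K: "Kf \<le> K" "Kg * (w * w) + Cg * w \<le> K" by (auto simp: K_def)
  have K0: "0 \<le> K" using Kf(1) K(1) by linarith
  have f_bd: "\<bar>f x $ i\<bar> \<le> C" and G_bd: "\<bar>G x $ i\<bar> \<le> C" and S_bd: "norm x \<le> C" if "x \<in> ?S" for x i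
    using Cf(2)[OF that, of i] G_bound[OF that, of i] CS[OF that] C by linarith+
  have f_li: "\<bar>f x $ i - f y $ i\<bar> \<le> K * norm (x - y)" and G_li: "\<bar>G x $ i - G y $ i\<bar> \<le> K * norm (x - y)"
    if "x \<in> ?S" "y \<in> ?S" for x y i
    using Kf(2)[OF that, of i] G_lip[OF that, of i] mult_right_mono[OF K(1) norm_ge_zero, of "x - y"]
      mult_right_mono[OF K(2) norm_ge_zero, of "x - y"] by linarith+
  let ?c = "clamp_box L R"
  have cS: "?c x \<in> ?S" for x using assms(4) by (intro clamp_box_in) (auto intro: less_imp_le)
  have c_li: "K * norm (?c x - ?c y) \<le> K * norm (x - y)" for x y
    by (intro mult_left_mono norm_clamp_box_diff K0)
  interpret E: euler_scheme M F W "\<lambda>x. f (?c x)" "\<lambda>x. G (?c x)" x\<^sub>0 C K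
  proof (intro euler_scheme.intro euler_scheme_axioms.intro)
    show "prob_space M" by fact
    show "AE \<omega> in M. continuous_on {0..} (\<lambda>t. W t \<omega>)"
      using conjunct1[OF conjunct2[OF conjunct2[OF assms(3)[unfolded brownian_motion_def]]]] .
    show "\<bar>f (?c x) $ i\<bar> \<le> C" "\<bar>G (?c x) $ i\<bar> \<le> C" for x i by (rule f_bd[OF cS] G_bd[OF cS])+
    show "\<bar>f (?c x) $ i - f (?c y) $ i\<bar> \<le> K * norm (x - y)" "\<bar>G (?c x) $ i - G (?c y) $ i\<bar> \<le> K * norm (x - y)" for x y i
      by (rule order_trans[OF f_li[OF cS cS] c_li] order_trans[OF G_li[OF cS cS] c_li])+
  qed (rule bm)
  have rep: "replace_coord i r y - y = axis i (r - y $ i)" for i r and y :: "real ^ 'd"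
    by (simp add: replace_coord_def axis_def vec_eq_iff)
  have norm_axis: "norm (axis i r :: real ^ 'd) = \<bar>r\<bar>" for i r
    by (simp add: norm_eq_sqrt_inner inner_axis_axis)
  \<comment> \<open>\<open>K\<close> serves the drift near a face; \<open>Cg * w\<close> serves the
    diffusion, where one of the two distances in \<open>G\<close> is bounded by \<open>w\<close> and
    the other one is retained.\<close>
  define \<kappa> where "\<kappa> = max K (Cg * w)"
  have \<kappa>: "0 \<le> \<kappa>" "K \<le> \<kappa>" "Cg * w \<le> \<kappa>" using K0 by (auto simp: \<kappa>_def)
  have low: "AE \<omega> in M. \<forall>t\<ge>0. 0 < 1 * (E.euler_limit t \<omega> $ i - L $ i)" for i
  proof (rule E.euler_limit_interior[OF _ \<kappa>(1)])
    fix x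
    let ?y = "?c x"
    have y: "L $ i \<le> ?y $ i" "?y $ i \<le> R $ i" "?y $ i - L $ i \<le> max 0 (1 * (x $ i - L $ i))"
      using box[OF cS[of x], of i] assms(4)[of i] by (auto simp: clamp_box_def)
    have rS: "replace_coord i (L $ i) ?y \<in> ?S"
      using cS[of x] assms(4) by (auto simp: mem_box_cart replace_coord_def intro: less_imp_le)
    \<comment> \<open>Moving along coordinate \<open>i\<close> to the face changes \<open>f\<close>
      by at most \<open>K\<close> times the distance, and on the face this component is nonnegative.
      The clamped distance is at most the positive part of the original one.\<close>
    have "\<bar>f (replace_coord i (L $ i) ?y) $ i - f ?y $ i\<bar> \<le> K * norm (axis i (L $ i - ?y $ i))"
      unfolding rep[symmetric] by (rule f_li[OF rS cS])
    also have "norm (axis i (L $ i - ?y $ i)) = ?y $ i - L $ i" using y by (simp add: norm_axis)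
    finally have "- (K * (?y $ i - L $ i)) \<le> f ?y $ i" using fL[OF cS[of x], of i] by linarith
    moreover have "K * (?y $ i - L $ i) \<le> \<kappa> * max 0 (1 * (x $ i - L $ i))"
      using \<kappa> K0 y by (intro mult_mono) auto
    ultimately show "- \<kappa> * max 0 (1 * (x $ i - L $ i)) \<le> 1 * f ?y $ i" by simp
    have "\<bar>G ?y $ i\<bar> = \<bar>g ?y $ i\<bar> * (R $ i - ?y $ i) * (?y $ i - L $ i)"
      unfolding Gp[OF cS] p_def abs_mult using y by simp
    also have "\<dots> \<le> (Cg * w) * max 0 (1 * (x $ i - L $ i))"
      using y wi[of i] Cg cS by (intro mult_mono mult_nonneg_nonneg w0) auto
    also have "\<dots> \<le> \<kappa> * max 0 (1 * (x $ i - L $ i))" using \<kappa> by (intro mult_right_mono) auto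
    finally show "\<bar>G ?y $ i\<bar> \<le> \<kappa> * max 0 (1 * (x $ i - L $ i))" .
  qed (use assms(10) in \<open>auto simp: mem_box_cart\<close>)
  \<comment> \<open>Mirror image of the lower face, with sign - 1.\<close>
  have high: "AE \<omega> in M. \<forall>t\<ge>0. 0 < (- 1) * (E.euler_limit t \<omega> $ i - R $ i)" for i
  proof (rule E.euler_limit_interior[OF _ \<kappa>(1)])
    fix x
    let ?y = "?c x"
    have y: "L $ i \<le> ?y $ i" "?y $ i \<le> R $ i" "R $ i - ?y $ i \<le> max 0 ((- 1) * (x $ i - R $ i))"
      using box[OF cS[of x], of i] assms(4)[of i] by (auto simp: clamp_box_def)
    have rS: "replace_coord i (R $ i) ?y \<in> ?S"
      using cS[of x] assms(4) by (auto simp: mem_box_cart replace_coord_def intro: less_imp_le)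
    have "\<bar>f (replace_coord i (R $ i) ?y) $ i - f ?y $ i\<bar> \<le> K * norm (axis i (R $ i - ?y $ i))"
      unfolding rep[symmetric] by (rule f_li[OF rS cS])
    also have "norm (axis i (R $ i - ?y $ i)) = R $ i - ?y $ i" using y by (simp add: norm_axis)
    finally have "f ?y $ i \<le> K * (R $ i - ?y $ i)" using fR[OF cS[of x], of i] by linarith
    moreover have "K * (R $ i - ?y $ i) \<le> \<kappa> * max 0 ((- 1) * (x $ i - R $ i))"
      using \<kappa> K0 y by (intro mult_mono) auto
    ultimately show "- \<kappa> * max 0 ((- 1) * (x $ i - R $ i)) \<le> (- 1) * f ?y $ i" by simp
    have "\<bar>G ?y $ i\<bar> = \<bar>g ?y $ i\<bar> * (?y $ i - L $ i) * (R $ i - ?y $ i)"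
      unfolding Gp[OF cS] p_def abs_mult using y by simp
    also have "\<dots> \<le> (Cg * w) * max 0 ((- 1) * (x $ i - R $ i))"
      using y wi[of i] Cg cS by (intro mult_mono mult_nonneg_nonneg w0) auto
    also have "\<dots> \<le> \<kappa> * max 0 ((- 1) * (x $ i - R $ i))" using \<kappa> by (intro mult_right_mono) auto
    finally show "\<bar>G ?y $ i\<bar> \<le> \<kappa> * max 0 ((- 1) * (x $ i - R $ i))" .
  qed (use assms(10) in \<open>auto simp: mem_box_cart\<close>)
  have "AE \<omega> in M. \<forall>i. \<forall>t\<ge>0. L $ i < E.euler_limit t \<omega> $ i \<and> E.euler_limit t \<omega> $ i < R $ i"
  proof -
    have "AE \<omega> in M. \<forall>t\<ge>0. L $ i < E.euler_limit t \<omega> $ i \<and> E.euler_limit t \<omega> $ i < R $ i" for i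
      using low[of i] high[of i] by eventually_elim auto
    then show ?thesis unfolding AE_all_countable by blast
  qed
  then have interior: "AE \<omega> in M. \<forall>t\<ge>0. E.euler_limit t \<omega> \<in> box L R"
    by eventually_elim (auto simp: mem_box_cart)
  have null: "N \<in> sets (F 0)" if "N \<in> null_sets M" for N
    using conjunct2[OF conjunct2[OF conjunct2[OF assms(2)[unfolded usual_conditions_def]]]] that by blast
  have W_adapted: "W t \<in> borel_measurable (F t)" if "0 \<le> t" for t
    using conjunct1[OF assms(3)[unfolded brownian_motion_def]] that by simp
  obtain X where X: "sde_solution M F W ?S (\<lambda>x. f (?c x)) (\<lambda>x. G (?c x)) x\<^sub>0 X" "\<And>t \<omega>. X t \<omega> \<in> box L R"
    "\<And>t. 0 \<le> t \<Longrightarrow> X t \<in> borel_measurable (completed_natural_filtration M W t)"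
    using E.euler_limit_solution[OF null W_adapted interior assms(10) box_subset_cbox[of L R]] by blast
  \<comment> \<open>The process stays in the box, where clamping is the identity, so it solves the
    original equation.\<close>
  have sol: "sde_solution M F W ?S f G x\<^sub>0 X"
  proof (rule sde_solution_cong[THEN iffD1, OF _ _ _ X(1)])
    show "X t \<omega> \<in> ?S" for t \<omega> using X(2) box_subset_cbox by blast
  qed (simp_all add: clamp_box_id)
  \<comment> \<open>Continuity on the box is read off from the clamped coefficient, which is
    Lipschitz on the whole space.\<close>
  have Gc: "continuous_on ?S G"
  proof -
    have "continuous_on ?S (\<lambda>x. G (?c x))"
      unfolding continuous_on_componentwise[of _ "\<lambda>x. G (?c x)"]
      using E.\<sigma>_component_continuous by (auto simp: Basis_vec_def inner_axis)
    then show ?thesis by (simp add: clamp_box_id cong: continuous_on_cong_simp)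
  qed
  have "indistinguishable M X Y" if "sde_solution M F W ?S f G x\<^sub>0 Y" for Y
    by (rule sde_pathwise_unique[OF bm closed_cbox fc Gc S_bd f_bd G_bd f_li G_li sol that])
  moreover have "strong_solution M F W ?S f G x\<^sub>0 X"
    unfolding strong_solution_def using sol X(3) by blast
  moreover have "measure M {\<omega>\<in>space M. \<forall>t\<ge>0. X t \<omega> $ i \<in> {L $ i<..<R $ i}} = 1" for i
  proof -
    \<comment> \<open>The process lies in the open box for every outcome, so the event is the whole
      space; this also settles its measurability, which is not evident for a condition on
      uncountably many times.\<close>
    have "{\<omega>\<in>space M. \<forall>t\<ge>0. X t \<omega> $ i \<in> {L $ i<..<R $ i}} = space M"
      using X(2) by (auto simp: mem_box_cart)
    then show ?thesis by (simp add: prob_space)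
  qed
  ultimately show ?thesis unfolding cl by blast
qed

end
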